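(* Let $\alpha$ be an integer with $\alpha\notin\{0,1,2\}$, let $p$ be a prime factor of $\alpha-1$, let $m=v_p(\alpha-1)$, and let $J$ be the Sylow $p$-subgroup of the Macdonald group $G(\alpha)$, with elements $A,B,C\in J$ as defined in the context. Then every element of $J$ can be written uniquely in the form $A^iB^jC^k$ with $0\le i<i_0$, $0\le j<j_0$, $0\le k<k_0$, where (Case 1) $(i_0,j_0,k_0)=(p^{3m},p^{2m},p^{2m})$, in which case $|J|=p^{7m}$; (Case 2) $(i_0,j_0,k_0)=(2^{3m-1},2^{2m-1},2^{2m-1})$, in which case $|J|=2^{7m-3}$; (Case 3) $(i_0,j_0,k_0)=(81,27,27)$, in which case $|J|=3^{10}$.
   Context: For elements $a,b$ of a group, $[a,b]=a^{-1}b^{-1}ab$ and $b^a=a^{-1}ba$. The Macdonald group is $G(\alpha)=\langle A,B\mid A^{[A,B]}=A^\alpha,\ B^{[B,A]}=B^\alpha\rangle$; for $\alpha\notin\{0,1,2\}$ it is finite and nilpotent, hence the direct product of its Sylow subgroups. $J$ is the Sylow $p$-subgroup; by abuse of notation $A,B\in J$ denote the images of the two generators of $G(\alpha)$ under the projection $G(\alpha)\to J$ (so $A,B$ generate $J$), and $C=[A,B]\in J$. $v_p$ denotes the $p$-adic valuation. Case 1: either $p>3$, or $p=3$ and ($m>1$ or $(\alpha-1)/3\equiv 1 \bmod 3$). Case 2: $p=2$. Case 3: $p=3$, $m=1$, and $(\alpha-1)/3\equiv -1\bmod 3$. *)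

theory Defs
  imports
    "HOL-Algebra.Generated_Groups"
    "HOL-Number_Theory.Cong"
begin

text \<open>
  A letter \<open>(g, False)\<close> stands for the generator \<open>g\<close>, and \<open>(g, True)\<close> for its formal inverse.
  Every element of the type \<open>'g\<close> is a generator.
\<close>

type_synonym 'g gword = "('g \<times> bool) list"

definition inv_word :: "'g gword \<Rightarrow> 'g gword" where
  "inv_word w = rev (map (\<lambda>(g, b). (g, \<not> b)) w)"

definition pow_word :: "'g gword \<Rightarrow> int \<Rightarrow> 'g gword" where
  "pow_word w k =
    (if k \<ge> 0 then concat (replicate (nat k) w)
     else concat (replicate (nat (- k)) (inv_word w)))"

definition conj_word :: "'g gword \<Rightarrow> 'g gword \<Rightarrow> 'g gword" where
  "conj_word w u = inv_word u @ w @ u"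

definition comm_word :: "'g gword \<Rightarrow> 'g gword \<Rightarrow> 'g gword" where
  "comm_word u v = inv_word u @ inv_word v @ u @ v"

text \<open>
  \<open>pres_eq R\<close> is the least congruence on words that contains the relations \<open>u = v\<close> for
  \<open>(u, v) \<in> R\<close> and makes each letter inverse to its formal inverse.
\<close>

inductive pres_eq :: "('g gword \<times> 'g gword) set \<Rightarrow> 'g gword \<Rightarrow> 'g gword \<Rightarrow> bool"
  for R where
  rel: "(u, v) \<in> R \<Longrightarrow> pres_eq R u v"
| cancel: "pres_eq R [(g, b), (g, \<not> b)] []"
| refl: "pres_eq R u u"
| sym: "pres_eq R u v \<Longrightarrow> pres_eq R v u"
| trans: "pres_eq R u v \<Longrightarrow> pres_eq R v w \<Longrightarrow> pres_eq R u w"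
| append: "pres_eq R u u' \<Longrightarrow> pres_eq R v v' \<Longrightarrow> pres_eq R (u @ v) (u' @ v')"

definition pres_class :: "('g gword \<times> 'g gword) set \<Rightarrow> 'g gword \<Rightarrow> 'g gword set" where
  "pres_class R u = {v. pres_eq R u v}"

definition presented_group :: "('g gword \<times> 'g gword) set \<Rightarrow> 'g gword set monoid" where
  "presented_group R =
    \<lparr>carrier = range (pres_class R),
     monoid.mult = (\<lambda>X Y. \<Union>u\<in>X. \<Union>v\<in>Y. pres_class R (u @ v)),
     monoid.one = pres_class R []\<rparr>"

lemma pres_class_eq_iff: "pres_class R u = pres_class R v \<longleftrightarrow> pres_eq R u v"
  unfolding pres_class_def by (blast intro: pres_eq.refl pres_eq.sym pres_eq.trans)

lemma mult_pres_class:
  "pres_class R u \<otimes>\<^bsub>presented_group R\<^esub> pres_class R v = pres_class R (u @ v)"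
proof -
  have "pres_class R (u' @ v') = pres_class R (u @ v)"
    if "u' \<in> pres_class R u" "v' \<in> pres_class R v" for u' v'
    using that unfolding pres_class_eq_iff
    by (simp add: pres_class_def pres_eq.append pres_eq.sym)
  moreover have "u \<in> pres_class R u" "v \<in> pres_class R v"
    by (auto simp: pres_class_def intro: pres_eq.refl)
  ultimately have "(\<Union>u'\<in>pres_class R u. \<Union>v'\<in>pres_class R v. pres_class R (u' @ v'))
      = pres_class R (u @ v)"
    by (metis (no_types, lifting) SUP_eq_const empty_iff)
  then show ?thesis
    by (simp add: presented_group_def)
qed

lemma pres_eq_inv_left: "pres_eq R (inv_word w @ w) []"
proof (induction w)
  case Nil
  then show ?case by (simp add: inv_word_def pres_eq.refl)
next
  case (Cons x w)
  obtain g b where x: "x = (g, b)" by (cases x)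
  have "pres_eq R ([(g, \<not> b), (g, b)] @ w) ([] @ w)"
    using pres_eq.cancel[of R g "\<not> b"] by (intro pres_eq.append pres_eq.refl) simp
  then have "pres_eq R (inv_word w @ ([(g, \<not> b), (g, b)] @ w)) (inv_word w @ ([] @ w))"
    by (rule pres_eq.append[OF pres_eq.refl])
  then have "pres_eq R (inv_word (x # w) @ (x # w)) (inv_word w @ w)"
    by (simp add: x inv_word_def)
  then show ?case
    using Cons by (rule pres_eq.trans)
qed

lemma group_presented_group: "group (presented_group R)"
proof (rule groupI)
  show "\<one>\<^bsub>presented_group R\<^esub> \<in> carrier (presented_group R)"
    by (simp add: presented_group_def)
  fix X assume X: "X \<in> carrier (presented_group R)"
  then obtain u where u: "X = pres_class R u" by (auto simp: presented_group_def)
  have one: "\<one>\<^bsub>presented_group R\<^esub> = pres_class R []" by (simp add: presented_group_def)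
  have "pres_class R (inv_word u) \<otimes>\<^bsub>presented_group R\<^esub> X = \<one>\<^bsub>presented_group R\<^esub>"
    by (simp add: u one mult_pres_class pres_class_eq_iff pres_eq_inv_left)
  then show "\<exists>Y\<in>carrier (presented_group R). Y \<otimes>\<^bsub>presented_group R\<^esub> X = \<one>\<^bsub>presented_group R\<^esub>"
    by (auto simp: presented_group_def)
  show "\<one>\<^bsub>presented_group R\<^esub> \<otimes>\<^bsub>presented_group R\<^esub> X = X"
    by (simp add: u one mult_pres_class)
  fix Y assume "Y \<in> carrier (presented_group R)"
  then obtain v where v: "Y = pres_class R v" by (auto simp: presented_group_def)
  show "X \<otimes>\<^bsub>presented_group R\<^esub> Y \<in> carrier (presented_group R)"
    unfolding u v mult_pres_class by (simp add: presented_group_def)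
  fix Z assume "Z \<in> carrier (presented_group R)"
  then obtain w where w: "Z = pres_class R w" by (auto simp: presented_group_def)
  show "X \<otimes>\<^bsub>presented_group R\<^esub> Y \<otimes>\<^bsub>presented_group R\<^esub> Z
      = X \<otimes>\<^bsub>presented_group R\<^esub> (Y \<otimes>\<^bsub>presented_group R\<^esub> Z)"
    by (simp add: u v w mult_pres_class)
qed

datatype macdonald_gen = GenA | GenB

abbreviation gen_word :: "'g \<Rightarrow> 'g gword" where
  "gen_word g \<equiv> [(g, False)]"

definition macdonald_rels :: "int \<Rightarrow> (macdonald_gen gword \<times> macdonald_gen gword) set" where
  "macdonald_rels \<alpha> =
    (let a = gen_word GenA; b = gen_word GenB in
      {(conj_word a (comm_word a b), pow_word a \<alpha>),
       (conj_word b (comm_word b a), pow_word b \<alpha>)})"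

definition macdonald_group :: "int \<Rightarrow> macdonald_gen gword set monoid" where
  "macdonald_group \<alpha> = presented_group (macdonald_rels \<alpha>)"

definition macdonald_gen_elt :: "int \<Rightarrow> macdonald_gen \<Rightarrow> macdonald_gen gword set" where
  "macdonald_gen_elt \<alpha> g = pres_class (macdonald_rels \<alpha>) (gen_word g)"

definition commutator :: "('a, 'b) monoid_scheme \<Rightarrow> 'a \<Rightarrow> 'a \<Rightarrow> 'a" where
  "commutator G x y = inv\<^bsub>G\<^esub> x \<otimes>\<^bsub>G\<^esub> inv\<^bsub>G\<^esub> y \<otimes>\<^bsub>G\<^esub> x \<otimes>\<^bsub>G\<^esub> y"

text \<open>
  Intended for finite \<open>G\<close>. If \<open>G\<close> is infinite then \<open>order G = 0\<close>, and only the trivial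
  subgroup qualifies; thus assuming \<open>sylow_subgroup G p H\<close> does not assume that \<open>G\<close> is finite.
\<close>

definition sylow_subgroup :: "('a, 'b) monoid_scheme \<Rightarrow> nat \<Rightarrow> 'a set \<Rightarrow> bool" where
  "sylow_subgroup G p H \<longleftrightarrow> subgroup H G \<and> card H = p ^ multiplicity p (order G)"

text \<open>
  If \<open>G\<close> is the internal direct product of its Sylow subgroups, then \<open>sylow_proj G p J\<close> is the
  projection onto the factor \<open>J\<close>, the Sylow \<open>p\<close>-subgroup: the complementary factor is generated
  by the Sylow \<open>q\<close>-subgroups with \<open>q \<noteq> p\<close>.
\<close>

definition sylow_complement :: "('a, 'b) monoid_scheme \<Rightarrow> nat \<Rightarrow> 'a set" where
  "sylow_complement G p =
    generate G (\<Union>{H. \<exists>q. prime q \<and> q \<noteq> p \<and> sylow_subgroup G q H})"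

definition sylow_proj :: "('a, 'b) monoid_scheme \<Rightarrow> nat \<Rightarrow> 'a set \<Rightarrow> 'a \<Rightarrow> 'a" where
  "sylow_proj G p J x = (THE y. y \<in> J \<and> (\<exists>z\<in>sylow_complement G p. x = y \<otimes>\<^bsub>G\<^esub> z))"

definition unique_normal_form ::
  "('a, 'b) monoid_scheme \<Rightarrow> 'a set \<Rightarrow> 'a \<Rightarrow> 'a \<Rightarrow> 'a \<Rightarrow> nat \<Rightarrow> nat \<Rightarrow> nat \<Rightarrow> bool" where
  "unique_normal_form G J A B C i\<^sub>0 j\<^sub>0 k\<^sub>0 \<longleftrightarrow>
    (\<forall>x\<in>J. \<exists>!(i, j, k). i < i\<^sub>0 \<and> j < j\<^sub>0 \<and> k < k\<^sub>0 \<and>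
      x = A [^]\<^bsub>G\<^esub> i \<otimes>\<^bsub>G\<^esub> B [^]\<^bsub>G\<^esub> j \<otimes>\<^bsub>G\<^esub> C [^]\<^bsub>G\<^esub> k)"

end

theory Submission
  imports
    Defs
    "HOL-Number_Theory.Number_Theory"
    "HOL-Algebra.Group_Action"
    "HOL-Algebra.Sylow"
begin

text \<open>
  Put \<open>C = [A, B]\<close>, \<open>s n = \<alpha> + \<dots> + \<alpha>\<^sup>n\<close> and \<open>w n = n \<alpha>\<^sup>n - s n\<close>. The relations give
  \<open>A\<^sup>n B = B C\<^sup>n A\<^bsup>s n\<^esup>\<close>, hence every element has the form \<open>B\<^sup>j C\<^sup>k A\<^sup>i\<close>. Writing \<open>A C\<^sup>k B\<close> in this form
  in two ways shows, for \<open>b = \<alpha>\<^sup>k > 0\<close>, that \<open>A\<close> to the power \<open>w b\<close> is central and inverse to the same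
  power of \<open>B\<close>, and that \<open>A\<close> has order dividing \<open>w b (\<alpha> - 1)\<close>. So the generators have finite order,
  divisible only by primes dividing \<open>\<alpha> - 1\<close>; their \<open>p\<close>-parts commute with their \<open>p'\<close>-parts and again
  satisfy the relations, which splits the group. If \<open>p\<^sup>v\<close> is the least power of \<open>p\<close> exactly dividing one
  of the numbers \<open>w b\<close>, the \<open>p\<close>-part has at most \<open>p\<^bsup>3 v + m\<^esup>\<close> elements. Conversely, the right
  multiplications by \<open>A\<close>, \<open>B\<close>, \<open>C\<close> read off from the form \<open>B\<^sup>j C\<^sup>k A\<^sup>i\<close> are permutations of a set of
  \<open>p\<^bsup>3 v + m\<^esup>\<close> triples that satisfy the relations, so the bound is attained.
\<close>

section \<open>Power sums and their defect\<close>

text \<open>The exponents \<open>a ^ t\<close> and s t in the relations depend on \<open>t\<close>,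
  which is itself an exponent and so known only modulo the order of a generator. They are well
  defined modulo that order once each of its prime factors divides \<open>a - 1\<close>. This is why
  the primes dividing the orders must be settled before anything can be split or counted. The size
  of the group is the valuation of w b for b = a^k. As a polynomial in q = a - 1 the defect starts
  with half of a b (b - 1) q. Both b - 1 and q have valuation at least m, with equality for k = 1,
  which explains 2m, and the halving explains 2m - 1 for p = 2. For p = 3 and m = 1 the next term
  has denominator 3 and competes with the first; together they carry the factor 1 + 2h(a^k - 2) with
  h = (a - 1)/3, which is divisible by 3 just when h = -1 modulo 3. It is divisible by 9 for at most
  one of k = 1 and k = 2, hence v = 3 in Case 3. Powers a^k have to be positive to count factors. In
  a group of finite exponent only the residue of the parameter matters, so it is replaced by a
  congruent integer that is at least 2.\<close>

definition pow_sum :: "int \<Rightarrow> nat \<Rightarrow> int" where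
  "pow_sum a n = (\<Sum>j=1..n. a ^ j)"

definition defect :: "int \<Rightarrow> nat \<Rightarrow> int" where
  "defect a n = int n * a ^ n - pow_sum a n"

lemma pow_sum_0 [simp]: "pow_sum a 0 = 0"
  by (simp add: pow_sum_def)

lemma pow_sum_1 [simp]: "pow_sum a (Suc 0) = a"
  by (simp add: pow_sum_def)

lemma pow_sum_Suc: "pow_sum a (Suc n) = pow_sum a n + a ^ Suc n"
  by (simp add: pow_sum_def)

lemma pow_sum_add: "pow_sum a (m + n) = pow_sum a m + a ^ m * pow_sum a n"
  by (induction n) (simp_all add: pow_sum_Suc algebra_simps power_add)

lemma pow_sum_geometric: "(a - 1) * pow_sum a n = a * (a ^ n - 1)"
  by (induction n) (simp_all add: pow_sum_Suc algebra_simps)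

lemma pow_sum_mult: "pow_sum a (m * n) = pow_sum a m * (\<Sum>i<n. a ^ (m * i))"
proof (induction n)
  case (Suc n)
  have "pow_sum a (m * Suc n) = pow_sum a (m * n) + a ^ (m * n) * pow_sum a m"
    using pow_sum_add[of a "m * n" m] by (simp add: add.commute)
  then show ?case
    using Suc by (simp add: algebra_simps)
qed simp

lemma pow_sum_cong: "[a = b] (mod m) \<Longrightarrow> [pow_sum a n = pow_sum b n] (mod m)"
  unfolding pow_sum_def by (intro cong_sum cong_pow)

lemma power_cong_1:
  fixes a :: int assumes "m dvd a - 1" shows "m dvd a ^ n - 1"
proof -
  have "[a ^ n = 1 ^ n] (mod m)"
    using assms by (intro cong_pow) (simp add: cong_iff_dvd_diff)
  then show ?thesis by (simp add: cong_iff_dvd_diff)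
qed

text \<open>With \<open>x = a - 1\<close> this is the condition under which \<open>a ^ t\<close> and
  \<open>pow_sum a t\<close> modulo \<open>D\<close> depend only on \<open>t\<close> modulo
  \<open>D\<close>. It passes to factors of \<open>D\<close>, and covers both powers of
  \<open>p\<close> and the orders of the generators.\<close>

definition radical_dvd :: "nat \<Rightarrow> int \<Rightarrow> bool" where
  "radical_dvd D x \<longleftrightarrow> D > 0 \<and> (\<forall>l. prime l \<and> l dvd D \<longrightarrow> int l dvd x)"

lemma radical_dvdD: "radical_dvd D x \<Longrightarrow> prime l \<Longrightarrow> l dvd D \<Longrightarrow> int l dvd x"
  unfolding radical_dvd_def by blast

lemma radical_dvd_prime_power:
  assumes "int p dvd x" "prime p" shows "radical_dvd (p ^ k) x"
proof -
  have "l = p" if "prime l" "l dvd p ^ k" for l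
    using that assms(2) prime_dvd_power primes_dvd_imp_eq by blast
  then show ?thesis
    using assms by (auto simp: radical_dvd_def prime_gt_0_nat)
qed

lemma radical_dvd_multD: "radical_dvd (a * b) x \<Longrightarrow> radical_dvd a x \<and> radical_dvd b x"
  unfolding radical_dvd_def by (meson dvd_mult dvd_mult2 nat_0_less_mult_iff)

text \<open>Split off a prime, \<open>D = E * l\<close>: \<open>pow_sum_mult\<close> leaves
  \<open>pow_sum a E\<close>, divisible by \<open>E\<close> by induction, times a sum of
  \<open>l\<close> powers of \<open>a\<close>, each of which is 1 modulo \<open>l\<close>.\<close>

lemma dvd_pow_sum_self: "radical_dvd D (a - 1) \<Longrightarrow> int D dvd pow_sum a D"
proof (induction D rule: less_induct)
  case (less D)
  show ?case
  proof (cases "D = 1")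
    case False
    then obtain l where l: "prime l" "l dvd D"
      using prime_factor_nat by blast
    then obtain E where E: "D = E * l" by (auto simp: mult.commute)
    have "D > 0" using less.prems unfolding radical_dvd_def by blast
    then have "E < D"
      using prime_gt_1_nat[OF l(1)] by (simp add: E)
    moreover have "radical_dvd E (a - 1)"
      using less.prems radical_dvd_multD unfolding E by blast
    ultimately have "int E dvd pow_sum a E"
      by (rule less.IH)
    moreover have "int l dvd (\<Sum>i<l. a ^ (E * i))"
    proof -
      have "[(\<Sum>i<l. a ^ (E * i)) = (\<Sum>i<l. 1)] (mod int l)"
        using radical_dvdD[OF less.prems l]
        by (intro cong_sum) (simp add: cong_iff_dvd_diff power_cong_1)
      then have "int l dvd (\<Sum>i<l. a ^ (E * i)) - int l + int l"
        by (intro dvd_add) (simp_all add: cong_iff_dvd_diff)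
      then show ?thesis by simp
    qed
    ultimately show ?thesis
      unfolding E pow_sum_mult by (simp add: mult_dvd_mono)
  qed simp
qed

lemma radical_dvd_coprime:
  assumes "radical_dvd D (a - 1)" shows "coprime (int D) a"
proof (rule ccontr)
  assume "\<not> coprime (int D) a"
  then have "nat (gcd (int D) a) \<noteq> 1"
    by (auto simp: coprime_iff_gcd_eq_1)
  then obtain l where l: "prime l" "l dvd nat (gcd (int D) a)"
    using prime_factor_nat by blast
  then have "int l dvd int (nat (gcd (int D) a))"
    by (simp only: int_dvd_int_iff)
  then have "int l dvd gcd (int D) a" by simp
  then have "int l dvd int D" "int l dvd a" by auto
  then have "int l dvd a - (a - 1)"
    using radical_dvdD[OF assms l(1)] dvd_diff[of "int l" a "a - 1"] by simp
  then show False using l(1) by auto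
qed

text \<open>Geometric summation turns divisibility of the power sum into divisibility of
  \<open>a * (a ^ D - 1)\<close>, and \<open>a\<close> is a unit modulo \<open>D\<close>.\<close>

lemma dvd_power_diff_1:
  assumes "radical_dvd D (a - 1)" "D dvd t" shows "int D dvd a ^ t - 1"
proof -
  have "int D dvd a * (a ^ D - 1)"
    using dvd_mult[OF dvd_pow_sum_self[OF assms(1)], of "a - 1"] by (simp only: pow_sum_geometric)
  then have "int D dvd a ^ D - 1"
    using coprime_dvd_mult_right_iff[OF radical_dvd_coprime[OF assms(1)]] by metis
  then have "int D dvd (a ^ D) ^ (t div D) - 1" by (rule power_cong_1)
  then show ?thesis using assms(2) by (simp flip: power_mult)
qed

lemma dvd_pow_sum:
  assumes "radical_dvd D (a - 1)" "D dvd t" shows "int D dvd pow_sum a t"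
  using assms(2) dvd_pow_sum_self[OF assms(1)] by (auto simp: pow_sum_mult)

lemma pow_sum_periodic:
  assumes "radical_dvd D (a - 1)" "[s = t] (mod D)"
  shows "[pow_sum a s = pow_sum a t] (mod int D)"
proof -
  have *: "[pow_sum a (s + D * k) = pow_sum a s] (mod int D)" for s k
    using dvd_pow_sum[OF assms(1), of "D * k"]
    by (simp add: pow_sum_add cong_iff_dvd_diff)
  show ?thesis
  proof -
    obtain k l where "t + k * D = s + l * D"
      using assms(2) by (auto simp: cong_iff_lin_nat)
    then have "[pow_sum a (s + D * l) = pow_sum a (t + D * k)] (mod int D)"
      by (simp add: mult.commute)
    then show ?thesis using * by (metis cong_sym cong_trans)
  qed
qed

lemma power_periodic:
  assumes "radical_dvd D (a - 1)" "[s = t] (mod D)"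
  shows "[a ^ s = a ^ t] (mod int D)"
proof -
  have *: "[a ^ (s + D * k) = a ^ s] (mod int D)" for s k
  proof -
    have "a ^ (s + D * k) - a ^ s = a ^ s * (a ^ (D * k) - 1)" by (simp add: power_add algebra_simps)
    then show ?thesis
    using dvd_power_diff_1[OF assms(1), of "D * k"]
    by (simp add: cong_iff_dvd_diff)
  qed
  show ?thesis
  proof -
    obtain k l where "t + k * D = s + l * D"
      using assms(2) by (auto simp: cong_iff_lin_nat)
    then have "[a ^ (s + D * l) = a ^ (t + D * k)] (mod int D)"
      by (simp add: mult.commute)
    then show ?thesis using * by (metis cong_sym cong_trans)
  qed
qed

section \<open>Expansion of the defect in powers of a - 1\<close>

lemma defect_Suc: "defect a (Suc n) = defect a n + int n * (a - 1) * a ^ n"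
  by (simp add: defect_def pow_sum_Suc algebra_simps)

text \<open>Both sides are \<open>q\<close> times the derivative of (1 + q)^n in
  \<open>q\<close>.\<close>

lemma sum_absorbed_binomial:
  fixes q :: int
  shows "(\<Sum>i<Suc n. int (Suc i) * int (n choose Suc i) * q ^ Suc i) = int n * q * (1 + q) ^ (n - 1)"
proof (cases n)
  case (Suc k)
  have "(\<Sum>i<Suc n. int (Suc i) * int (n choose Suc i) * q ^ Suc i)
      = (\<Sum>i<Suc n. int n * q * (int (k choose i) * q ^ i))"
  proof (rule sum.cong)
    fix i
    have "int (Suc i) * int (n choose Suc i) = int n * int (k choose i)"
      using binomial_absorption[of i n] by (metis Suc diff_Suc_1 of_nat_mult)
    then show "int (Suc i) * int (n choose Suc i) * q ^ Suc i = int n * q * (int (k choose i) * q ^ i)"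
      by simp
  qed simp
  also have "\<dots> = int n * q * (\<Sum>i\<le>k. int (k choose i) * q ^ i)"
    by (simp add: Suc sum_distrib_left [symmetric] lessThan_Suc_atMost)
  also have "(\<Sum>i\<le>k. int (k choose i) * q ^ i) = (1 + q) ^ k"
    using binomial_ring[of q 1 k] by (simp add: add.commute)
  finally show ?thesis by (simp add: Suc)
qed simp

text \<open>Both sides vanish at \<open>n = 0\<close> and have the same increment: on the left it is
  \<open>defect_Suc\<close>, on the right Pascal's rule produces the sum of
  \<open>sum_absorbed_binomial\<close>.\<close>

lemma defect_expansion:
  "defect a n = a * (\<Sum>i<n. int (Suc i) * int (n choose (i + 2)) * (a - 1) ^ Suc i)"
proof (induction n)
  case 0
  show ?case by (simp add: defect_def)
next
  case (Suc n)
  define q where "q = a - 1"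
  have "(\<Sum>i<Suc n. int (Suc i) * int (Suc n choose (i + 2)) * q ^ Suc i)
      = (\<Sum>i<Suc n. int (Suc i) * int (n choose (i + 2)) * q ^ Suc i)
        + (\<Sum>i<Suc n. int (Suc i) * int (n choose Suc i) * q ^ Suc i)"
    by (simp add: sum.distrib [symmetric] algebra_simps)
  also have "\<dots> = (\<Sum>i<n. int (Suc i) * int (n choose (i + 2)) * q ^ Suc i) + int n * q * (1 + q) ^ (n - 1)"
    unfolding sum_absorbed_binomial by (simp add: binomial_eq_0)
  finally have "a * (\<Sum>i<Suc n. int (Suc i) * int (Suc n choose (i + 2)) * q ^ Suc i)
      = a * ((\<Sum>i<n. int (Suc i) * int (n choose (i + 2)) * q ^ Suc i) + int n * q * (1 + q) ^ (n - 1))"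
    by (simp only:)
  also have "\<dots> = defect a n + int n * q * (a * a ^ (n - 1))"
    unfolding Suc [folded q_def] distrib_left by (simp add: q_def)
  finally have "a * (\<Sum>i<Suc n. int (Suc i) * int (Suc n choose (i + 2)) * q ^ Suc i)
      = defect a n + int n * q * (a * a ^ (n - 1))" .
  moreover have "int n * q * (a * a ^ (n - 1)) = int n * q * a ^ n"
    by (cases n) simp_all
  ultimately show ?case unfolding defect_Suc q_def [symmetric] by (simp only:)
qed

text \<open>Absorbing twice exchanges \<open>Suc i\<close> and the denominator \<open>i + 2\<close>
  for the factors \<open>Suc Q\<close> and \<open>Q\<close>. In the application
  \<open>Suc Q = a ^ k\<close>, so \<open>Q\<close> contributes to the valuation, and the only loss
  comes from \<open>i + 2\<close>.\<close>

lemma defect_term: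
  fixes q :: int
  shows "int (i + 2) * (int (Suc i) * int (Suc Q choose (i + 2)) * q ^ Suc i)
    = int (Suc Q) * int Q * int ((Q - 1) choose i) * q ^ Suc i"
proof -
  have "(i + 2) * (Suc Q choose (i + 2)) = Suc Q * (Q choose Suc i)"
    using binomial_absorption[of "Suc i" "Suc Q"] by simp
  then have "(i + 2) * (Suc i * (Suc Q choose (i + 2))) = Suc Q * (Suc i * (Q choose Suc i))"
    by (simp only: mult.left_commute)
  also have "\<dots> = Suc Q * (Q * ((Q - 1) choose i))"
    by (simp only: binomial_absorption)
  finally have "int ((i + 2) * (Suc i * (Suc Q choose (i + 2)))) = int (Suc Q * (Q * ((Q - 1) choose i)))"
    by (simp only:)
  then show ?thesis by (simp only: of_nat_mult mult.assoc [symmetric])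
qed

section \<open>Valuations of the terms of the expansion\<close>

lemma prime_power_dvd_cancel:
  fixes p r t :: int
  assumes "prime p" "p ^ (a + b) dvd r * t" "\<not> p ^ Suc b dvd r"
  shows "p ^ a dvd t"
proof (cases "t = 0")
  case False
  have r: "r \<noteq> 0" using assms(3) by auto
  have p: "\<not> is_unit p" "prime_elem p" using assms(1) by (auto simp: prime_imp_prime_elem)
  have "a + b \<le> multiplicity p (r * t)"
    using assms(2) False r p(1) by (simp add: power_dvd_iff_le_multiplicity)
  also have "\<dots> = multiplicity p r + multiplicity p t"
    using False r p(2) by (simp add: prime_elem_multiplicity_mult_distrib)
  finally have "a + b \<le> multiplicity p r + multiplicity p t" .
  moreover have "multiplicity p r < Suc b"
    using assms(3) power_dvd_iff_le_multiplicity[OF r p(1), of "Suc b"] by linarith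
  ultimately show ?thesis
    using multiplicity_dvd'[of a p t] by linarith
qed simp

lemma less_3_power: "i + 5 < 3 ^ (i + 2)" for i :: nat
  by (induction i) simp_all

lemma less_2_power: "i + 3 < 2 ^ (i + 2)" for i :: nat
  by (induction i) simp_all

lemma not_prime_power_dvd_small:
  assumes "0 < r" "r < x ^ k" "x \<le> p" shows "\<not> int p ^ k dvd int r"
proof
  assume "int p ^ k dvd int r"
  then have "p ^ k \<le> r" using assms(1) by (metis dvd_imp_le of_nat_dvd_iff of_nat_power)
  moreover have "x ^ k \<le> p ^ k" using assms(3) by (rule power_mono) simp
  ultimately show False using assms(2) by simp
qed

context
  fixes p m u Q :: nat and q :: int
  assumes p: "prime p" and q: "int p ^ m dvd q" and Q: "int p ^ u dvd int Q" and m: "1 \<le> m"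
begin

private definition T :: "nat \<Rightarrow> int" where
  "T i = int (Suc i) * int (Suc Q choose (i + 2)) * q ^ Suc i"

text \<open>\<open>Q\<close> contributes \<open>u\<close> and each of the \<open>Suc i\<close>
  factors \<open>q\<close> contributes \<open>m\<close>; \<open>b\<close> bounds the valuation of
  the denominator \<open>i + 2\<close>.\<close>

lemma defect_term_dvd:
  assumes "\<not> int p ^ Suc b dvd int (i + 2)" "c + b \<le> u + Suc i * m"
  shows "int p ^ c dvd T i"
proof (rule prime_power_dvd_cancel[OF _ _ assms(1)])
  have "int p ^ (m * Suc i) dvd q ^ Suc i"
    using dvd_power_same[OF q] by (simp only: power_mult)
  then have "int p ^ (u + Suc i * m) dvd int Q * q ^ Suc i"
    using Q by (simp only: power_add mult_dvd_mono mult.commute[of "Suc i"])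
  then have "int p ^ (u + Suc i * m) dvd int (Suc Q) * int ((Q - 1) choose i) * (int Q * q ^ Suc i)"
    by (rule dvd_mult)
  also have "\<dots> = int (i + 2) * T i"
    unfolding T_def defect_term by (simp add: mult_ac)
  finally show "int p ^ (c + b) dvd int (i + 2) * T i"
    using dvd_trans[OF le_imp_power_dvd[OF assms(2)]] by simp
qed (use p in simp)

text \<open>The valuation of \<open>i + 2\<close> is at most \<open>i - 2\<close>, which is repaid
  by the \<open>i - 2\<close> factors \<open>q\<close> beyond the third. From \<open>i = 3\<close>
  on this holds because i + 2 < 3^(i - 1); at \<open>i = 2\<close> that estimate fails, but an odd
  prime does not divide 4.\<close>

lemma defect_term_dvd_odd:
  assumes "p \<noteq> 2" "2 \<le> i" shows "int p ^ (u + 3 * m) dvd T i"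
proof (rule defect_term_dvd)
  have "3 \<le> p" using p assms(1) prime_ge_2_nat[of p] by simp
  show "\<not> int p ^ Suc (i - 2) dvd int (i + 2)"
  proof (cases "i = 2")
    case True
    have "\<not> p dvd 2 * 2"
      using prime_dvd_multD[OF p, of 2 2] dvd_imp_le[of p 2] \<open>3 \<le> p\<close> by linarith
    then have "\<not> int p dvd int (2 * 2)" by (simp only: int_dvd_int_iff not_False_eq_True)
    then show ?thesis using True by simp
  next
    case False
    then have "i + 2 < 3 ^ Suc (i - 2)"
      using less_3_power[of "i - 3"] assms(2) by (simp add: numeral_eq_Suc Suc_diff_Suc)
    then show ?thesis using \<open>3 \<le> p\<close> by (intro not_prime_power_dvd_small) simp_all
  qed
  have "(i - 2) * 1 \<le> (i - 2) * m" using m by (intro mult_left_mono) simp_all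
  moreover have "Suc i * m = (i - 2) * m + 3 * m"
    using assms(2) by (simp flip: distrib_right)
  ultimately show "u + 3 * m + (i - 2) \<le> u + Suc i * m" by linarith
qed

lemma defect_term_dvd_1:
  assumes "p \<noteq> 3" shows "int p ^ (u + 2 * m) dvd T 1"
proof (rule defect_term_dvd)
  have "\<not> p dvd 3"
  proof
    assume dvd: "p dvd 3"
    then have "p = 2"
      using prime_ge_2_nat[OF p] dvd_imp_le[OF dvd] assms by simp
    then show False using dvd by simp
  qed
  then show "\<not> int p ^ Suc 0 dvd int (1 + 2)" by (simp flip: int_dvd_int_iff)
qed simp

lemma defect_term_dvd_1_3:
  assumes "p = 3" shows "int p ^ (u + 2 * m - 1) dvd T 1"
proof (rule defect_term_dvd)
  show "\<not> int p ^ Suc 1 dvd int (1 + 2)" using assms by simp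
  show "u + 2 * m - 1 + 1 \<le> u + Suc 1 * m" using m by simp
qed

lemma defect_term_dvd_2:
  assumes "p = 2" "1 \<le> i" shows "int p ^ (u + m) dvd T i"
proof (rule defect_term_dvd)
  show "\<not> int p ^ Suc i dvd int (i + 2)"
    using less_2_power[of "i - 1"] assms
    by (intro not_prime_power_dvd_small[of _ 2]) simp_all
  have "i * 1 \<le> i * m" using m by (intro mult_left_mono) simp_all
  then show "u + m + i \<le> u + Suc i * m" by simp
qed

lemma sum_defect_terms:
  assumes "Q \<noteq> 0"
  shows "(\<Sum>i<Suc Q. T i) = T 0 + T 1 + (\<Sum>i\<in>{2..<Suc Q}. T i)"
proof -
  have "{..<Suc Q} = {0, 1} \<union> {2..<Suc Q}" using assms by auto
  then have "(\<Sum>i<Suc Q. T i) = (\<Sum>i\<in>{0, 1}. T i) + (\<Sum>i\<in>{2..<Suc Q}. T i)"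
    by (simp only:) (rule sum.union_disjoint, auto)
  then show ?thesis by simp
qed

lemma twice_first_defect_term: "2 * T 0 = int (Suc Q) * int Q * q"
  using defect_term[of 0 Q q] by (simp add: T_def)

text \<open>Doubling clears the denominator of \<open>T 0\<close>. For \<open>p = 3\<close> the term
  \<open>T 1\<close> loses one factor 3, and \<open>1 < m\<close> compensates for it. For
  \<open>p = 2\<close> the terms after \<open>T 0\<close> may fall one factor 2 short of the bound
  on \<open>E\<close>, which the doubling supplies.\<close>

lemma defect_generic:
  assumes "p = 3 \<Longrightarrow> 1 < m"
  obtains E where "2 * defect (1 + q) (Suc Q) = (1 + q) * (int (Suc Q) * int Q * q + E)"
    "int p ^ (u + m + 1) dvd E"
proof (cases "Q = 0")
  case True
  show thesis by (rule that[of 0]) (simp_all add: True defect_def)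
next
  case False
  define R where "R = T 1 + (\<Sum>i\<in>{2..<Suc Q}. T i)"
  have "2 * defect (1 + q) (Suc Q) = (1 + q) * (2 * (\<Sum>i<Suc Q. T i))"
    unfolding defect_expansion T_def by simp
  also have "2 * (\<Sum>i<Suc Q. T i) = int (Suc Q) * int Q * q + 2 * R"
    unfolding sum_defect_terms[OF False] R_def twice_first_defect_term [symmetric] by simp
  finally have eq: "2 * defect (1 + q) (Suc Q) = (1 + q) * (int (Suc Q) * int Q * q + 2 * R)" .
  show thesis
  proof (cases "p = 2")
    case True
    then have "int p ^ (u + m) dvd R"
      unfolding R_def using defect_term_dvd_2 by (intro dvd_add dvd_sum) auto
    then show thesis
      using True by (intro that[OF eq]) (simp add: mult_dvd_mono)
  next
    case p2: False
    have le: "int p ^ a dvd T i \<Longrightarrow> u + m + 1 \<le> a \<Longrightarrow> int p ^ (u + m + 1) dvd T i" for a i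
      by (rule dvd_trans[OF le_imp_power_dvd])
    have "int p ^ (u + m + 1) dvd T 1"
    proof (cases "p = 3")
      case True
      then show ?thesis using assms by (intro le[OF defect_term_dvd_1_3]) auto
    next
      case False
      then show ?thesis using m by (intro le[OF defect_term_dvd_1]) auto
    qed
    moreover have "int p ^ (u + m + 1) dvd T i" if "2 \<le> i" for i
      using that p2 m by (intro le[OF defect_term_dvd_odd]) auto
    ultimately have "int p ^ (u + m + 1) dvd R"
      unfolding R_def by (intro dvd_add dvd_sum) auto
    then show thesis by (intro that[OF eq] dvd_mult)
  qed
qed

text \<open>Here the lower bounds for the valuations of \<open>T 0\<close> and \<open>T 1\<close>
  coincide, so \<open>T 1\<close> cannot be left in the error. It is computed exactly: the 3 in
  \<open>q = 3 * h\<close> cancels its denominator.\<close>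

lemma defect_exceptional:
  assumes "p = 3" "m = 1" "q = 3 * h"
  obtains E where "2 * defect (1 + q) (Suc Q)
      = (1 + q) * (int (Suc Q) * int Q * q * (1 + 2 * h * (int Q - 1)) + E)"
    "3 ^ (u + 3) dvd E"
proof (cases "Q = 0")
  case True
  show thesis by (rule that[of 0]) (simp_all add: True defect_def)
next
  case False
  define R where "R = (\<Sum>i\<in>{2..<Suc Q}. T i)"
  have "3 * T 1 = 3 * (int (Suc Q) * int Q * q * h * (int Q - 1))"
    using defect_term[of 1 Q q, folded T_def] False by (simp add: assms(3) of_nat_diff)
  then have T1: "T 1 = int (Suc Q) * int Q * q * h * (int Q - 1)" by (simp only: mult_cancel_left) simp
  have "2 * defect (1 + q) (Suc Q) = (1 + q) * (2 * (\<Sum>i<Suc Q. T i))"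
    unfolding defect_expansion T_def by simp
  also have "2 * (\<Sum>i<Suc Q. T i) = int (Suc Q) * int Q * q + 2 * T 1 + 2 * R"
    unfolding sum_defect_terms[OF False] R_def twice_first_defect_term [symmetric] by simp
  also have "\<dots> = int (Suc Q) * int Q * q * (1 + 2 * h * (int Q - 1)) + 2 * R"
    unfolding T1 by (simp add: algebra_simps)
  finally have eq: "2 * defect (1 + q) (Suc Q)
      = (1 + q) * (int (Suc Q) * int Q * q * (1 + 2 * h * (int Q - 1)) + 2 * R)" .
  have "3 ^ (u + 3) dvd R"
    unfolding R_def using defect_term_dvd_odd assms by (intro dvd_sum) auto
  then show thesis by (intro that[OF eq] dvd_mult)
qed

end

section \<open>The valuation of the defect\<close>

text \<open>For \<open>a\<close> at least 2 and \<open>m\<close> the valuation of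
  \<open>a - 1\<close>, this is the least valuation at \<open>p\<close> of
  \<open>defect a (nat (a ^ k))\<close> over all \<open>k\<close>; see
  \<open>dvd_defect_power\<close> and \<open>ex_not_dvd_defect_power\<close>.\<close>

definition macdonald_exponent :: "nat \<Rightarrow> nat \<Rightarrow> int \<Rightarrow> nat" where
  "macdonald_exponent p m a =
    (if p = 2 then 2 * m - 1
     else if p = 3 \<and> m = 1 \<and> [(a - 1) div 3 = -1] (mod 3) then 3
     else 2 * m)"

lemma dvd_mult_add:
  fixes d x y z w :: int
  shows "d dvd x \<Longrightarrow> d dvd w \<Longrightarrow> d dvd y * (z * x + w)"
  by (intro dvd_mult dvd_add)

lemma not_dvd_add:
  fixes x y d :: int
  shows "d dvd y \<Longrightarrow> \<not> d dvd x \<Longrightarrow> \<not> d dvd x + y"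
  by (simp add: dvd_add_left_iff)

lemma coprime_not_dvd_mult:
  fixes x y d :: int
  shows "coprime d x \<Longrightarrow> \<not> d dvd y \<Longrightarrow> \<not> d dvd x * y"
  using coprime_dvd_mult_right_iff by blast

lemma not_prime_power_dvd_mult:
  fixes p x y :: int
  assumes "prime p" "\<not> p ^ Suc i dvd x" "\<not> p ^ Suc j dvd y"
  shows "\<not> p ^ Suc (i + j) dvd x * y"
  using prime_power_dvd_cancel[OF assms(1), of "Suc j" i x y] assms(2,3) by (auto simp: add.commute)

text \<open>The two numbers are the values at \<open>k = 1\<close> and \<open>k = 2\<close> of the
  factor \<open>1 + 2 * h * (a ^ k - 2)\<close> of \<open>defect_exceptional\<close>, for
  \<open>a = 3 * h + 1\<close>. Their difference is 3 times an integer prime to 3.\<close>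

lemma not_9_dvd_both:
  fixes h :: int
  assumes "[h = 2] (mod 3)"
  shows "\<not> 9 dvd 1 + 2 * h * (3 * h - 1) \<or> \<not> 9 dvd 1 + 2 * h * (3 * h * (3 * h + 2) - 1)"
proof (rule ccontr)
  assume "\<not> ?thesis"
  then have "9 dvd (1 + 2 * h * (3 * h * (3 * h + 2) - 1)) - (1 + 2 * h * (3 * h - 1))"
    by (intro dvd_diff) auto
  also have "\<dots> = 3 * (2 * h * h * (3 * h + 1))" by (simp add: algebra_simps)
  finally have "3 * 3 dvd 3 * (2 * h * h * (3 * h + 1))" by simp
  then have "3 dvd 2 * h * h * (3 * h + 1)"
    by (subst (asm) dvd_mult_cancel_left) simp
  moreover have "[2 * h * h * (3 * h + 1) = 2 * 2 * 2 * (0 * 2 + 1)] (mod 3)"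
    using assms by (intro cong_mult cong_add) (auto simp: cong_def)
  ultimately show False
    using cong_dvd_iff by fastforce
qed

text \<open>The bound \<open>2 \<le> a\<close> makes every \<open>a ^ k\<close> a positive number of
  factors, so that \<open>defect\<close> can be taken at it. An arbitrary parameter is replaced by a
  congruent one of this kind in \<open>ex_macdonald_prime\<close>.\<close>

locale macdonald_prime =
  fixes p m :: nat and a :: int
  assumes p: "prime p" and m: "1 \<le> m"
    and dvd: "int p ^ m dvd a - 1" and not_dvd: "\<not> int p ^ Suc m dvd a - 1"
    and a: "2 \<le> a"
begin

abbreviation v :: nat where "v \<equiv> macdonald_exponent p m a"

lemma prime_int: "prime (int p)"
  using p by simp

lemma p_dvd: "int p dvd a - 1"
  using dvd_trans[OF dvd_power[of m "int p"] dvd] m by simp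

lemma coprime_a: "coprime (int p) a"
  using radical_dvd_coprime[OF radical_dvd_prime_power[OF p_dvd p, of 1]] by simp

lemma dvd_power_minus_1: "int p ^ m dvd a ^ k - 1"
  using power_cong_1[OF dvd] .

lemma a_pow_ge_1: "1 \<le> a ^ k"
  using a by (simp add: one_le_power)

lemma cases_p:
  obtains (exceptional) h where "p = 3" "m = 1" "a - 1 = 3 * h" "[h = 2] (mod 3)" "v = 3"
  | (unexceptional) h where "p = 3" "m = 1" "a - 1 = 3 * h" "[h = 1] (mod 3)" "v = 2"
  | (two) "p = 2" "v = 2 * m - 1"
  | (generic) "p \<noteq> 2" "p = 3 \<Longrightarrow> 1 < m" "v = 2 * m"
proof (cases "p = 3 \<and> m = 1")
  case True
  then have "3 dvd a - 1" using dvd by simp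
  then obtain h where h: "a - 1 = 3 * h" by (rule dvdE)
  have "\<not> 3 dvd h"
    using mult_dvd_mono[of 3 3 3 h] not_dvd True unfolding h by auto
  then have "h mod 3 = 1 \<or> h mod 3 = 2" by presburger
  then consider "[h = 1] (mod 3)" | "[h = 2] (mod 3)"
    by (auto simp: cong_def)
  then show thesis
  proof cases
    case 1
    then have "\<not> [h = -1] (mod 3)" by (simp add: cong_def)
    then have "v = 2" using True unfolding macdonald_exponent_def h by simp
    then show thesis using True by (intro unexceptional[OF _ _ h 1]) simp_all
  next
    case 2
    then have "[h = -1] (mod 3)" by (simp add: cong_def)
    then have "v = 3" using True unfolding macdonald_exponent_def h by simp
    then show thesis using True by (intro exceptional[OF _ _ h 2]) simp_all
  qed
next
  case False
  show thesis
  proof (cases "p = 2")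
    case True
    then show thesis by (intro two) (simp_all add: macdonald_exponent_def)
  next
    case p2: False
    then have "v = 2 * m" using False unfolding macdonald_exponent_def by auto
    then show thesis using False m p2 by (intro generic) linarith+
  qed
qed

lemma dvd_half:
  assumes "p \<noteq> 2" "int p ^ i dvd 2 * x" shows "int p ^ i dvd x"
proof -
  have "\<not> p dvd 2"
    using prime_ge_2_nat[OF p] dvd_imp_le[of p 2] assms(1) by auto
  then have "\<not> int p dvd 2"
    using int_dvd_int_iff[of p 2] by simp
  then show ?thesis
    using prime_power_dvd_cancel[OF prime_int, of i 0 2 x] assms(2) by simp
qed

lemma defect_power_expansion:
  assumes "p = 3 \<Longrightarrow> 1 < m"
  obtains E where "2 * defect a (nat (a ^ k)) = a * (a ^ k * ((a ^ k - 1) * (a - 1)) + E)"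
    "int p ^ Suc (m + m) dvd E"
proof -
  have Q: "int (nat (a ^ k - 1)) = a ^ k - 1" and Suc_Q: "Suc (nat (a ^ k - 1)) = nat (a ^ k)"
    using a_pow_ge_1[of k] by simp_all
  have "int p ^ m dvd int (nat (a ^ k - 1))"
    unfolding Q by (rule dvd_power_minus_1)
  from defect_generic[OF p dvd this m assms] obtain E where
    "2 * defect (1 + (a - 1)) (nat (a ^ k))
      = (1 + (a - 1)) * (int (nat (a ^ k)) * (a ^ k - 1) * (a - 1) + E)" "int p ^ (m + m + 1) dvd E"
    unfolding Q Suc_Q by blast
  then show thesis
    using a_pow_ge_1[of k] by (intro that[of E]) (simp_all add: mult.assoc)
qed

lemma defect_power_expansion_exceptional:
  assumes "p = 3" "m = 1" "a - 1 = 3 * h"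
  obtains E where "2 * defect a (nat (a ^ k))
      = a * (a ^ k * ((a ^ k - 1) * (a - 1) * (1 + 2 * h * (a ^ k - 2))) + E)"
    "int p ^ 4 dvd E"
proof -
  have Q: "int (nat (a ^ k - 1)) = a ^ k - 1" and Suc_Q: "Suc (nat (a ^ k - 1)) = nat (a ^ k)"
    using a_pow_ge_1[of k] by simp_all
  have "int p ^ m dvd int (nat (a ^ k - 1))"
    unfolding Q by (rule dvd_power_minus_1)
  from defect_exceptional[OF p dvd this m assms] obtain E where
    "2 * defect (1 + (a - 1)) (nat (a ^ k))
      = (1 + (a - 1)) * (int (nat (a ^ k)) * (a ^ k - 1) * (a - 1) * (1 + 2 * h * (a ^ k - 1 - 1)) + E)"
    "3 ^ (m + 3) dvd E"
    unfolding Q Suc_Q by blast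
  then show thesis
    using a_pow_ge_1[of k] assms(1,2) by (intro that[of E]) (simp_all add: mult.assoc)
qed

lemma dvd_defect_power: "int p ^ v dvd defect a (nat (a ^ k))"
proof (cases rule: cases_p)
  case (exceptional h)
  obtain E where E: "2 * defect a (nat (a ^ k))
      = a * (a ^ k * ((a ^ k - 1) * (a - 1) * (1 + 2 * h * (a ^ k - 2))) + E)" "int p ^ 4 dvd E"
    using defect_power_expansion_exceptional[OF exceptional(1-3)] .
  have dvds: "3 dvd a ^ k - 1" "3 dvd a - 1"
    using dvd_power_minus_1[of k] exceptional by auto
  have "a ^ k mod 3 = 1" "h mod 3 = 2"
    using dvds(1) exceptional(4) by (presburger, simp add: cong_def)
  \<comment> \<open>The right side is -3, so this factor supplies a third 3 besides those of
    \<open>a ^ k - 1\<close> and \<open>a - 1\<close>.\<close>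
  then have "[1 + 2 * h * (a ^ k - 2) = 1 + 2 * 2 * (1 - 2)] (mod 3)"
    by (intro cong_add cong_mult cong_diff) (simp_all add: cong_def)
  then have "3 dvd 1 + 2 * h * (a ^ k - 2)"
    by (simp add: cong_def dvd_eq_mod_eq_0)
  with dvds have "3 * 3 * 3 dvd (a ^ k - 1) * (a - 1) * (1 + 2 * h * (a ^ k - 2))"
    by (intro mult_dvd_mono)
  moreover have "int p ^ 3 dvd E"
    by (rule dvd_trans[OF le_imp_power_dvd E(2)]) simp
  ultimately have "int p ^ 3 dvd 2 * defect a (nat (a ^ k))"
    unfolding E(1) using exceptional(1) by (intro dvd_mult_add) simp_all
  then show ?thesis
    unfolding exceptional(5) by (rule dvd_half[rotated]) (simp_all add: exceptional(1))
next
  case (unexceptional h)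
  obtain E where E: "2 * defect a (nat (a ^ k))
      = a * (a ^ k * ((a ^ k - 1) * (a - 1) * (1 + 2 * h * (a ^ k - 2))) + E)" "int p ^ 4 dvd E"
    using defect_power_expansion_exceptional[OF unexceptional(1-3)] .
  have "3 dvd a ^ k - 1" "3 dvd a - 1"
    using dvd_power_minus_1[of k] unexceptional by auto
  then have "3 * 3 dvd (a ^ k - 1) * (a - 1)"
    by (intro mult_dvd_mono)
  then have "3 * 3 dvd (a ^ k - 1) * (a - 1) * (1 + 2 * h * (a ^ k - 2))"
    by (rule dvd_mult2)
  moreover have "int p ^ 2 dvd E"
    by (rule dvd_trans[OF le_imp_power_dvd E(2)]) simp
  ultimately have "int p ^ 2 dvd 2 * defect a (nat (a ^ k))"
    unfolding E(1) using unexceptional(1) by (intro dvd_mult_add) simp_all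
  then show ?thesis
    unfolding unexceptional(5) by (rule dvd_half[rotated]) (simp_all add: unexceptional(1))
next
  case two
  then have "p = 3 \<Longrightarrow> 1 < m" by simp
  from defect_power_expansion[OF this] obtain E where
    E: "2 * defect a (nat (a ^ k)) = a * (a ^ k * ((a ^ k - 1) * (a - 1)) + E)" "int p ^ Suc (m + m) dvd E" .
  have "int p ^ (m + m) dvd (a ^ k - 1) * (a - 1)"
    unfolding power_add using dvd_power_minus_1 dvd by (rule mult_dvd_mono)
  moreover have "int p ^ (m + m) dvd E"
    by (rule dvd_trans[OF le_imp_power_dvd E(2)]) simp
  ultimately have "int p ^ (m + m) dvd 2 * defect a (nat (a ^ k))"
    unfolding E(1) by (intro dvd_mult_add)
  \<comment> \<open>One of the \<open>m + m\<close> factors 2 is accounted for by the doubling of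
    the defect.\<close>
  moreover have "m + m = Suc v" using two m by simp
  ultimately show ?thesis using two(1) by simp
next
  case generic
  from defect_power_expansion[OF generic(2)] obtain E where
    E: "2 * defect a (nat (a ^ k)) = a * (a ^ k * ((a ^ k - 1) * (a - 1)) + E)" "int p ^ Suc (m + m) dvd E"
    by blast
  have "int p ^ (m + m) dvd (a ^ k - 1) * (a - 1)"
    unfolding power_add using dvd_power_minus_1 dvd by (rule mult_dvd_mono)
  moreover have "int p ^ (m + m) dvd E"
    by (rule dvd_trans[OF le_imp_power_dvd E(2)]) simp
  ultimately have "int p ^ (m + m) dvd 2 * defect a (nat (a ^ k))"
    unfolding E(1) by (intro dvd_mult_add)
  then show ?thesis
    using dvd_half generic(1) unfolding generic(3) mult_2 by blast
qed

text \<open>\<open>k = 1\<close> attains the bound, except that in the exceptional case the extra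
  factor may be divisible by 9 there; then \<open>k = 2\<close> does.\<close>

lemma ex_not_dvd_defect_power: "\<exists>k. \<not> int p ^ Suc v dvd defect a (nat (a ^ k))"
proof -
  have unit: "\<not> int p ^ i dvd a * (a ^ k * x + E)" if "\<not> int p ^ i dvd x" "int p ^ i dvd E" for i k x E
    using that coprime_a by (intro coprime_not_dvd_mult not_dvd_add) simp_all
  have generic_case: "\<not> int p ^ Suc (m + m) dvd 2 * defect a (nat (a ^ 1))" if gen: "p = 3 \<Longrightarrow> 1 < m"
  proof -
    obtain E where E: "2 * defect a (nat (a ^ 1)) = a * (a ^ 1 * ((a ^ 1 - 1) * (a - 1)) + E)"
      "int p ^ Suc (m + m) dvd E"
      using defect_power_expansion[OF gen] by blast
    show ?thesis
      unfolding E(1) using not_prime_power_dvd_mult[OF prime_int not_dvd not_dvd] E(2)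
      by (intro unit) simp_all
  qed
  \<comment> \<open>\<open>j\<close> bounds the valuation of the extra factor;
    \<open>a ^ k - 1\<close> and \<open>a - 1\<close> contribute one each. The condition on
    \<open>j\<close> keeps the total below the valuation of \<open>E\<close>.\<close>
  have exceptional_case: "\<not> int p ^ Suc (Suc (1 + j)) dvd 2 * defect a (nat (a ^ k))"
    if ex: "p = 3" "m = 1" "a - 1 = 3 * h" "\<not> int p ^ Suc j dvd 1 + 2 * h * (a ^ k - 2)"
      "\<not> int p ^ Suc 1 dvd a ^ k - 1" "j \<le> 1" for h j k
  proof -
    obtain E where E: "2 * defect a (nat (a ^ k))
        = a * (a ^ k * ((a ^ k - 1) * (a - 1) * (1 + 2 * h * (a ^ k - 2))) + E)" "int p ^ 4 dvd E"
      using defect_power_expansion_exceptional[OF ex(1-3)] .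
    have "\<not> int p ^ Suc (1 + 1 + j) dvd (a ^ k - 1) * (a - 1) * (1 + 2 * h * (a ^ k - 2))"
      using not_dvd unfolding ex(2)
      by (intro not_prime_power_dvd_mult[OF prime_int not_prime_power_dvd_mult[OF prime_int ex(5)] ex(4)])
    moreover have "int p ^ Suc (Suc (1 + j)) dvd E"
      using ex(6) by (intro dvd_trans[OF le_imp_power_dvd E(2)]) simp
    ultimately show ?thesis
      unfolding E(1) by (intro unit) simp_all
  qed
  show ?thesis
  proof (cases rule: cases_p)
    case (exceptional h)
    have a: "a = 3 * h + 1" using exceptional by simp
    \<comment> \<open>Here \<open>3 * h + 2\<close> is \<open>a + 1\<close>, which is prime to 3, so
      squaring \<open>a\<close> does not raise the valuation.\<close>
    have "a ^ 2 - 1 = (a - 1) * (3 * h + 2)" by (simp add: a power2_eq_square algebra_simps)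
    moreover have "\<not> 3 dvd (3 * h + 2)" by presburger
    then have "\<not> int p ^ Suc (m + 0) dvd (a - 1) * (3 * h + 2)"
      using exceptional(1) by (intro not_prime_power_dvd_mult[OF prime_int not_dvd]) simp
    ultimately have not_dvd_2: "\<not> int p ^ Suc m dvd a ^ 2 - 1" by simp
    have "a ^ 2 - 2 = 3 * h * (3 * h + 2) - 1" "a ^ 1 - 2 = 3 * h - 1"
      by (simp_all add: a power2_eq_square algebra_simps)
    then have "\<not> 9 dvd 1 + 2 * h * (a ^ 1 - 2) \<or> \<not> 9 dvd 1 + 2 * h * (a ^ 2 - 2)"
      using not_9_dvd_both[OF exceptional(4)] by simp
    moreover have "\<not> int p ^ Suc m dvd a ^ 1 - 1" using not_dvd by simp
    ultimately obtain k where "\<not> 9 dvd 1 + 2 * h * (a ^ k - 2)" "\<not> int p ^ Suc m dvd a ^ k - 1"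
      using not_dvd_2 by blast
    then have "\<not> int p ^ Suc (Suc (1 + 1)) dvd 2 * defect a (nat (a ^ k))"
      using exceptional(1-3) by (intro exceptional_case[of h]) simp_all
    moreover have eq: "Suc (Suc (1 + 1)) = Suc v" using exceptional(5) by simp
    ultimately have "\<not> int p ^ Suc v dvd 2 * defect a (nat (a ^ k))"
      unfolding eq by blast
    then have "\<not> int p ^ Suc v dvd defect a (nat (a ^ k))"
      using dvd_mult by blast
    then show ?thesis by blast
  next
    case (unexceptional h)
    have "a mod 3 = 1" "h mod 3 = 1"
      using unexceptional(3,4) by (presburger, simp add: cong_def)
    then have "[1 + 2 * h * (a ^ 1 - 2) = 1 + 2 * 1 * (1 - 2)] (mod 3)"
      by (intro cong_add cong_mult cong_diff) (simp_all add: cong_def)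
    then have "\<not> int p ^ Suc 0 dvd 1 + 2 * h * (a ^ 1 - 2)"
      using unexceptional(1) by (simp add: cong_def dvd_eq_mod_eq_0)
    then have "\<not> int p ^ Suc (Suc (1 + 0)) dvd 2 * defect a (nat (a ^ 1))"
      using unexceptional(1-3) not_dvd by (intro exceptional_case[of h]) simp_all
    moreover have eq: "Suc (Suc (1 + 0)) = Suc v" using unexceptional(5) by simp
    ultimately have "\<not> int p ^ Suc v dvd 2 * defect a (nat (a ^ 1))"
      unfolding eq by blast
    then have "\<not> int p ^ Suc v dvd defect a (nat (a ^ 1))"
      using dvd_mult by blast
    then show ?thesis by blast
  next
    case two
    then have v: "m + m = Suc v" using m by simp
    have "\<not> int p ^ Suc (m + m) dvd 2 * defect a (nat (a ^ 1))"
      using two(1) by (intro generic_case) simp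
    then have "\<not> 2 * int p ^ Suc v dvd 2 * defect a (nat (a ^ 1))"
      unfolding v using two(1) by simp
    then have "\<not> int p ^ Suc v dvd defect a (nat (a ^ 1))"
      unfolding dvd_mult_cancel_left by simp
    then show ?thesis by blast
  next
    case generic
    have "\<not> int p ^ Suc v dvd 2 * defect a (nat (a ^ 1))"
      using generic_case[OF generic(2)] unfolding generic(3) mult_2 .
    then have "\<not> int p ^ Suc v dvd defect a (nat (a ^ 1))"
      using dvd_mult[of "int p ^ Suc v" "defect a (nat (a ^ 1))" 2] by argo
    then show ?thesis by blast
  qed
qed

end

section \<open>Pairs satisfying the Macdonald relations\<close>

lemma (in group) int_pow_commute:
  assumes "x \<in> carrier G" "y \<in> carrier G" "c \<in> carrier G" "x \<otimes> c = c \<otimes> y"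
  shows "x [^] (i::int) \<otimes> c = c \<otimes> y [^] i"
proof -
  have nat: "x [^] (n::nat) \<otimes> c = c \<otimes> y [^] n" for n
  proof (induction n)
    case (Suc n)
    have "x [^] Suc n \<otimes> c = x [^] n \<otimes> (x \<otimes> c)" using assms(1,3) by (simp add: m_assoc)
    also have "\<dots> = (x [^] n \<otimes> c) \<otimes> y" using assms by (simp add: m_assoc)
    also have "\<dots> = c \<otimes> y [^] Suc n" using assms by (simp add: Suc m_assoc)
    finally show ?case .
  qed (use assms in simp)
  show ?thesis
  proof (cases i rule: int_cases2)
    case (nonneg n)
    then show ?thesis using nat by (simp add: int_pow_int)
  next
    case (nonpos n)
    have "x [^] n \<otimes> (inv (x [^] n) \<otimes> c \<otimes> y [^] n) = x [^] n \<otimes> c"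
      using assms nat[of n] by (simp add: m_assoc [symmetric])
    then have "inv (x [^] n) \<otimes> c \<otimes> y [^] n = c"
      using assms by simp
    then have "inv (x [^] n) \<otimes> c = c \<otimes> inv (y [^] n)"
      using assms by (metis inv_closed inv_solve_right m_closed nat_pow_closed)
    then show ?thesis using nonpos assms by (simp add: int_pow_neg_int)
  qed
qed

text \<open>The defining relations cleared of inverses, with [B, A] written as the inverse of
  \<open>C\<close>. Keeping \<open>C\<close> as a parameter, although \<open>AB\<close> determines
  it, lets the locale be reused for swapped pairs, for parts of the generators and for
  permutations.\<close>

locale macdonald_pair = group G for G (structure) +
  fixes A B C :: 'a and a :: int
  assumes A [simp]: "A \<in> carrier G" and B [simp]: "B \<in> carrier G" and C [simp]: "C \<in> carrier G"
    and AB: "A \<otimes> B = B \<otimes> A \<otimes> C"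
    and AC: "A \<otimes> C = C \<otimes> A [^] a"
    and CB: "C \<otimes> B = B [^] a \<otimes> C"
begin

text \<open>The symmetry of the presentation. Each later fact about \<open>A\<close> gives its
  mirror image for \<open>B\<close> through it.\<close>

lemma swap: "macdonald_pair G B A (inv C) a"
proof
  show "B \<otimes> A = A \<otimes> B \<otimes> inv C"
    by (simp add: AB m_assoc)
  show "B \<otimes> inv C = inv C \<otimes> B [^] a"
    using CB by (metis A B C inv_closed inv_solve_left inv_solve_right int_pow_closed m_assoc m_closed)
  show "inv C \<otimes> A = A [^] a \<otimes> inv C"
    using AC by (metis A B C inv_closed inv_solve_left inv_solve_right int_pow_closed m_assoc m_closed)
qed simp_all

lemma pow_A_pow_C: "A [^] (i::int) \<otimes> C [^] (k::nat) = C [^] k \<otimes> A [^] (i * a ^ k)"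
proof (induction k)
  case (Suc k)
  have "A [^] i \<otimes> C [^] Suc k = A [^] i \<otimes> C [^] k \<otimes> C"
    by (simp add: m_assoc)
  also have "\<dots> = C [^] k \<otimes> (A [^] (i * a ^ k) \<otimes> C)"
    unfolding Suc by (simp add: m_assoc)
  also have "A [^] (i * a ^ k) \<otimes> C = C \<otimes> A [^] (i * a ^ Suc k)"
    using int_pow_commute[OF A _ C AC, of "i * a ^ k"] by (simp add: int_pow_pow mult_ac)
  finally show ?case by (simp add: m_assoc)
qed simp

lemma pow_C_pow_B: "C [^] (k::nat) \<otimes> B [^] (j::int) = B [^] (j * a ^ k) \<otimes> C [^] k"
proof -
  interpret s: macdonald_pair G B A "inv C" a by (rule swap)
  have "B [^] (j * a ^ k) \<otimes> C [^] k = C [^] k \<otimes> (inv (C [^] k) \<otimes> B [^] (j * a ^ k)) \<otimes> C [^] k"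
    by (simp add: m_assoc [symmetric])
  also have "inv (C [^] k) \<otimes> B [^] (j * a ^ k) = B [^] j \<otimes> inv (C [^] k)"
    using s.pow_A_pow_C[of j k] by (simp add: nat_pow_inv)
  finally show ?thesis by (simp add: m_assoc)
qed

lemma pow_A_B: "A [^] int n \<otimes> B = B \<otimes> C [^] n \<otimes> A [^] pow_sum a n"
proof (induction n)
  case (Suc n)
  have "A [^] int (Suc n) \<otimes> B = A \<otimes> (A [^] int n \<otimes> B)"
    using int_pow_mult[OF A, of 1 "int n"] by (simp add: m_assoc)
  also have "\<dots> = A \<otimes> B \<otimes> (C [^] n \<otimes> A [^] pow_sum a n)"
    unfolding Suc by (simp add: m_assoc)
  also have "\<dots> = B \<otimes> (A [^] (1::int) \<otimes> C [^] Suc n) \<otimes> A [^] pow_sum a n"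
    unfolding AB nat_pow_Suc2[OF C] by (simp add: m_assoc)
  also have "\<dots> = B \<otimes> C [^] Suc n \<otimes> (A [^] a ^ Suc n \<otimes> A [^] pow_sum a n)"
    unfolding pow_A_pow_C by (simp add: m_assoc)
  also have "A [^] a ^ Suc n \<otimes> A [^] pow_sum a n = A [^] pow_sum a (Suc n)"
    by (simp add: int_pow_mult [symmetric] pow_sum_Suc add.commute)
  finally show ?case .
qed simp

text \<open>The mirror image of \<open>pow_A_B\<close> is B^n A = A C^(-n) B^(s n). Since C^(-n)
  B^(n a^n) C^n = B^n, the correction needed on the right is B to the power n a^n - s n; this is
  where the defect comes from.\<close>

lemma A_pow_B: "A \<otimes> B [^] int n = B [^] int n \<otimes> A \<otimes> B [^] defect a n \<otimes> C [^] n"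
proof -
  interpret s: macdonald_pair G B A "inv C" a by (rule swap)
  have "B [^] int n \<otimes> A \<otimes> B [^] defect a n \<otimes> C [^] n
      = A \<otimes> (inv (C [^] n) \<otimes> (B [^] (pow_sum a n + defect a n)) \<otimes> C [^] n)"
    unfolding s.pow_A_B by (simp add: int_pow_mult nat_pow_inv m_assoc)
  also have "B [^] (pow_sum a n + defect a n) \<otimes> C [^] n = C [^] n \<otimes> B [^] int n"
    by (simp add: defect_def pow_C_pow_B)
  ultimately show ?thesis
    by (simp add: m_assoc) (simp add: m_assoc [symmetric])
qed

text \<open>The overlap A C^k B: moving \<open>A\<close> across C^k first produces A^b B, moving
  \<open>B\<close> first produces A B^b. Rewriting these by \<open>pow_A_B\<close> and
  \<open>A_pow_B\<close> and comparing gives a relation that is not visible in the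
  presentation.\<close>

lemma A_pow_C_B:
  assumes "int b = a ^ k"
  shows "B [^] defect a b \<otimes> C [^] (b + k) = C [^] (b + k) \<otimes> A [^] (- defect a b)"
proof -
  have "A \<otimes> C [^] k \<otimes> B = C [^] k \<otimes> (A [^] int b \<otimes> B)"
    using pow_A_pow_C[of 1 k] by (simp add: assms m_assoc)
  also have "\<dots> = (C [^] k \<otimes> B [^] (1::int)) \<otimes> (C [^] b \<otimes> A [^] pow_sum a b)"
    unfolding pow_A_B by (simp add: m_assoc)
  also have "\<dots> = B [^] int b \<otimes> (C [^] (b + k) \<otimes> A [^] pow_sum a b)"
    unfolding pow_C_pow_B by (simp add: assms m_assoc nat_pow_mult [symmetric] add.commute[of b k])
  finally have 1: "A \<otimes> C [^] k \<otimes> B = B [^] int b \<otimes> (C [^] (b + k) \<otimes> A [^] pow_sum a b)" .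
  have "A \<otimes> C [^] k \<otimes> B = A \<otimes> (C [^] k \<otimes> B [^] (1::int))"
    by (simp add: m_assoc)
  also have "\<dots> = (A \<otimes> B [^] int b) \<otimes> C [^] k"
    unfolding pow_C_pow_B by (simp add: assms m_assoc)
  also have "\<dots> = B [^] int b \<otimes> (A \<otimes> B [^] defect a b \<otimes> C [^] (b + k))"
    unfolding A_pow_B by (simp add: m_assoc nat_pow_mult [symmetric])
  finally have "A \<otimes> (B [^] defect a b \<otimes> C [^] (b + k)) = C [^] (b + k) \<otimes> A [^] pow_sum a b"
    using 1 by (simp add: m_assoc)
  then have "B [^] defect a b \<otimes> C [^] (b + k) = A [^] (-1 :: int) \<otimes> C [^] (b + k) \<otimes> A [^] pow_sum a b"
    by (simp add: int_pow_neg inv_solve_left m_assoc)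
  also have "\<dots> = C [^] (b + k) \<otimes> (A [^] (- (a ^ (b + k))) \<otimes> A [^] pow_sum a b)"
    unfolding pow_A_pow_C by (simp add: m_assoc)
  also have "A [^] (- (a ^ (b + k))) \<otimes> A [^] pow_sum a b = A [^] (- defect a b)"
    by (simp add: int_pow_mult [symmetric] defect_def assms power_add mult.commute)
  finally show ?thesis .
qed

lemma C_eq: "C = inv (B \<otimes> A) \<otimes> (A \<otimes> B)"
  by (simp add: AB inv_solve_left m_assoc)

lemma defect_pow:
  assumes b: "int b = a ^ k"
  shows "A [^] defect a b \<otimes> B = B \<otimes> A [^] defect a b" (is ?commute_B)
    and "A [^] defect a b \<otimes> C = C \<otimes> A [^] defect a b" (is ?commute_C)
    and "B [^] defect a b = A [^] (- defect a b)" (is ?eq)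
    and "A [^] (defect a b * (a - 1)) = \<one>" (is ?order)
proof -
  define w where "w = defect a b"
  define D where "D = C [^] (b + k)"
  have [simp]: "D \<in> carrier G" by (simp add: D_def)
  have 1: "B [^] w \<otimes> D = D \<otimes> A [^] (- w)"
    using A_pow_C_B[OF b] by (simp add: w_def D_def)
  \<comment> \<open>In this power of the relation, carrying \<open>D\<close> back across the power
    of \<open>A\<close> removes the factor a^(b + k). So A^(-w) equals a power of \<open>B\<close>
    and therefore commutes with \<open>B\<close>.\<close>
  have "B [^] (w * a ^ (b + k)) \<otimes> D = D \<otimes> A [^] (- w * a ^ (b + k))"
    using int_pow_commute[OF _ _ _ 1, of "a ^ (b + k)"] by (simp add: int_pow_pow)
  also have "\<dots> = A [^] (- w) \<otimes> D"
    using pow_A_pow_C[of "- w" "b + k"] by (simp add: D_def)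
  finally have 2: "A [^] (- w) = B [^] (w * a ^ (b + k))"
    by simp
  have "B [^] (w * a ^ (b + k)) \<otimes> B = B \<otimes> B [^] (w * a ^ (b + k))"
    by (rule int_pow_commute) simp_all
  then have "A [^] (- w) \<otimes> B = B \<otimes> A [^] (- w)"
    by (simp add: 2)
  from int_pow_commute[OF _ _ _ this, of "-1"] show wB: ?commute_B
    by (simp add: int_pow_pow w_def)
  have wA: "A [^] w \<otimes> A = A \<otimes> A [^] w"
    by (rule int_pow_commute) simp_all
  have "A [^] w \<otimes> (B \<otimes> A) = (B \<otimes> A) \<otimes> A [^] w" "A [^] w \<otimes> (A \<otimes> B) = (A \<otimes> B) \<otimes> A [^] w"
    using wA wB by (simp_all add: m_assoc [symmetric] w_def) (simp_all add: m_assoc)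
  then have "(B \<otimes> A) \<otimes> (A [^] w \<otimes> C) = (B \<otimes> A) \<otimes> (C \<otimes> A [^] w)"
    unfolding AB by (metis A B C int_pow_closed m_assoc m_closed)
  then show wC: ?commute_C
    by (simp add: w_def)
  \<comment> \<open>Conjugation by \<open>C\<close> raises A^w to the power \<open>a\<close> but
    also fixes it, so the order divides w (a - 1).\<close>
  have "C \<otimes> A [^] (w * a) = C \<otimes> A [^] w"
    using pow_A_pow_C[of w 1] wC by (simp add: w_def)
  then have "A [^] (w * a) = A [^] w"
    by simp
  then show ?order
    by (simp add: w_def int_pow_diff right_diff_distrib)
  have "A [^] w \<otimes> C [^] n = C [^] n \<otimes> A [^] w" for n :: nat
    using int_pow_commute[OF _ _ _ wC[symmetric], of "int n"] by (simp add: w_def int_pow_int)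
  from this[of "b + k"] have "A [^] w \<otimes> D = D \<otimes> A [^] w"
    by (simp add: D_def)
  from int_pow_commute[OF _ _ _ this, of "-1"] have "B [^] w \<otimes> D = A [^] (- w) \<otimes> D"
    by (simp add: 1 int_pow_pow)
  then show ?eq
    by (simp add: w_def)
qed

end

section \<open>Pairs of finite order\<close>

lemma (in group) int_pow_cong:
  assumes "x \<in> carrier G" "x [^] (N::nat) = \<one>" "[i = j] (mod int N)"
  shows "x [^] i = x [^] j"
proof -
  have "int (ord x) dvd int N" using assms(1,2) by (simp add: pow_eq_id)
  also have "int N dvd j - i" using assms(3) by (metis cong_iff_dvd_diff cong_sym)
  finally show ?thesis using assms(1) by (simp add: int_pow_eq)
qed

lemma (in group) nat_pow_cong:
  assumes "x \<in> carrier G" "x [^] (N::nat) = \<one>" "[i = j] (mod N)"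
  shows "x [^] (i::nat) = x [^] (j::nat)"
  using int_pow_cong[OF assms(1,2), of "int i" "int j"] assms(3) by (simp add: int_pow_int cong_int_iff)

lemma (in group) int_pow_eq_nat_pow:
  assumes "x \<in> carrier G" "x [^] (N::nat) = \<one>" "N > 0"
  obtains k where "x [^] (i::int) = x [^] (k::nat)" "k < N"
proof (rule that)
  have "x [^] i = x [^] int (nat (i mod int N))"
    using assms by (intro int_pow_cong[OF assms(1,2)]) (simp add: cong_def)
  then show "x [^] i = x [^] nat (i mod int N)" by (simp add: int_pow_int)
  show "nat (i mod int N) < N" using assms(3) by (simp add: nat_less_iff)
qed

section \<open>Products of finite subgroups\<close>

lemma (in group) card_set_mult_dvd:
  assumes H: "subgroup H G" "finite H" and K: "subgroup K G" "finite K"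
  shows "card (H <#> K) dvd card H * card K"
proof -
  interpret H: subgroup H G by (rule H(1))
  interpret K: subgroup K G by (rule K(1))
  define f where "f = (\<lambda>(h, k). h \<otimes> k)"
  \<comment> \<open>The pairs with product h k are exactly (h d, d^(-1) k) with \<open>d\<close> in
    both subgroups, so all fibers of the multiplication map have the same size.\<close>
  have fiber: "card {x \<in> H \<times> K. f x = y} = card (H \<inter> K)" if y: "y \<in> f ` (H \<times> K)" for y
  proof -
    obtain h k where hk: "h \<in> H" "k \<in> K" "y = h \<otimes> k" using y by (auto simp: f_def)
    have "bij_betw (\<lambda>d. (h \<otimes> d, inv d \<otimes> k)) (H \<inter> K) {x \<in> H \<times> K. f x = y}"
    proof (rule bij_betw_byWitness[where f' = "\<lambda>(u, v). inv h \<otimes> u"])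
      show "\<forall>d\<in>H \<inter> K. (\<lambda>(u, v). inv h \<otimes> u) (h \<otimes> d, inv d \<otimes> k) = d"
        using hk by (simp add: m_assoc [symmetric])
      show "\<forall>x\<in>{x \<in> H \<times> K. f x = y}. (h \<otimes> ((\<lambda>(u, v). inv h \<otimes> u) x), inv ((\<lambda>(u, v). inv h \<otimes> u) x) \<otimes> k) = x"
      proof
        fix x assume "x \<in> {x \<in> H \<times> K. f x = y}"
        then obtain u v where uv: "u \<in> H" "v \<in> K" "x = (u, v)" and eq: "u \<otimes> v = h \<otimes> k"
          by (auto simp: f_def hk)
        have "inv (inv h \<otimes> u) \<otimes> k = inv u \<otimes> (h \<otimes> k)"
          using hk uv by (simp add: inv_mult_group m_assoc)
        also have "\<dots> = v" using hk uv by (simp add: eq [symmetric] m_assoc [symmetric])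
        finally show "(h \<otimes> ((\<lambda>(u, v). inv h \<otimes> u) x), inv ((\<lambda>(u, v). inv h \<otimes> u) x) \<otimes> k) = x"
          using hk uv by (simp add: m_assoc [symmetric])
      qed
      show "(\<lambda>d. (h \<otimes> d, inv d \<otimes> k)) ` (H \<inter> K) \<subseteq> {x \<in> H \<times> K. f x = y}"
      proof (intro image_subsetI CollectI conjI)
        fix d assume d: "d \<in> H \<inter> K"
        then show "(h \<otimes> d, inv d \<otimes> k) \<in> H \<times> K" using hk by simp
        have "d \<otimes> (inv d \<otimes> k) = k" using hk d by (simp add: m_assoc [symmetric])
        then show "f (h \<otimes> d, inv d \<otimes> k) = y" using hk d by (simp add: f_def m_assoc)
      qed
      show "(\<lambda>(u, v). inv h \<otimes> u) ` {x \<in> H \<times> K. f x = y} \<subseteq> H \<inter> K"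
      proof (rule image_subsetI)
        fix x assume "x \<in> {x \<in> H \<times> K. f x = y}"
        then obtain u v where uv: "u \<in> H" "v \<in> K" "x = (u, v)" and eq: "u \<otimes> v = h \<otimes> k"
          by (auto simp: f_def hk)
        have "inv h \<otimes> u = inv h \<otimes> (u \<otimes> v) \<otimes> inv v"
          using hk uv by (simp add: m_assoc)
        also have "\<dots> = k \<otimes> inv v"
          using hk uv by (simp add: eq m_assoc [symmetric])
        finally have "inv h \<otimes> u = k \<otimes> inv v" .
        moreover have "inv h \<otimes> u \<in> H" "k \<otimes> inv v \<in> K" using hk uv by simp_all
        ultimately show "(\<lambda>(u, v). inv h \<otimes> u) x \<in> H \<inter> K" using uv by simp
      qed
    qed
    then show ?thesis by (simp add: bij_betw_same_card)
  qed
  have "card H * card K = (\<Sum>x\<in>H \<times> K. 1)" by (simp add: card_cartesian_product)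
  also have "\<dots> = (\<Sum>y\<in>f ` (H \<times> K). \<Sum>x\<in>{x \<in> H \<times> K. f x = y}. 1)"
    using H(2) K(2) by (intro sum.image_gen) simp
  also have "\<dots> = card (f ` (H \<times> K)) * card (H \<inter> K)"
    using fiber by simp
  also have "f ` (H \<times> K) = H <#> K"
    by (auto simp: f_def set_mult_def)
  finally show ?thesis by simp
qed

lemma (in group) subgroup_set_mult:
  assumes H: "subgroup H G" and K: "subgroup K G" and "K <#> H \<subseteq> H <#> K"
  shows "subgroup (H <#> K) G"
proof (rule subgroupI)
  interpret H: subgroup H G by (rule H(1))
  interpret K: subgroup K G by (rule K(1))
  have mem_iff: "x \<in> U <#> V \<longleftrightarrow> (\<exists>u\<in>U. \<exists>v\<in>V. x = u \<otimes> v)" for x U V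
    unfolding set_mult_def by blast
  have KH: "\<exists>h'\<in>H. \<exists>k'\<in>K. k \<otimes> h = h' \<otimes> k'" if "k \<in> K" "h \<in> H" for h k
  proof -
    have "k \<otimes> h \<in> K <#> H" using that unfolding mem_iff by blast
    then have "k \<otimes> h \<in> H <#> K" using assms(3) by (rule subsetD[rotated])
    then show ?thesis unfolding mem_iff .
  qed
  show "H <#> K \<subseteq> carrier G" unfolding set_mult_def by auto
  show "H <#> K \<noteq> {}" using H.one_closed K.one_closed unfolding set_mult_def by blast
  show "inv x \<in> H <#> K" if x: "x \<in> H <#> K" for x
  proof -
    obtain h k where hk: "h \<in> H" "k \<in> K" "x = h \<otimes> k" using x unfolding mem_iff by blast
    then have eq: "inv x = inv k \<otimes> inv h" by (simp add: inv_mult_group)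
    have "inv k \<in> K" "inv h \<in> H" using hk by simp_all
    from KH[OF this] show ?thesis unfolding mem_iff eq .
  qed
  show "x \<otimes> y \<in> H <#> K" if x: "x \<in> H <#> K" and y: "y \<in> H <#> K" for x y
  proof -
    obtain h k where x: "h \<in> H" "k \<in> K" "x = h \<otimes> k" using x unfolding mem_iff by blast
    obtain h' k' where y: "h' \<in> H" "k' \<in> K" "y = h' \<otimes> k'" using y unfolding mem_iff by blast
    obtain u v where uv: "u \<in> H" "v \<in> K" "k \<otimes> h' = u \<otimes> v" using KH[OF x(2) y(1)] by blast
    have "x \<otimes> y = h \<otimes> (k \<otimes> h') \<otimes> k'" using x y by (simp add: m_assoc)
    also have "\<dots> = (h \<otimes> u) \<otimes> (v \<otimes> k')" unfolding uv using x y uv by (simp add: m_assoc)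
    finally have "x \<otimes> y = (h \<otimes> u) \<otimes> (v \<otimes> k')" .
    moreover have "h \<otimes> u \<in> H" "v \<otimes> k' \<in> K" using x y uv by simp_all
    ultimately show ?thesis unfolding mem_iff by blast
  qed
qed

lemma (in group) finite_generate_singleton:
  assumes "x \<in> carrier G" "x [^] (N::nat) = \<one>" "N > 0"
  shows "finite (generate G {x})" "card (generate G {x}) dvd N"
proof -
  have dvd: "ord x dvd N" using assms by (simp add: pow_eq_id)
  then show "card (generate G {x}) dvd N" using generate_pow_card[OF assms(1)] by simp
  have "generate G {x} \<subseteq> (\<lambda>k. x [^] k) ` {..<N}"
  proof
    fix y assume "y \<in> generate G {x}"
    then obtain i :: int where "y = x [^] i" unfolding generate_pow[OF assms(1)] by blast
    with int_pow_eq_nat_pow[OF assms, of i] show "y \<in> (\<lambda>k. x [^] k) ` {..<N}" by (metis imageI lessThan_iff)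
  qed
  then show "finite (generate G {x})" by (rule finite_subset) simp
qed

lemma int_cong_mult_coprime:
  fixes x y :: int
  assumes "coprime D E" "[x = y] (mod int D)" "[x = y] (mod int E)"
  shows "[x = y] (mod int (D * E))"
  using coprime_cong_mult[OF assms(2,3)] assms(1) by simp

locale macdonald_torsion = macdonald_pair +
  fixes N :: nat
  assumes N: "radical_dvd N (a - 1)" and pow_A_N: "A [^] N = \<one>" and pow_B_N: "B [^] N = \<one>"
begin

lemma N_pos: "N > 0"
  using N by (simp add: radical_dvd_def)

text \<open>In \<open>pow_A_B\<close> at \<open>n = N\<close> both powers of \<open>A\<close>
  disappear, the second because \<open>N\<close> divides s N.\<close>

lemma pow_C_N: "C [^] N = \<one>"
proof -
  have "B = B \<otimes> (C [^] N \<otimes> A [^] pow_sum a N)"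
    using pow_A_B[of N] pow_A_N by (simp add: int_pow_int m_assoc)
  moreover have "A [^] pow_sum a N = A [^] (0::int)"
    using dvd_pow_sum_self[OF N] by (intro int_pow_cong[OF A pow_A_N]) (simp add: cong_0_iff)
  ultimately show ?thesis by simp
qed

text \<open>The order \<open>B\<close>, \<open>C\<close>, \<open>A\<close> is the one that
  \<open>pow_A_B\<close> produces, so the set is stable under right multiplication by
  \<open>B\<close> as well as by \<open>A\<close>.\<close>

definition nf :: "'a set" where
  "nf = generate G {B} <#> generate G {C} <#> generate G {A}"

lemma mem_nf_iff: "x \<in> nf \<longleftrightarrow> (\<exists>(j::int) (k::int) (i::int). x = B [^] j \<otimes> C [^] k \<otimes> A [^] i)"
proof
  assume "x \<in> nf"
  then obtain y z where "y \<in> generate G {B} <#> generate G {C}" "z \<in> generate G {A}" "x = y \<otimes> z"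
    unfolding nf_def set_mult_def by blast
  moreover from this obtain u v where "u \<in> generate G {B}" "v \<in> generate G {C}" "y = u \<otimes> v"
    unfolding set_mult_def by blast
  moreover from calculation obtain j k i :: int where "u = B [^] j" "v = C [^] k" "z = A [^] i"
    unfolding generate_pow[OF A] generate_pow[OF B] generate_pow[OF C] by blast
  ultimately show "\<exists>(j::int) (k::int) (i::int). x = B [^] j \<otimes> C [^] k \<otimes> A [^] i"
    by blast
next
  assume "\<exists>(j::int) (k::int) (i::int). x = B [^] j \<otimes> C [^] k \<otimes> A [^] i"
  then obtain j k i :: int where x: "x = B [^] j \<otimes> C [^] k \<otimes> A [^] i" by blast
  have "B [^] j \<in> generate G {B}" "C [^] k \<in> generate G {C}" "A [^] i \<in> generate G {A}"
    by (auto simp: generate_pow)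
  then show "x \<in> nf" unfolding nf_def set_mult_def x by blast
qed

lemma nf_carrier: assumes "x \<in> nf" shows "x \<in> carrier G"
proof -
  obtain j k i :: int where "x = B [^] j \<otimes> C [^] k \<otimes> A [^] i"
    using assms mem_nf_iff by blast
  then show ?thesis by simp
qed

lemma nf_closed: assumes "x \<in> nf" shows "x \<otimes> A \<in> nf" "x \<otimes> B \<in> nf"
proof -
  obtain j k i :: int where x: "x = B [^] j \<otimes> C [^] k \<otimes> A [^] i"
    using assms mem_nf_iff by blast
  have "x \<otimes> A = B [^] j \<otimes> C [^] k \<otimes> A [^] (i + 1)"
    by (simp add: x m_assoc int_pow_mult)
  then show "x \<otimes> A \<in> nf" using mem_nf_iff by blast
  obtain n where n: "A [^] i = A [^] (n::nat)" using int_pow_eq_nat_pow[OF A pow_A_N N_pos] by blast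
  obtain l where l: "C [^] k = C [^] (l::nat)" using int_pow_eq_nat_pow[OF C pow_C_N N_pos] by blast
  have "x \<otimes> B = B [^] j \<otimes> C [^] l \<otimes> (A [^] int n \<otimes> B)"
    by (simp add: x n l m_assoc int_pow_int)
  also have "\<dots> = B [^] j \<otimes> (C [^] l \<otimes> B [^] (1::int)) \<otimes> C [^] n \<otimes> A [^] pow_sum a n"
    unfolding pow_A_B by (simp add: m_assoc)
  also have "\<dots> = B [^] (j + a ^ l) \<otimes> C [^] int (l + n) \<otimes> A [^] pow_sum a n"
    unfolding pow_C_pow_B by (simp add: m_assoc int_pow_mult int_pow_int)
  finally show "x \<otimes> B \<in> nf" using mem_nf_iff by blast
qed

lemma generate_subset_nf: "generate G {A, B} \<subseteq> nf"
proof
  \<comment> \<open>Finite order turns inverses of the generators into positive powers, so stability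
    under the generators is enough.\<close>
  have inv_pow: "inv x = x [^] (N - 1)" if "x \<in> carrier G" "x [^] N = \<one>" for x
  proof (rule inv_equality)
    have "x [^] (N - 1) \<otimes> x = x [^] Suc (N - 1)" by simp
    then show "x [^] (N - 1) \<otimes> x = \<one>" using that N_pos by simp
  qed (use that in simp_all)
  note inv_A = inv_pow[OF A pow_A_N] and inv_B = inv_pow[OF B pow_B_N]
  have pow: "x \<otimes> A [^] (n::nat) \<in> nf \<and> x \<otimes> B [^] n \<in> nf" if "x \<in> nf" for x n
  proof (induction n)
    case 0
    show ?case using that nf_carrier by simp
  next
    case (Suc n)
    have "x \<in> carrier G" using that by (rule nf_carrier)
    then show ?case using nf_closed(1)[of "x \<otimes> A [^] n"] nf_closed(2)[of "x \<otimes> B [^] n"] Suc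
      by (simp add: m_assoc)
  qed
  have "g \<in> carrier G \<and> (\<forall>x\<in>nf. x \<otimes> g \<in> nf)" if "g \<in> generate G {A, B}" for g
    using that
  proof (induction g rule: generate.induct)
    case one
    show ?case using nf_carrier by auto
  next
    case (incl h)
    then show ?case using nf_closed by auto
  next
    case (inv h)
    then show ?case using pow by (auto simp: inv_A inv_B)
  next
    case (eng h1 h2)
    have "x \<otimes> (h1 \<otimes> h2) = x \<otimes> h1 \<otimes> h2" if "x \<in> nf" for x
      using that nf_carrier eng by (simp add: m_assoc)
    then show ?case using eng by simp
  qed
  moreover have "\<one> \<in> nf"
    unfolding mem_nf_iff by (rule exI[of _ 0], rule exI[of _ 0], rule exI[of _ 0]) simp
  ultimately show "x \<in> nf" if "x \<in> generate G {A, B}" for x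
    using that l_one[of x] by force
qed

lemma C_in_generate: "C \<in> generate G {A, B}"
  unfolding C_eq
  by (simp add: generate.eng generate.incl generate_m_inv_closed)

lemma generate_eq_nf: "generate G {A, B} = nf"
proof
  show "nf \<subseteq> generate G {A, B}"
  proof
    fix x assume "x \<in> nf"
    then obtain j k i :: int where x: "x = B [^] j \<otimes> C [^] k \<otimes> A [^] i"
      using mem_nf_iff by blast
    interpret S: subgroup "generate G {A, B}" G by (rule generate_is_subgroup) simp
    have "y [^] (i::int) \<in> generate G {A, B}" if "y \<in> generate G {A, B}" for y i
      using that generate_is_subgroup[of "{A, B}"] by (intro subgroup_int_pow_closed) simp_all
    then show "x \<in> generate G {A, B}"
      unfolding x using C_in_generate by (intro S.m_closed) (simp_all add: generate.incl)
  qed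
qed (rule generate_subset_nf)

text \<open>The purpose is to control the primes: all prime factors of the order divide
  \<open>N\<close>. This separates the part at \<open>p\<close> from the rest before exact orders
  are known.\<close>

lemma generate_finite: "finite (generate G {A, B})"
  and card_generate_dvd: "card (generate G {A, B}) dvd N ^ 3"
proof -
  have sub: "subgroup (generate G {x}) G" if "x \<in> carrier G" for x
    using that by (intro generate_is_subgroup) simp
  have "generate G {C} <#> generate G {B} \<subseteq> generate G {B} <#> generate G {C}"
  proof
    fix x assume "x \<in> generate G {C} <#> generate G {B}"
    then obtain k j :: int where x: "x = C [^] k \<otimes> B [^] j"
      unfolding set_mult_def generate_pow[OF B] generate_pow[OF C] by blast
    obtain l where l: "C [^] k = C [^] (l::nat)" using int_pow_eq_nat_pow[OF C pow_C_N N_pos] by blast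
    have "x = B [^] (j * a ^ l) \<otimes> C [^] int l" unfolding x l pow_C_pow_B by (simp add: int_pow_int)
    then show "x \<in> generate G {B} <#> generate G {C}"
      unfolding set_mult_def generate_pow[OF B] generate_pow[OF C] by blast
  qed
  then have subBC: "subgroup (generate G {B} <#> generate G {C}) G"
    by (intro subgroup_set_mult sub) simp_all
  note fin = finite_generate_singleton[OF A pow_A_N N_pos] finite_generate_singleton[OF B pow_B_N N_pos]
    finite_generate_singleton[OF C pow_C_N N_pos]
  have finBC: "finite (generate G {B} <#> generate G {C})"
    using fin unfolding set_mult_def by auto
  then show "finite (generate G {A, B})"
    using fin unfolding generate_eq_nf nf_def set_mult_def by auto
  have "card nf dvd card (generate G {B} <#> generate G {C}) * card (generate G {A})"
    unfolding nf_def using fin finBC by (intro card_set_mult_dvd subBC sub) simp_all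
  also have "\<dots> dvd (N * N) * N"
  proof (intro mult_dvd_mono)
    have "card (generate G {B} <#> generate G {C}) dvd card (generate G {B}) * card (generate G {C})"
      using fin by (intro card_set_mult_dvd sub) simp_all
    also have "\<dots> dvd N * N" using fin by (intro mult_dvd_mono) simp_all
    finally show "card (generate G {B} <#> generate G {C}) dvd N * N" .
  qed (use fin in simp)
  finally show "card (generate G {A, B}) dvd N ^ 3"
    by (simp add: generate_eq_nf power3_eq_cube)
qed

text \<open>Inverting a product in \<open>nf\<close> gives the order \<open>A\<close>,
  \<open>C\<close>, \<open>B\<close>, and \<open>pow_C_pow_B\<close> then exchanges the last
  two.\<close>

lemma ex_pow_A_B_C:
  assumes "x \<in> generate G {A, B}"
  obtains i j k :: nat where "x = A [^] i \<otimes> B [^] j \<otimes> C [^] k"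
proof -
  have carrier: "x \<in> carrier G"
    using assms generate_in_carrier[of "{A, B}"] by simp
  have "inv x \<in> nf" using assms generate_m_inv_closed[of "{A, B}"] by (simp add: generate_eq_nf)
  then obtain j k i :: int where "inv x = B [^] j \<otimes> C [^] k \<otimes> A [^] i"
    using mem_nf_iff by blast
  then have x: "x = A [^] (-i) \<otimes> (C [^] (-k) \<otimes> B [^] (-j))"
    using carrier inv_inv[of x] by (simp add: int_pow_neg inv_mult_group m_assoc)
  obtain l where l: "C [^] (-k) = C [^] (l::nat)" using int_pow_eq_nat_pow[OF C pow_C_N N_pos] by blast
  obtain n where n: "A [^] (-i) = A [^] (n::nat)" using int_pow_eq_nat_pow[OF A pow_A_N N_pos] by blast
  obtain h where h: "B [^] (-j * a ^ l) = B [^] (h::nat)" using int_pow_eq_nat_pow[OF B pow_B_N N_pos] by blast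
  show thesis
    by (rule that[of n h l]) (simp add: x l pow_C_pow_B h [simplified] n m_assoc)
qed

end

section \<open>Splitting a pair into parts of coprime orders\<close>

lemma cong_coprime_iff:
  assumes "coprime D E" "N = D * E"
  shows "[x = y] (mod int N) \<longleftrightarrow> [x = y] (mod int D) \<and> [x = y] (mod int E)"
  using int_cong_mult_coprime[OF assms(1), of x y] assms(2)
  by (metis cong_dvd_modulus dvd_triv_left dvd_triv_right of_nat_mult)

lemma cong_nat_mult_int: "[n = n'] (mod D) \<Longrightarrow> [int n * x = int n' * x] (mod int D)"
  by (intro cong_mult) (simp_all add: cong_int_iff)

context macdonald_torsion
begin

text \<open>\<open>n\<close> and \<open>j\<close> are the idempotents modulo \<open>N\<close>
  belonging to the factorization \<open>N = D * E\<close>: the powers with exponent \<open>n\<close>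
  are the parts of order dividing \<open>D\<close>, those with exponent \<open>j\<close> the parts
  of order dividing \<open>E\<close>.\<close>

context
  fixes D E n j :: nat
  assumes coprime: "coprime D E" and DE: "N = D * E"
    and nD: "[n = 1] (mod D)" and nE: "[n = 0] (mod E)"
    and jD: "[j = 0] (mod D)" and jE: "[j = 1] (mod E)"
begin

lemma radical_D: "radical_dvd D (a - 1)" and radical_E: "radical_dvd E (a - 1)"
  using radical_dvd_multD[of D E] N by (simp_all add: DE)

lemmas cong_N = cong_coprime_iff[OF coprime DE]

lemma power_n_D: "[a ^ n = a] (mod int D)"
  using power_periodic[OF radical_D nD] by simp

lemma power_n_E: "[a ^ n = 1] (mod int E)"
  using power_periodic[OF radical_E nE] by simp

lemma pow_C_commute_idem: "[int n * a ^ n = int n * a] (mod int N)"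
  unfolding cong_N
proof
  show "[int n * a ^ n = int n * a] (mod int D)"
    using power_n_D by (intro cong_mult cong_refl)
  show "[int n * a ^ n = int n * a] (mod int E)"
    using cong_nat_mult_int[OF nE, of "a ^ n"] cong_nat_mult_int[OF nE, of a]
    by (simp add: cong_def)
qed

lemma pow_sum_idem: "[pow_sum a n = int n * a] (mod int N)"
  unfolding cong_N
proof
  have "[pow_sum a n = a] (mod int D)"
    using pow_sum_periodic[OF radical_D nD] by simp
  then show "[pow_sum a n = int n * a] (mod int D)"
    using cong_nat_mult_int[OF nD, of a] by (simp add: cong_def)
  have "[pow_sum a n = 0] (mod int E)"
    using pow_sum_periodic[OF radical_E nE] by simp
  then show "[pow_sum a n = int n * a] (mod int E)"
    using cong_nat_mult_int[OF nE, of a] by (simp add: cong_def)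
qed

definition Ap where "Ap = A [^] n"
definition Cp where "Cp = C [^] n"

lemma Ap_closed [simp]: "Ap \<in> carrier G" and Cp_closed [simp]: "Cp \<in> carrier G"
  by (simp_all add: Ap_def Cp_def)

lemma pow_A_mult_nat: "Ap [^] (i::int) = A [^] (int n * i)"
  by (simp add: Ap_def int_pow_pow int_pow_int [symmetric])

lemma Ap_Cp: "Ap \<otimes> Cp = Cp \<otimes> Ap [^] a"
proof -
  have "A [^] int n \<otimes> C [^] n = C [^] n \<otimes> A [^] (int n * a)"
    unfolding pow_A_pow_C using int_pow_cong[OF A pow_A_N pow_C_commute_idem] by simp
  then show ?thesis
    by (simp add: pow_A_mult_nat) (simp add: Ap_def Cp_def int_pow_int)
qed

text \<open>At the idempotent exponent \<open>n\<close>, \<open>pow_A_B\<close> becomes the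
  commutator relation for A^n and the whole of \<open>B\<close>: by \<open>pow_sum_idem\<close>, s n
  may be replaced by n a, and \<open>Ap_Cp\<close> reorders the result.\<close>

lemma Ap_B: "Ap \<otimes> B = B \<otimes> Ap \<otimes> Cp"
proof -
  have "Ap \<otimes> B = B \<otimes> (C [^] n \<otimes> A [^] pow_sum a n)"
    using pow_A_B[of n] by (simp add: Ap_def int_pow_int m_assoc)
  also have "A [^] pow_sum a n = Ap [^] a"
    unfolding pow_A_mult_nat by (rule int_pow_cong[OF A pow_A_N pow_sum_idem])
  also have "C [^] n \<otimes> Ap [^] a = Ap \<otimes> Cp"
    using Ap_Cp by (simp add: Cp_def)
  finally show ?thesis by (simp add: m_assoc)
qed

lemma Cp_B: "Cp \<otimes> B [^] (y::int) = B [^] (y * a ^ n) \<otimes> Cp"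
  by (simp add: Cp_def pow_C_pow_B)

lemma B_inv_Cp: "B [^] (y::int) \<otimes> inv Cp = inv Cp \<otimes> B [^] (y * a ^ n)"
proof -
  have "Cp \<otimes> (B [^] y \<otimes> inv Cp) = B [^] (y * a ^ n)"
    by (simp add: m_assoc [symmetric] Cp_B) (simp add: m_assoc)
  then show ?thesis by (metis B Cp_closed int_pow_closed inv_closed inv_solve_left m_closed)
qed

lemma pow_B_inv_Cp: "(B \<otimes> inv Cp) [^] (k::nat) = inv Cp [^] k \<otimes> B [^] pow_sum (a ^ n) k"
proof (induction k)
  case (Suc k)
  have "(B \<otimes> inv Cp) [^] Suc k = inv Cp [^] k \<otimes> (B [^] (pow_sum (a ^ n) k + 1) \<otimes> inv Cp)"
    by (simp add: Suc int_pow_mult m_assoc)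
  also have "\<dots> = inv Cp [^] Suc k \<otimes> B [^] ((pow_sum (a ^ n) k + 1) * a ^ n)"
    unfolding B_inv_Cp by (simp add: m_assoc)
  also have "(pow_sum (a ^ n) k + 1) * a ^ n = pow_sum (a ^ n) (Suc k)"
    using pow_sum_add[of "a ^ n" 1 k] by (simp add: algebra_simps)
  finally show ?case .
qed simp

lemma pow_B_Ap: "B [^] k \<otimes> Ap = Ap \<otimes> (inv Cp [^] k \<otimes> B [^] pow_sum (a ^ n) k)" for k :: nat
proof -
  have "B \<otimes> Ap = Ap \<otimes> (B \<otimes> inv Cp)"
  proof -
    have "B \<otimes> Ap \<otimes> Cp \<otimes> inv Cp = Ap \<otimes> B \<otimes> inv Cp" by (simp only: Ap_B)
    then show ?thesis by (simp add: m_assoc)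
  qed
  from int_pow_commute[OF _ _ _ this, of "int k"] show ?thesis
    by (simp add: int_pow_int pow_B_inv_Cp)
qed

lemma dvd_power_n: "radical_dvd D (a ^ n - 1)"
  using radical_D power_cong_1[of "a - 1" a n] unfolding radical_dvd_def by (meson dvd_refl dvd_trans)

lemma inv_Cp_pow_cong: "[n * k = i] (mod N) \<Longrightarrow> inv Cp [^] k = inv (C [^] i)"
  by (simp add: Cp_def nat_pow_inv nat_pow_pow) (metis nat_pow_cong[OF C pow_C_N])

text \<open>In \<open>pow_B_Ap\<close> at \<open>j\<close> the factor C^(n j) disappears because
  \<open>N\<close> divides n j. The exponent of \<open>B\<close> stays congruent to
  \<open>j\<close>: modulo \<open>D\<close> both vanish, and modulo \<open>E\<close> the sum has
  \<open>j\<close> terms a^(n i), each equal to 1.\<close>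

lemma pow_parts_commute: "B [^] j \<otimes> A [^] n = A [^] n \<otimes> B [^] j"
proof -
  have "[n * j = 0] (mod D)" using cong_mult[OF nD jD] by simp
  moreover have "[n * j = 0] (mod E)" using cong_mult[OF nE jE] by simp
  ultimately have "[n * j = 0] (mod N)"
    unfolding DE using coprime by (intro coprime_cong_mult_nat)
  then have "inv Cp [^] j = \<one>" using inv_Cp_pow_cong[of j 0] by simp
  moreover have "B [^] pow_sum (a ^ n) j = B [^] int j"
  proof (rule int_pow_cong[OF B pow_B_N], unfold cong_N, intro conjI)
    have "D dvd j" using jD by (simp add: cong_0_iff)
    then show "[pow_sum (a ^ n) j = int j] (mod int D)"
      using dvd_pow_sum[OF dvd_power_n] by (simp add: cong_def dvd_eq_mod_eq_0 [symmetric] flip: of_nat_mod)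
    have "[pow_sum (a ^ n) j = pow_sum 1 j] (mod int E)"
      by (rule pow_sum_cong[OF power_n_E])
    then show "[pow_sum (a ^ n) j = int j] (mod int E)"
      by (simp add: pow_sum_def)
  qed
  ultimately show ?thesis
    using pow_B_Ap[of j] by (simp add: Ap_def int_pow_int)
qed

text \<open>The commutator relation comes from \<open>pow_B_Ap\<close> at \<open>n\<close>.
  Idempotence gives C^(n n) = C^n, and the power sum of a^n reduces to n a^n: modulo
  \<open>D\<close> one term remains, modulo \<open>E\<close> all terms are 1.\<close>

lemma part: "macdonald_torsion G (A [^] n) (B [^] n) (C [^] n) a D"
proof (intro macdonald_torsion.intro macdonald_torsion_axioms.intro macdonald_pair.intro macdonald_pair_axioms.intro)
  show "group G" ..
  show "A [^] n \<otimes> C [^] n = C [^] n \<otimes> (A [^] n) [^] a"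
    using Ap_Cp by (simp add: Ap_def Cp_def)
  have BB: "B [^] (int n * a ^ n) = (B [^] n) [^] a"
    using int_pow_cong[OF B pow_B_N pow_C_commute_idem]
    by (simp add: int_pow_pow flip: int_pow_int)
  then show "C [^] n \<otimes> B [^] n = (B [^] n) [^] a \<otimes> C [^] n"
    using pow_C_pow_B[of n "int n"] by (simp add: int_pow_int)
  have "[n * n = n] (mod D)" using cong_mult[OF nD nD] nD by (simp add: cong_def)
  moreover have "[n * n = n] (mod E)" using cong_mult[OF nE nE] nE by (simp add: cong_def)
  ultimately have "[n * n = n] (mod N)"
    unfolding DE using coprime by (intro coprime_cong_mult_nat)
  then have "inv Cp [^] n = inv Cp" using inv_Cp_pow_cong[of n n] by (simp add: Cp_def)
  moreover have "B [^] pow_sum (a ^ n) n = B [^] (int n * a ^ n)"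
  proof (rule int_pow_cong[OF B pow_B_N], unfold cong_N, intro conjI)
    have "[pow_sum (a ^ n) n = pow_sum (a ^ n) 1] (mod int D)"
      by (rule pow_sum_periodic[OF dvd_power_n nD])
    then show "[pow_sum (a ^ n) n = int n * a ^ n] (mod int D)"
      using cong_nat_mult_int[OF nD, of "a ^ n"] by (simp add: cong_def)
    have "[pow_sum (a ^ n) n = pow_sum 1 n] (mod int E)"
      by (rule pow_sum_cong[OF power_n_E])
    moreover have "[int n * a ^ n = int n * 1] (mod int E)"
      using power_n_E by (intro cong_mult cong_refl)
    ultimately show "[pow_sum (a ^ n) n = int n * a ^ n] (mod int E)"
      by (simp add: pow_sum_def cong_def)
  qed
  ultimately have "B [^] n \<otimes> Ap = Ap \<otimes> (inv Cp \<otimes> B [^] (int n * a ^ n))"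
    using pow_B_Ap[of n] by simp
  also have "inv Cp \<otimes> B [^] (int n * a ^ n) = B [^] n \<otimes> inv Cp"
    using B_inv_Cp[of "int n"] by (simp add: int_pow_int)
  finally have "B [^] n \<otimes> Ap \<otimes> Cp = Ap \<otimes> B [^] n"
    by (simp add: m_assoc)
  then show "A [^] n \<otimes> B [^] n = B [^] n \<otimes> A [^] n \<otimes> C [^] n"
    by (simp add: Ap_def Cp_def)
  show "radical_dvd D (a - 1)" by (rule radical_D)
  have "[n * D = 0] (mod N)"
    using nE by (auto simp: cong_0_iff DE mult.commute)
  then show "(A [^] n) [^] D = \<one>" "(B [^] n) [^] D = \<one>"
    using nat_pow_cong[OF A pow_A_N] nat_pow_cong[OF B pow_B_N] by (simp_all add: nat_pow_pow)
qed simp_all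

end

end

section \<open>Finiteness of the order of the generators\<close>

lemma defect_mod_power:
  fixes a :: int
  shows "(a - 1) * defect a n = a - a ^ n + (int n - 1) * (a - 1) * a ^ n"
proof -
  have "(a - 1) * defect a n = int n * (a - 1) * a ^ n - a * (a ^ n - 1)"
    unfolding defect_def right_diff_distrib pow_sum_geometric by (simp add: algebra_simps)
  then show ?thesis by (simp add: algebra_simps)
qed

text \<open>Suppose \<open>l\<close> divides all these defects, and let \<open>d > 1\<close> be the
  order of \<open>a\<close> modulo \<open>l\<close>. Whenever \<open>l\<close> divides a^k - 1,
  \<open>defect_mod_power\<close> shows that it divides a - a^(a^k), that is, \<open>d\<close>
  divides a^k - 1. Fermat's exponent k = l - 1 thus makes \<open>d\<close> coprime to
  \<open>a\<close>. For Euler's exponent k = totient d the difference a - a^(a^k) vanishes modulo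
  \<open>l\<close>, so the other summand forces \<open>l\<close> to divide a^k - 1; then
  \<open>d\<close> divides totient d, which is smaller.\<close>

lemma ex_not_prime_dvd_defect:
  fixes a l :: nat
  assumes l: "prime l" and a: "\<not> l dvd a" "\<not> int l dvd int a - 1"
  shows "\<exists>k. \<not> int l dvd defect (int a) (a ^ k)"
proof (rule ccontr)
  assume "\<not> ?thesis"
  then have dvd: "int l dvd defect (int a) (a ^ k)" for k by blast
  have a_pos: "a > 0" using a(1) by (cases a) auto
  have cop: "coprime a l" using prime_imp_coprime[OF l a(1)] by (simp add: coprime_commute)
  define d where "d = ord l a"
  have ord: "int l dvd int a ^ e - 1 \<longleftrightarrow> d dvd e" for e
  proof -
    have "[a ^ e = 1] (mod l) \<longleftrightarrow> [int (a ^ e) = int 1] (mod int l)" by (simp only: cong_int_iff)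
    then show ?thesis using ord_divides[of a e l] by (simp add: cong_iff_dvd_diff d_def)
  qed
  have "d \<noteq> 1" using ord[of 1] a(2) by auto
  moreover have "d \<noteq> 0" using cop by (simp add: d_def ord_eq_0 coprime_commute)
  ultimately have d: "1 < d" by simp
  have prime_l: "prime (int l)" using l by simp
  have not_dvd_a: "\<not> int l dvd int a" using a(1) by (simp only: int_dvd_int_iff not_False_eq_True)
  have coprime_dvd: "int l dvd y" if "int l dvd int a * y" for y
    using prime_dvd_multD[OF prime_l that] not_dvd_a by argo
  have key: "int l dvd int a - int a ^ n \<longleftrightarrow> d dvd n - 1" if "n > 0" for n
  proof -
    have "int a ^ n = int a * int a ^ (n - 1)"
      using power_Suc[of "int a" "n - 1"] that by simp
    then have "int a - int a ^ n = int a * - (int a ^ (n - 1) - 1)"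
      by (simp add: right_diff_distrib)
    then have "int l dvd int a - int a ^ n \<longleftrightarrow> int l dvd - (int a ^ (n - 1) - 1)"
      using coprime_dvd dvd_mult by metis
    then show ?thesis by (simp only: dvd_minus_iff ord)
  qed
  have defect_dvd: "int l dvd int a - int a ^ (a ^ k) + (int (a ^ k) - 1) * (int a - 1) * int a ^ (a ^ k)" for k
    unfolding defect_mod_power [symmetric] using dvd by (rule dvd_mult)
  have n_pos: "a ^ k > 0" for k using a_pos by simp
  have step: "d dvd a ^ k - 1" if "int l dvd int a ^ k - 1" for k
  proof -
    have "int l dvd int (a ^ k) - 1" using that by simp
    then have 1: "int l dvd (int (a ^ k) - 1) * (int a - 1) * int a ^ (a ^ k)"
      by (intro dvd_mult2)
    have "int l dvd int a - int a ^ (a ^ k)"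
      using defect_dvd[of k] unfolding dvd_add_left_iff[OF 1] .
    then show ?thesis unfolding key[OF n_pos] .
  qed
  have "int l dvd int a ^ (l - 1) - 1"
  proof -
    have "[a ^ (l - 1) = 1] (mod l)" using fermat_theorem[OF l a(1)] .
    then show ?thesis unfolding ord d_def ord_divides .
  qed
  from step[OF this] have "coprime a d"
  proof -
    assume "d dvd a ^ (l - 1) - 1"
    moreover have "coprime (a ^ (l - 1) - 1) a"
    proof -
      have "coprime (a ^ (l - 1) - 1) (a ^ (l - 1))"
        using a_pos by (intro coprime_diff_one_left_nat) simp
      then have "coprime (a ^ (l - 1) - 1) a \<or> l - 1 = 0"
        by (simp only: coprime_power_right_iff)
      then show ?thesis using prime_gt_1_nat[OF l] by linarith
    qed
    ultimately have "coprime d a"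
      by (rule coprime_divisors[OF _ dvd_refl])
    then show ?thesis by (simp only: coprime_commute)
  qed
  define t where "t = totient d"
  have "[a ^ t = 1] (mod d)" unfolding t_def using \<open>coprime a d\<close> by (rule euler_theorem)
  then have "int d dvd int (a ^ t) - int 1"
    by (simp only: cong_int_iff [symmetric] cong_iff_dvd_diff)
  also have "int (a ^ t) - int 1 = int (a ^ t - 1)"
    using a_pos by (intro of_nat_diff [symmetric]) simp
  finally have "d dvd a ^ t - 1"
    by (simp only: int_dvd_int_iff)
  then have 2: "int l dvd int a - int a ^ (a ^ t)" unfolding key[OF n_pos] .
  have "int l dvd (int (a ^ t) - 1) * (int a - 1) * int a ^ (a ^ t)"
    using defect_dvd[of t] unfolding dvd_add_right_iff[OF 2] .
  moreover have "\<not> int l dvd int a ^ (a ^ t)"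
    using prime_dvd_power[OF prime_l] not_dvd_a by blast
  ultimately have "int l dvd (int (a ^ t) - 1) * (int a - 1)"
    using prime_dvd_multD[OF prime_l] by metis
  then have "int l dvd int (a ^ t) - 1"
    using prime_dvd_multD[OF prime_l] a(2) by metis
  then have "int l dvd int a ^ t - 1" by simp
  then have "d dvd t" unfolding ord .
  then have "d \<le> t" using d by (intro dvd_imp_le) (simp_all add: t_def)
  then show False using totient_less[OF d] by (simp add: t_def)
qed

text \<open>For n at least 2 the defect is -a modulo a^2, and a^2 does not divide \<open>a\<close>.
  The exponent 2 makes the number of factors positive for negative \<open>a\<close> too.\<close>

lemma defect_square_nonzero:
  fixes a :: int
  assumes "\<bar>a\<bar> \<ge> 2" shows "defect a (nat (a ^ 2)) \<noteq> 0"
proof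
  assume 0: "defect a (nat (a ^ 2)) = 0"
  have "2 * 2 \<le> \<bar>a\<bar> * \<bar>a\<bar>" using assms by (intro mult_mono) simp_all
  then have n: "4 \<le> nat (a ^ 2)" by (simp add: power2_eq_square abs_mult [symmetric])
  then obtain m where m: "nat (a ^ 2) = Suc (Suc m)"
    using le_Suc_ex[of 2 "nat (a ^ 2)"] by auto
  have "pow_sum a (Suc (Suc m)) = a + a ^ 2 * (1 + pow_sum a m)"
    using pow_sum_add[of a 1 "Suc m"] pow_sum_add[of a 1 m] by (simp add: power2_eq_square algebra_simps)
  then have "a = a ^ 2 * (int (Suc (Suc m)) * a ^ m - (1 + pow_sum a m))"
    using 0 unfolding m defect_def by (simp add: power2_eq_square algebra_simps)
  then have "a ^ 2 dvd a" by (rule dvdI)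
  then have "\<bar>a ^ 2\<bar> \<le> \<bar>a\<bar>" using assms by (intro dvd_imp_le_int) auto
  then have "\<bar>a\<bar> * \<bar>a\<bar> \<le> \<bar>a\<bar>" by (simp only: power2_eq_square abs_mult)
  moreover have "2 * \<bar>a\<bar> \<le> \<bar>a\<bar> * \<bar>a\<bar>" using assms by (intro mult_right_mono) simp_all
  ultimately show False using assms by linarith
qed

section \<open>Orders of the generators\<close>

context macdonald_pair
begin

lemma change_exponent:
  assumes "A [^] (N::nat) = \<one>" "B [^] N = \<one>" "[a = b] (mod int N)"
  shows "macdonald_pair G A B C b"
proof
  show "A \<otimes> C = C \<otimes> A [^] b"
    using AC int_pow_cong[OF A assms(1,3)] by simp
  show "C \<otimes> B = B [^] b \<otimes> C"
    using CB int_pow_cong[OF B assms(2,3)] by simp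
qed (simp_all add: AB)

lemma commute_C:
  assumes x: "x \<in> carrier G" and xB: "x \<otimes> B = B \<otimes> x" and xA: "x \<otimes> A = A \<otimes> x"
  shows "x \<otimes> C = C \<otimes> x"
proof -
  have "(B \<otimes> A) \<otimes> (x \<otimes> C) = B \<otimes> (A \<otimes> x) \<otimes> C" using x by (simp add: m_assoc)
  also have "\<dots> = (B \<otimes> x) \<otimes> A \<otimes> C" unfolding xA [symmetric] using x by (simp add: m_assoc)
  also have "\<dots> = x \<otimes> (A \<otimes> B)" unfolding xB [symmetric] AB using x by (simp add: m_assoc)
  also have "\<dots> = A \<otimes> x \<otimes> B" using x by (simp add: m_assoc [symmetric] xA)
  also have "\<dots> = A \<otimes> B \<otimes> x" using x by (simp add: m_assoc xB)
  also have "\<dots> = (B \<otimes> A) \<otimes> (C \<otimes> x)" unfolding AB using x by (simp add: m_assoc)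
  finally show ?thesis using x by (simp del: m_assoc)
qed

text \<open>For \<open>a = -1\<close> the only positive power of \<open>a\<close> is 1, whose defect
  is 0, so \<open>defect_pow\<close> gives nothing. Instead, computing the inverse of A B A^(-1) in
  two ways yields A^2 = B^(-2). Hence A^2 commutes with \<open>A\<close>, \<open>B\<close> and
  \<open>C\<close>, while conjugation by \<open>C\<close> inverts it.\<close>

lemma pow_A_4:
  assumes "a = -1" shows "A [^] (4::int) = \<one>"
proof -
  have AC': "A \<otimes> C = C \<otimes> inv A" and CB': "C \<otimes> B = inv B \<otimes> C"
    using AC CB by (simp_all add: assms int_pow_neg)
  interpret s: macdonald_pair G B A "inv C" a by (rule swap)
  have BC': "inv C \<otimes> A = inv A \<otimes> inv C"
    using s.CB by (simp add: assms int_pow_neg)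
  have iCB: "inv C \<otimes> inv B = B \<otimes> inv C"
    using s.AC by (simp add: assms int_pow_neg)
  have 1: "A \<otimes> B \<otimes> inv A = B \<otimes> C \<otimes> A [^] (-2::int)"
  proof -
    have "A \<otimes> B \<otimes> inv A = B \<otimes> (A \<otimes> C) \<otimes> inv A" by (simp add: AB m_assoc)
    also have "\<dots> = B \<otimes> C \<otimes> (inv A \<otimes> inv A)" unfolding AC' by (simp add: m_assoc)
    also have "inv A \<otimes> inv A = A [^] (-2::int)"
      using int_pow_mult[OF A, of "-1" "-1"] by (simp add: int_pow_neg)
    finally show ?thesis .
  qed
  have 2: "A \<otimes> inv B = inv B \<otimes> inv C \<otimes> A"
  proof -
    have "A \<otimes> inv B \<otimes> C = A \<otimes> C \<otimes> B" by (simp add: CB' m_assoc)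
    also have "\<dots> = C \<otimes> (inv A \<otimes> B)" by (simp add: AC' m_assoc)
    also have "inv A \<otimes> B = B \<otimes> A \<otimes> inv C"
    proof -
      have "A \<otimes> (B \<otimes> A \<otimes> inv C) = A \<otimes> B \<otimes> (A \<otimes> inv C)" by (simp add: m_assoc)
      also have "\<dots> = B \<otimes> (A \<otimes> C) \<otimes> (A \<otimes> inv C)" by (simp add: AB m_assoc)
      also have "\<dots> = B \<otimes> (C \<otimes> (inv A \<otimes> (A \<otimes> inv C)))" unfolding AC' by (simp add: m_assoc)
      also have "inv A \<otimes> (A \<otimes> inv C) = inv C" by (simp add: m_assoc [symmetric])
      also have "B \<otimes> (C \<otimes> inv C) = B" by simp
      finally have "inv A \<otimes> B = inv A \<otimes> (A \<otimes> (B \<otimes> A \<otimes> inv C))" by simp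
      also have "\<dots> = B \<otimes> A \<otimes> inv C" by (simp add: m_assoc [symmetric])
      finally show ?thesis .
    qed
    also have "C \<otimes> (B \<otimes> A \<otimes> inv C) = inv B \<otimes> (C \<otimes> A \<otimes> inv C)"
      by (simp add: m_assoc [symmetric] CB')
    finally have "A \<otimes> inv B \<otimes> C = inv B \<otimes> (C \<otimes> A \<otimes> inv C)"
      by (simp add: m_assoc)
    then have "A \<otimes> inv B \<otimes> C \<otimes> inv C = inv B \<otimes> (C \<otimes> A \<otimes> inv C) \<otimes> inv C" by simp
    then have "A \<otimes> inv B = inv B \<otimes> (C \<otimes> A \<otimes> inv C \<otimes> inv C)"
      by (simp add: m_assoc)
    also have "C \<otimes> A \<otimes> inv C \<otimes> inv C = inv C \<otimes> A"
    proof -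
      have "C \<otimes> A = inv A \<otimes> C"
        using int_pow_commute[OF A _ C AC', of "-1"] by (simp add: int_pow_neg)
      then have "C \<otimes> A \<otimes> inv C \<otimes> inv C = inv A \<otimes> inv C" by (simp add: m_assoc)
      then show ?thesis by (simp add: BC')
    qed
    finally show ?thesis by (simp add: m_assoc)
  qed
  have "inv (A \<otimes> B \<otimes> inv A) = A \<otimes> inv B \<otimes> inv A"
    by (simp add: inv_mult_group m_assoc)
  also have "\<dots> = inv B \<otimes> inv C"
    unfolding 2 by (simp add: m_assoc)
  finally have "inv (A \<otimes> B \<otimes> inv A) = inv B \<otimes> inv C" .
  moreover have "inv (A \<otimes> B \<otimes> inv A) = A [^] (2::int) \<otimes> B \<otimes> inv C"
    unfolding 1 by (simp add: inv_mult_group int_pow_neg m_assoc iCB)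
  ultimately have "A [^] (2::int) \<otimes> B = inv B"
    by (metis A B C int_pow_closed inv_closed m_closed right_cancel)
  then have A2: "A [^] (2::int) = inv B \<otimes> inv B"
    by (simp add: inv_solve_right)
  have "A [^] (2::int) \<otimes> B = B \<otimes> A [^] (2::int)"
    unfolding A2 by (simp add: m_assoc [symmetric]) (simp add: m_assoc)
  moreover have "A [^] (2::int) \<otimes> A = A \<otimes> A [^] (2::int)"
    by (rule int_pow_commute) simp_all
  ultimately have "A [^] (2::int) \<otimes> C = C \<otimes> A [^] (2::int)"
    by (intro commute_C) simp_all
  then have "A [^] (-2::int) = A [^] (2::int)"
    using pow_A_pow_C[of 2 1] by (simp add: assms)
  then have "A [^] (2::int) \<otimes> A [^] (2::int) = A [^] (2::int) \<otimes> A [^] (-2::int)" by simp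
  then show ?thesis by (simp only: int_pow_mult [OF A, symmetric]) simp
qed

lemma ex_pow_A:
  assumes "a \<notin> {0, 1}"
  obtains N :: nat where "N > 0" "A [^] N = \<one>"
proof (cases "a = -1")
  case True
  have "A [^] int 4 = \<one>" using pow_A_4[OF True] by simp
  then show thesis by (intro that[of 4]) (simp_all only: int_pow_int)
next
  case False
  then have a: "\<bar>a\<bar> \<ge> 2" using assms by auto
  define i where "i = defect a (nat (a ^ 2)) * (a - 1)"
  have "i \<noteq> 0" using defect_square_nonzero[OF a] assms by (simp add: i_def)
  moreover have "A [^] i = \<one>"
    unfolding i_def by (rule defect_pow(4)) simp
  ultimately have "nat \<bar>i\<bar> > 0" "A [^] int (nat \<bar>i\<bar>) = \<one>"
    by (auto simp: abs_if int_pow_neg)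
  then show thesis by (intro that[of "nat \<bar>i\<bar>"]) (simp_all only: int_pow_int)
qed

text \<open>Replacing \<open>a\<close> by a congruent \<open>b\<close> at least 2 makes all b^k
  available. If \<open>l\<close> divides \<open>b\<close>, conjugation by \<open>C\<close> sends A
  to the power d / l to the identity, which is impossible. Otherwise some defect w at a power of
  \<open>b\<close> is prime to \<open>l\<close>, contradicting that \<open>d\<close> divides w (b -
  1).\<close>

lemma prime_dvd_ord_A:
  assumes a: "a \<notin> {0, 1}" and l: "prime l" "l dvd ord A"
  shows "int l dvd a - 1"
proof (rule ccontr)
  assume not_dvd: "\<not> int l dvd a - 1"
  obtain M where M: "M > 0" "A [^] (M::nat) = \<one>" using ex_pow_A[OF a] .
  interpret s: macdonald_pair G B A "inv C" a by (rule swap)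
  obtain M' where M': "M' > 0" "B [^] (M'::nat) = \<one>" using s.ex_pow_A[OF a] .
  define d where "d = ord A"
  have d: "d > 0" "l dvd d" "A [^] d = \<one>"
    using M l by (auto simp: d_def ord_eq_0 intro!: Nat.gr0I)
  define L where "L = d * M'"
  have "A [^] L = (A [^] d) [^] M'" "B [^] L = (B [^] M') [^] d"
    by (simp_all add: L_def nat_pow_pow mult.commute)
  then have L: "L > 0" "A [^] L = \<one>" "B [^] L = \<one>"
    using M' d by (simp_all add: L_def)
  \<comment> \<open>A multiple of \<open>L\<close>, so that the relations survive, and of
    \<open>l\<close>, so that \<open>b - 1\<close> stays prime to \<open>l\<close>; its size makes
    \<open>a + X\<close> at least 2.\<close>
  define X where "X = int L * (\<bar>a\<bar> + 2)"
  have "\<bar>a\<bar> + 2 \<le> X"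
    unfolding X_def using mult_right_mono[of 1 "int L" "\<bar>a\<bar> + 2"] L(1) by simp
  then have "2 \<le> a + X" using abs_ge_minus_self[of a] by linarith
  moreover define b where "b = nat (a + X)"
  ultimately have b: "int b = a + X" by simp
  have "[a = int b] (mod int L)" by (simp add: b X_def cong_iff_dvd_diff)
  then interpret P: macdonald_pair G A B C "int b"
    by (intro change_exponent[OF L(2,3)])
  have "int l dvd X" using d(2) by (simp add: X_def L_def)
  then have "\<not> int l dvd (a - 1) + X" using not_dvd by (rule not_dvd_add)
  then have not_dvd_b: "\<not> int l dvd int b - 1" by (simp add: b algebra_simps)
  have "\<not> l dvd b"
  proof
    assume "l dvd b"
    obtain e where e: "d = l * e" using d(2) by (rule dvdE)
    obtain f where f: "b = l * f" using \<open>l dvd b\<close> by (rule dvdE)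
    have "C \<otimes> A [^] (int e * int b) = A [^] int e \<otimes> C"
      using P.pow_A_pow_C[of "int e" 1] by simp
    moreover have "int e * int b = int d * int f" by (simp add: e f)
    moreover have "A [^] (int d * int f) = \<one>"
      using d(3) by (simp add: int_pow_pow [symmetric] int_pow_int)
    ultimately have "A [^] int e \<otimes> C = C" by (simp only: r_one C)
    then have "A [^] e = \<one>" by (simp add: int_pow_int)
    then have "d dvd e" by (simp only: pow_eq_id A d_def)
    moreover have "0 < e" "e < d" using e d(1) prime_gt_1_nat[OF l(1)] by simp_all
    ultimately show False by (simp add: nat_dvd_not_less)
  qed
  then obtain k where k: "\<not> int l dvd defect (int b) (b ^ k)"
    using ex_not_prime_dvd_defect[OF l(1) _ not_dvd_b] by blast
  have "A [^] (defect (int b) (b ^ k) * (int b - 1)) = \<one>"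
    by (rule P.defect_pow(4)[of _ k]) simp
  then have "int d dvd defect (int b) (b ^ k) * (int b - 1)"
    by (simp only: d_def int_pow_eq_id A)
  moreover have "int l dvd int d" using d(2) by (simp only: int_dvd_int_iff)
  ultimately have "int l dvd defect (int b) (b ^ k) * (int b - 1)"
    by (rule dvd_trans[rotated])
  moreover have "prime (int l)" using l(1) by simp
  ultimately show False using k not_dvd_b prime_dvd_multD[of "int l"] by metis
qed

lemma ex_torsion:
  assumes "a \<notin> {0, 1}"
  obtains N where "radical_dvd N (a - 1)" "A [^] N = \<one>" "B [^] N = \<one>"
proof -
  interpret s: macdonald_pair G B A "inv C" a by (rule swap)
  have pos: "ord A > 0" "ord B > 0"
    using ex_pow_A[OF assms] s.ex_pow_A[OF assms] ord_eq_0[OF A] ord_eq_0[OF B] by auto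
  show thesis
  proof (rule that[of "ord A * ord B"])
    show "radical_dvd (ord A * ord B) (a - 1)"
      unfolding radical_dvd_def
    proof (intro conjI allI impI)
      fix l :: nat assume l: "prime l \<and> l dvd ord A * ord B"
      then have "l dvd ord A \<or> l dvd ord B" using prime_dvd_multD by blast
      then show "int l dvd a - 1"
        using l prime_dvd_ord_A[OF assms] s.prime_dvd_ord_A[OF assms] by blast
    qed (use pos in simp)
  qed (simp_all add: pow_eq_id)
qed

end

section \<open>Upper bound for the Sylow subgroup\<close>

lemma macdonald_exponent_cong:
  assumes "[a = b] (mod 9)" "3 dvd a - 1"
  shows "macdonald_exponent 3 m a = macdonald_exponent 3 m b"
proof -
  obtain h where h: "a - 1 = 3 * h" using assms(2) by (rule dvdE)
  obtain k where k: "b - a = 9 * k" using assms(1) by (metis cong_iff_dvd_diff cong_sym dvdE)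
  have "b - 1 = 3 * (h + 3 * k)" using h k by simp
  then have "(b - 1) div 3 = h + 3 * k" "(a - 1) div 3 = h" using h by simp_all
  moreover have "[h + 3 * k = h] (mod 3)" by (simp add: cong_iff_dvd_diff)
  ultimately have "[(a - 1) div 3 = -1] (mod 3) \<longleftrightarrow> [(b - 1) div 3 = -1] (mod 3)"
    by (simp add: cong_def)
  then show ?thesis by (simp add: macdonald_exponent_def)
qed

lemma ex_macdonald_prime:
  fixes a :: int
  assumes p: "prime p" "1 \<le> m" "int p ^ m dvd a - 1" "\<not> int p ^ Suc m dvd a - 1"
  obtains b where "macdonald_prime p m b" "[a = b] (mod int p ^ e)"
    "macdonald_exponent p m b = macdonald_exponent p m a"
proof -
  \<comment> \<open>The exponent exceeds \<open>e\<close> for the congruence, is large enough to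
    preserve the valuation \<open>m\<close>, and is at least 2 because for \<open>p = 3\<close> the
    exponent depends on \<open>a\<close> modulo 9.\<close>
  define L where "L = int p ^ (e + m + 2)"
  have L: "L > 0" using prime_gt_0_nat[OF p(1)] by (simp add: L_def)
  define b where "b = a + L * (\<bar>a\<bar> + 2)"
  have "\<bar>a\<bar> + 2 \<le> L * (\<bar>a\<bar> + 2)" using L mult_right_mono[of 1 L "\<bar>a\<bar> + 2"] by simp
  then have b2: "2 \<le> b" unfolding b_def using abs_ge_minus_self[of a] by linarith
  have L_dvd: "L dvd b - a" by (simp add: b_def)
  have dvd: "int p ^ i dvd b - a" if "i \<le> e + m + 2" for i
    using dvd_trans[OF le_imp_power_dvd[OF that] L_dvd[unfolded L_def]] .
  have b1: "b - 1 = (a - 1) + (b - a)" by simp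
  have "macdonald_prime p m b"
  proof
    show "int p ^ m dvd b - 1" unfolding b1 using p(3) dvd[of m] by (intro dvd_add) simp_all
    show "\<not> int p ^ Suc m dvd b - 1" unfolding b1 using p(4) dvd[of "Suc m"] by (intro not_dvd_add) simp_all
  qed (use p b2 in simp_all)
  moreover have "[a = b] (mod int p ^ e)"
    using dvd[of e] by (simp add: cong_iff_dvd_diff dvd_diff_commute)
  moreover have "macdonald_exponent p m b = macdonald_exponent p m a"
  proof (cases "p = 3")
    case True
    have "(3::int) ^ 2 dvd b - a" using dvd[of 2] True by simp
    then have "[a = b] (mod 9)" by (simp add: cong_iff_dvd_diff dvd_diff_commute)
    moreover have "3 dvd a - 1"
      using dvd_trans[OF dvd_power[of m "int p"] p(3)] p(2) True by simp
    ultimately show ?thesis using macdonald_exponent_cong True by simp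
  next
    case False
    then show ?thesis by (simp add: macdonald_exponent_def)
  qed
  ultimately show thesis by (rule that)
qed

text \<open>In a group of exponent \<open>p ^ e\<close> this recovers x^i from x^(i u).\<close>

lemma ex_inverse_prime_power:
  assumes "prime p" "\<not> int p dvd u"
  obtains y :: int where "\<forall>i. [i = i * u * y] (mod int (p ^ e))"
proof -
  have "coprime u (int (p ^ e))"
    using prime_imp_coprime[of "int p" u] assms by (simp add: coprime_commute)
  then obtain y where y: "[u * y = 1] (mod int (p ^ e))"
    using coprime_iff_invertible_int[of u] by blast
  have "[i = i * u * y] (mod int (p ^ e))" for i
    using cong_mult[OF cong_refl[of i] cong_sym[OF y]] by (simp add: mult.assoc)
  then show thesis by (intro that) blast
qed

locale macdonald_p_group = macdonald_pair +
  fixes p m e :: nat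
  assumes p: "prime p" and m: "1 \<le> m" and dvd: "int p ^ m dvd a - 1" and not_dvd: "\<not> int p ^ Suc m dvd a - 1"
    and pow_A: "A [^] (p ^ e) = \<one>" and pow_B: "B [^] (p ^ e) = \<one>"
begin

abbreviation v :: nat where "v \<equiv> macdonald_exponent p m a"

text \<open>Take a defect w = p^v u with \<open>u\<close> prime to \<open>p\<close>. Since
  \<open>A\<close> and \<open>B\<close> have \<open>p\<close>-power order, their powers with
  exponent p^v are powers of A^w and B^w and inherit \<open>defect_pow\<close>. For
  \<open>C\<close>, use \<open>pow_A_B\<close> at p^v: A^(p^v) commutes with \<open>B\<close> and
  p^v divides the power sum, so C^(p^v) is what is left over.\<close>

lemma eps_relations:
  shows "A [^] (p ^ (v + m)) = \<one>"
    and "B [^] (int p ^ v) = A [^] (- (int p ^ v))"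
    and "A [^] (int p ^ v) \<otimes> B = B \<otimes> A [^] (int p ^ v)"
    and "A [^] (int p ^ v) \<otimes> C = C \<otimes> A [^] (int p ^ v)"
    and "\<exists>z :: int. C [^] (int p ^ v) = A [^] (int p ^ v * z)"
proof -
  obtain b where b: "macdonald_prime p m b" "[a = b] (mod int p ^ e)" "macdonald_exponent p m b = v"
    using ex_macdonald_prime[OF p m dvd not_dvd] .
  interpret b: macdonald_prime p m b by (rule b(1))
  have "[a = b] (mod int (p ^ e))" using b(2) by simp
  then interpret P: macdonald_pair G A B C b
    by (rule change_exponent[OF pow_A pow_B])
  obtain k where k: "\<not> int p ^ Suc v dvd defect b (nat (b ^ k))"
    using b.ex_not_dvd_defect_power unfolding b(3) by blast
  define w where "w = defect b (nat (b ^ k))"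
  have "int (nat (b ^ k)) = b ^ k" using b.a_pow_ge_1[of k] by simp
  note pows = P.defect_pow[OF this, folded w_def]
  obtain u where u: "w = int p ^ v * u"
    using b.dvd_defect_power[of k] unfolding b(3) w_def [symmetric] by (rule dvdE)
  have not_u: "\<not> int p dvd u"
    using k unfolding w_def [symmetric] u by (auto simp: mult.commute)
  obtain z where "\<forall>i. [i = i * u * z] (mod int (p ^ e))"
    using ex_inverse_prime_power[OF p not_u, where e = e] .
  then have z: "A [^] (i :: int) = A [^] (i * u * z)" "B [^] (i :: int) = B [^] (i * u * z)" for i
    using int_pow_cong[OF A pow_A] int_pow_cong[OF B pow_B] by blast+
  have A_eps: "A [^] (int p ^ v) = (A [^] w) [^] z"
    using z(1)[of "int p ^ v"] by (simp add: u int_pow_pow)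
  show com_B: "A [^] (int p ^ v) \<otimes> B = B \<otimes> A [^] (int p ^ v)"
    unfolding A_eps using int_pow_commute[OF _ _ _ pows(1)] by simp
  show "A [^] (int p ^ v) \<otimes> C = C \<otimes> A [^] (int p ^ v)"
    unfolding A_eps using int_pow_commute[OF _ _ _ pows(2)] by simp
  have "B [^] (int p ^ v) = (B [^] w) [^] z"
    using z(2)[of "int p ^ v"] by (simp add: u int_pow_pow)
  also have "\<dots> = A [^] (- (int p ^ v) * u * z)"
    unfolding pows(3) by (simp add: int_pow_pow u)
  also have "\<dots> = A [^] (- (int p ^ v))"
    by (rule z(1)[symmetric])
  finally show "B [^] (int p ^ v) = A [^] (- (int p ^ v))" .
  obtain t where t: "b - 1 = int p ^ m * t" using b.dvd by (rule dvdE)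
  have not_t: "\<not> int p dvd t"
    using b.not_dvd unfolding t by (auto simp: mult.commute)
  have "prime (int p)" using p by simp
  then have not_ut: "\<not> int p dvd u * t" using not_u not_t prime_dvd_multD by blast
  obtain x where "\<forall>i. [i = i * (u * t) * x] (mod int (p ^ e))"
    using ex_inverse_prime_power[OF p not_ut, where e = e] .
  then have x: "A [^] (i :: int) = A [^] (i * (u * t) * x)" for i
    using int_pow_cong[OF A pow_A] by blast
  have "A [^] int (p ^ (v + m)) = A [^] (int p ^ (v + m) * (u * t) * x)"
    using x[of "int (p ^ (v + m))"] by simp
  also have "int p ^ (v + m) * (u * t) * x = w * (b - 1) * x"
    by (simp add: u t power_add)
  also have "A [^] (w * (b - 1) * x) = (A [^] (w * (b - 1))) [^] x"
    by (simp add: int_pow_pow)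
  finally show "A [^] (p ^ (v + m)) = \<one>"
    by (simp only: pows(4) int_pow_one int_pow_int)
  have "int (p ^ v) dvd pow_sum a (p ^ v)"
    using dvd_trans[OF dvd_power[of m "int p"] dvd] m
    by (intro dvd_pow_sum_self radical_dvd_prime_power p) simp
  then obtain y where y: "pow_sum a (p ^ v) = int p ^ v * y" unfolding of_nat_power by (rule dvdE)
  have "B \<otimes> A [^] (int p ^ v) = B \<otimes> (C [^] (p ^ v) \<otimes> A [^] (int p ^ v * y))"
    using pow_A_B[of "p ^ v"] com_B by (simp add: y m_assoc)
  then have "A [^] (int p ^ v) = C [^] (p ^ v) \<otimes> A [^] (int p ^ v * y)"
    by simp
  then have "C [^] (p ^ v) = A [^] (int p ^ v) \<otimes> inv (A [^] (int p ^ v * y))"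
    by (simp add: inv_solve_right)
  also have "\<dots> = A [^] (int p ^ v * (1 - y))"
    by (simp add: int_pow_diff right_diff_distrib)
  finally show "\<exists>z :: int. C [^] (int p ^ v) = A [^] (int p ^ v * z)"
    by (metis int_pow_int of_nat_power)
qed

text \<open>The powers of \<open>B\<close> and \<open>C\<close> with exponent p^v are powers of
  \<open>A\<close> commuting with everything here, so multiples of p^v in \<open>j\<close> and
  \<open>k\<close> can be moved into the exponent of \<open>A\<close>.\<close>

lemma ex_normal_form:
  fixes i j k :: nat
  assumes x: "x = A [^] i \<otimes> B [^] j \<otimes> C [^] k"
  shows "\<exists>i j k :: nat. i < p ^ (v + m) \<and> j < p ^ v \<and> k < p ^ v \<and> x = A [^] i \<otimes> B [^] j \<otimes> C [^] k"
proof -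
  define E where "E = p ^ v"
  have E: "E > 0" "int E = int p ^ v" using prime_gt_0_nat[OF p] by (simp_all add: E_def)
  obtain z :: int where z: "C [^] int E = A [^] (int E * z)"
    using eps_relations(5) unfolding E by blast
  have com: "A [^] (int E * t) \<otimes> y = y \<otimes> A [^] (int E * t)" if "y = B [^] (n::nat) \<or> y = C [^] n" for t n y
  proof -
    define W where "W = A [^] int E"
    have [simp]: "W \<in> carrier G" by (simp add: W_def)
    have "W \<otimes> B = B \<otimes> W" "W \<otimes> C = C \<otimes> W" using eps_relations(3,4) by (simp_all add: W_def E)
    then have "W \<otimes> y = y \<otimes> W"
      using that group_commutes_pow[of B W n] group_commutes_pow[of C W n] by auto
    then have "W [^] t \<otimes> y = y \<otimes> W [^] t" using that by (intro int_pow_commute) auto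
    then show ?thesis by (simp add: W_def int_pow_pow)
  qed
  have Ck: "C [^] k = C [^] (k mod E) \<otimes> A [^] (int E * (z * int (k div E)))"
  proof -
    have "C [^] k = C [^] (k mod E) \<otimes> C [^] (E * (k div E))"
      by (simp add: nat_pow_mult)
    also have "C [^] (E * (k div E)) = (C [^] int E) [^] int (k div E)"
      by (simp add: int_pow_int nat_pow_pow)
    finally show ?thesis by (simp add: z int_pow_pow mult.assoc)
  qed
  have Bj: "B [^] j = A [^] (int E * (- int (j div E))) \<otimes> B [^] (j mod E)"
  proof -
    have "B [^] j = B [^] (E * (j div E)) \<otimes> B [^] (j mod E)"
      by (simp add: nat_pow_mult)
    also have "B [^] (E * (j div E)) = (B [^] int E) [^] int (j div E)"
      by (simp add: int_pow_int nat_pow_pow)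
    finally show ?thesis using eps_relations(2) by (simp add: E int_pow_pow)
  qed
  have "x = A [^] int i \<otimes> (A [^] (int E * (- int (j div E))) \<otimes> B [^] (j mod E)) \<otimes> (A [^] (int E * (z * int (k div E))) \<otimes> C [^] (k mod E))"
    unfolding x Bj using Ck com[of "C [^] (k mod E)" "k mod E"] by (simp add: int_pow_int)
  also have "\<dots> = A [^] int i \<otimes> A [^] (int E * (- int (j div E))) \<otimes> (B [^] (j mod E) \<otimes> A [^] (int E * (z * int (k div E)))) \<otimes> C [^] (k mod E)"
    by (simp add: m_assoc)
  also have "B [^] (j mod E) \<otimes> A [^] (int E * (z * int (k div E))) = A [^] (int E * (z * int (k div E))) \<otimes> B [^] (j mod E)"
    using com[of "B [^] (j mod E)" "j mod E"] by simp
  also have "A [^] int i \<otimes> A [^] (int E * (- int (j div E))) \<otimes> (A [^] (int E * (z * int (k div E))) \<otimes> B [^] (j mod E)) \<otimes> C [^] (k mod E)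
      = A [^] (int i + int E * (- int (j div E)) + int E * (z * int (k div E))) \<otimes> B [^] (j mod E) \<otimes> C [^] (k mod E)"
    by (simp only: int_pow_mult[OF A]) (simp add: m_assoc)
  finally have x': "x = A [^] (int i + int E * (- int (j div E)) + int E * (z * int (k div E))) \<otimes> B [^] (j mod E) \<otimes> C [^] (k mod E)" .
  have "p ^ (v + m) > 0" using prime_gt_0_nat[OF p] by simp
  then obtain i' where "A [^] (int i + int E * (- int (j div E)) + int E * (z * int (k div E))) = A [^] (i' :: nat)" "i' < p ^ (v + m)"
    using int_pow_eq_nat_pow[OF A eps_relations(1)] by blast
  then show ?thesis
    using x' E(1) by (intro exI[of _ i'] exI[of _ "j mod E"] exI[of _ "k mod E"]) (simp flip: E_def)
qed

end

section \<open>Universal property of the presentation\<close>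

definition eval_word :: "('a, 'b) monoid_scheme \<Rightarrow> ('g \<Rightarrow> 'a) \<Rightarrow> 'g gword \<Rightarrow> 'a" where
  "eval_word G f w = foldr (\<lambda>(g, b) x. (if b then inv\<^bsub>G\<^esub> (f g) else f g) \<otimes>\<^bsub>G\<^esub> x) w \<one>\<^bsub>G\<^esub>"

context group
begin

context
  fixes f :: "'g \<Rightarrow> 'a"
  assumes f: "\<And>g. f g \<in> carrier G"
begin

lemma eval_word_Nil: "eval_word G f [] = \<one>"
  by (simp add: eval_word_def)

lemma eval_word_Cons: "eval_word G f ((g, b) # w) = (if b then inv (f g) else f g) \<otimes> eval_word G f w"
  by (simp add: eval_word_def)

lemma eval_word_closed [simp]: "eval_word G f w \<in> carrier G"
proof (induction w)
  case (Cons x w)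
  then show ?case using f by (cases x) (simp add: eval_word_Cons)
qed (simp add: eval_word_Nil)

lemma eval_word_append: "eval_word G f (u @ v) = eval_word G f u \<otimes> eval_word G f v"
proof (induction u)
  case (Cons x u)
  then show ?case using f by (cases x) (simp add: eval_word_Cons m_assoc)
qed (simp add: eval_word_Nil)

lemma eval_inv_word: "eval_word G f (inv_word w) = inv (eval_word G f w)"
proof (induction w)
  case (Cons x w)
  obtain g b where x: "x = (g, b)" by (cases x)
  have "inv_word (x # w) = inv_word w @ [(g, \<not> b)]" by (simp add: x inv_word_def)
  then show ?case
    using Cons f by (simp add: x eval_word_append eval_word_Cons eval_word_Nil inv_mult_group)
qed (simp add: eval_word_Nil inv_word_def)

lemma eval_replicate: "eval_word G f (concat (replicate n w)) = eval_word G f w [^] n"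
proof (induction n)
  case (Suc n)
  then show ?case
    by (simp only: replicate.simps concat.simps eval_word_append nat_pow_Suc2[OF eval_word_closed])
qed (simp add: eval_word_Nil)

lemma eval_pow_word: "eval_word G f (pow_word w k) = eval_word G f w [^] k"
  by (simp add: pow_word_def eval_replicate eval_inv_word int_pow_def2 nat_pow_inv del: pow_nat)

lemma pres_eq_eval_word:
  assumes R: "\<And>u v. (u, v) \<in> R \<Longrightarrow> eval_word G f u = eval_word G f v"
    and "pres_eq R u v"
  shows "eval_word G f u = eval_word G f v"
  using assms(2)
proof induction
  case (rel u v)
  then show ?case by (rule R)
next
  case (cancel g b)
  show ?case using f by (simp add: eval_word_Cons eval_word_Nil)
next
  case (append u u' v v')
  then show ?case by (simp only: eval_word_append)
qed simp_all

lemma presented_group_hom: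
  assumes R: "\<And>u v. (u, v) \<in> R \<Longrightarrow> eval_word G f u = eval_word G f v"
  obtains h where "h \<in> hom (presented_group R) G"
    "\<And>w. h (pres_class R w) = eval_word G f w"
proof -
  define h where "h X = eval_word G f (SOME w. w \<in> X)" for X
  have h: "h (pres_class R w) = eval_word G f w" for w
  proof -
    have "w \<in> pres_class R w" by (simp add: pres_class_def pres_eq.refl)
    then have "(SOME u. u \<in> pres_class R w) \<in> pres_class R w" by (rule someI)
    then have "pres_eq R w (SOME u. u \<in> pres_class R w)" by (simp add: pres_class_def)
    with R have "eval_word G f w = eval_word G f (SOME u. u \<in> pres_class R w)"
      by (rule pres_eq_eval_word)
    then show ?thesis by (simp only: h_def)
  qed
  have carrier: "\<exists>u. X = pres_class R u" if "X \<in> carrier (presented_group R)" for X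
    using that unfolding presented_group_def by auto
  have "h \<in> hom (presented_group R) G"
  proof (rule homI)
    fix X assume "X \<in> carrier (presented_group R)"
    then obtain u where "X = pres_class R u" using carrier by blast
    then show "h X \<in> carrier G" by (simp only: h eval_word_closed)
    fix Y assume "Y \<in> carrier (presented_group R)"
    then obtain v where "Y = pres_class R v" using carrier by blast
    then show "h (X \<otimes>\<^bsub>presented_group R\<^esub> Y) = h X \<otimes> h Y"
      using \<open>X = pres_class R u\<close> by (simp only: mult_pres_class h eval_word_append)
  qed
  then show thesis using h by (rule that)
qed

end

lemma commutator_closed [simp]:
  "x \<in> carrier G \<Longrightarrow> y \<in> carrier G \<Longrightarrow> commutator G x y \<in> carrier G"
  by (simp add: commutator_def)

lemma eval_conj_comm:
  assumes f: "\<And>g. f g \<in> carrier G"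
  shows "eval_word G f (conj_word (gen_word g) (comm_word (gen_word g) (gen_word h)))
    = inv (commutator G (f g) (f h)) \<otimes> f g \<otimes> commutator G (f g) (f h)"
proof -
  have "eval_word G f (comm_word (gen_word g) (gen_word h)) = commutator G (f g) (f h)"
    using f by (simp add: comm_word_def eval_word_append eval_inv_word eval_word_Cons eval_word_Nil
        commutator_def m_assoc)
  then show ?thesis
    using f by (simp add: conj_word_def eval_word_append eval_inv_word eval_word_Cons eval_word_Nil m_assoc)
qed

lemma commutator_swap:
  assumes "x \<in> carrier G" "y \<in> carrier G"
  shows "commutator G y x = inv (commutator G x y)"
  using assms by (simp add: commutator_def inv_mult_group m_assoc)

lemma eval_macdonald_rels_iff:
  assumes f: "\<And>g. f g \<in> carrier G"
  shows "(\<forall>(u, v) \<in> macdonald_rels a. eval_word G f u = eval_word G f v) \<longleftrightarrow>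
    macdonald_pair G (f GenA) (f GenB) (commutator G (f GenA) (f GenB)) a"
proof -
  define A B C where "A = f GenA" and "B = f GenB" and "C = commutator G A B"
  have [simp]: "A \<in> carrier G" "B \<in> carrier G" "C \<in> carrier G"
    using f by (simp_all add: A_def B_def C_def)
  have AB: "A \<otimes> B = B \<otimes> A \<otimes> C"
    by (simp add: C_def commutator_def m_assoc [symmetric]) (simp add: m_assoc)
  have 1: "inv C \<otimes> A \<otimes> C = A [^] a \<longleftrightarrow> A \<otimes> C = C \<otimes> A [^] a"
  proof
    assume "inv C \<otimes> A \<otimes> C = A [^] a"
    then have "C \<otimes> (inv C \<otimes> A \<otimes> C) = C \<otimes> A [^] a" by simp
    then show "A \<otimes> C = C \<otimes> A [^] a" by (simp add: m_assoc [symmetric])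
  next
    assume "A \<otimes> C = C \<otimes> A [^] a"
    then have "inv C \<otimes> A \<otimes> C = inv C \<otimes> (C \<otimes> A [^] a)" by (simp add: m_assoc)
    then show "inv C \<otimes> A \<otimes> C = A [^] a" by (simp add: m_assoc [symmetric])
  qed
  have 2: "C \<otimes> B \<otimes> inv C = B [^] a \<longleftrightarrow> C \<otimes> B = B [^] a \<otimes> C"
  proof
    assume "C \<otimes> B \<otimes> inv C = B [^] a"
    then have "C \<otimes> B \<otimes> inv C \<otimes> C = B [^] a \<otimes> C" by simp
    then show "C \<otimes> B = B [^] a \<otimes> C" by (simp add: m_assoc)
  next
    assume "C \<otimes> B = B [^] a \<otimes> C"
    then have "C \<otimes> B \<otimes> inv C = B [^] a \<otimes> C \<otimes> inv C" by simp
    then show "C \<otimes> B \<otimes> inv C = B [^] a" by (simp add: m_assoc)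
  qed
  have "(\<forall>(u, v) \<in> macdonald_rels a. eval_word G f u = eval_word G f v) \<longleftrightarrow>
      inv C \<otimes> A \<otimes> C = A [^] a \<and> C \<otimes> B \<otimes> inv C = B [^] a"
    using f commutator_swap[of A B]
    by (simp add: macdonald_rels_def Let_def eval_conj_comm eval_pow_word eval_word_Cons eval_word_Nil
        A_def [symmetric] B_def [symmetric] C_def [symmetric])
  also have "\<dots> \<longleftrightarrow> macdonald_pair G A B C a"
    unfolding 1 2 using AB group_axioms by (simp add: macdonald_pair_def macdonald_pair_axioms_def)
  finally show ?thesis by (simp add: A_def B_def C_def)
qed

end

lemma group_macdonald_group: "group (macdonald_group a)"
  by (simp add: macdonald_group_def group_presented_group)

lemma eval_word_pres_class:
  "eval_word (presented_group R) (\<lambda>g. pres_class R (gen_word g)) w = pres_class R w"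
proof -
  interpret group "presented_group R" by (rule group_presented_group)
  have closed: "pres_class R u \<in> carrier (presented_group R)" for u
    by (simp add: presented_group_def)
  show ?thesis
  proof (induction w)
    case Nil
    then show ?case by (simp add: eval_word_def) (simp add: presented_group_def)
  next
    case (Cons x w)
    obtain g b where x: "x = (g, b)" by (cases x)
    have "pres_class R [(g, True)] \<otimes>\<^bsub>presented_group R\<^esub> pres_class R [(g, False)] = \<one>\<^bsub>presented_group R\<^esub>"
      using pres_eq.cancel[of R g True] by (simp add: mult_pres_class pres_class_eq_iff) (simp add: presented_group_def pres_class_eq_iff)
    then have "inv\<^bsub>presented_group R\<^esub> (pres_class R [(g, False)]) = pres_class R [(g, True)]"
      using closed by (rule inv_equality) (rule closed)
    then show ?case
      using Cons by (cases b) (simp_all add: x eval_word_def mult_pres_class)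
  qed
qed

lemma macdonald_gen_closed: "macdonald_gen_elt a g \<in> carrier (macdonald_group a)"
  by (simp add: macdonald_gen_elt_def macdonald_group_def presented_group_def)

lemma macdonald_pair_gens:
  "macdonald_pair (macdonald_group a) (macdonald_gen_elt a GenA) (macdonald_gen_elt a GenB)
    (commutator (macdonald_group a) (macdonald_gen_elt a GenA) (macdonald_gen_elt a GenB)) a"
proof -
  interpret group "macdonald_group a" by (rule group_macdonald_group)
  have "eval_word (macdonald_group a) (macdonald_gen_elt a) u = eval_word (macdonald_group a) (macdonald_gen_elt a) v"
    if "(u, v) \<in> macdonald_rels a" for u v
    unfolding macdonald_group_def macdonald_gen_elt_def eval_word_pres_class
    using that by (simp add: pres_class_eq_iff pres_eq.rel)
  then show ?thesis
    using eval_macdonald_rels_iff[of "macdonald_gen_elt a" a] macdonald_gen_closed by blast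
qed

lemma generate_macdonald_gens:
  "generate (macdonald_group a) {macdonald_gen_elt a GenA, macdonald_gen_elt a GenB} = carrier (macdonald_group a)"
    (is "generate _ ?gens = _")
proof
  interpret group "macdonald_group a" by (rule group_macdonald_group)
  show "generate (macdonald_group a) ?gens \<subseteq> carrier (macdonald_group a)"
    using macdonald_gen_closed by (intro generate_incl) auto
  have gens: "macdonald_gen_elt a g \<in> ?gens" for g by (cases g) simp_all
  have "eval_word (macdonald_group a) (macdonald_gen_elt a) w \<in> generate (macdonald_group a) ?gens" for w
  proof (induction w)
    case Nil
    then show ?case by (simp add: eval_word_def generate.one)
  next
    case (Cons x w)
    obtain g b where x: "x = (g, b)" by (cases x)
    show ?case
      using Cons generate.eng[OF generate.incl[OF gens[of g]]] generate.eng[OF generate.inv[OF gens[of g]]]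
      by (cases b) (simp_all add: x eval_word_def)
  qed
  then show "carrier (macdonald_group a) \<subseteq> generate (macdonald_group a) ?gens"
    unfolding macdonald_group_def macdonald_gen_elt_def eval_word_pres_class
    by (auto simp: presented_group_def)
qed

lemma macdonald_group_hom:
  assumes "macdonald_pair H x y z a"
  obtains h where "h \<in> hom (macdonald_group a) H"
    "h (macdonald_gen_elt a GenA) = x" "h (macdonald_gen_elt a GenB) = y"
proof -
  interpret H: macdonald_pair H x y z a by (rule assms)
  define f where "f g = (case g of GenA \<Rightarrow> x | GenB \<Rightarrow> y)" for g
  have f: "f g \<in> carrier H" for g by (cases g) (simp_all add: f_def)
  have z: "z = commutator H x y"
    using H.C_eq by (simp add: commutator_def H.inv_mult_group H.m_assoc)
  have rels: "eval_word H f u = eval_word H f v" if "(u, v) \<in> macdonald_rels a" for u v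
    using H.eval_macdonald_rels_iff[of f a] f assms that by (auto simp: f_def z)
  obtain h where h: "h \<in> hom (presented_group (macdonald_rels a)) H"
      "\<And>w. h (pres_class (macdonald_rels a) w) = eval_word H f w"
    using H.presented_group_hom[of f "macdonald_rels a"] f rels by blast
  have "h (macdonald_gen_elt a g) = f g" for g
    using f by (simp add: macdonald_gen_elt_def h(2) H.eval_word_Cons H.eval_word_Nil)
  then show thesis
    using h(1) by (intro that[of h]) (simp_all add: macdonald_group_def f_def)
qed

section \<open>Internal products of coprime orders\<close>

text \<open>Meant for the subgroups generated by the \<open>p\<close>-parts and by the complementary
  parts of the two generators; the locale identifies them with the Sylow subgroup and with
  \<open>sylow_complement\<close>.\<close>

locale coprime_product = group G for G (structure) +
  fixes P Q :: "'a set" and p e :: nat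
  assumes p: "prime p"
    and P: "subgroup P G" and Q: "subgroup Q G"
    and finP: "finite P" and finQ: "finite Q"
    and commute: "\<And>x y. x \<in> P \<Longrightarrow> y \<in> Q \<Longrightarrow> x \<otimes> y = y \<otimes> x"
    and carrier: "\<And>x. x \<in> carrier G \<Longrightarrow> \<exists>u\<in>P. \<exists>v\<in>Q. x = u \<otimes> v"
    and cardP: "card P = p ^ e" and cardQ: "\<not> p dvd card Q"
begin

sublocale P: subgroup P G by (rule P)
sublocale Q: subgroup Q G by (rule Q)

lemma finite_carrier: "finite (carrier G)"
proof (rule finite_subset)
  show "carrier G \<subseteq> (\<lambda>(u, v). u \<otimes> v) ` (P \<times> Q)" using carrier by fastforce
  show "finite ((\<lambda>(u, v). u \<otimes> v) ` (P \<times> Q))" using finP finQ by simp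
qed

lemma coprime_cards: "coprime (card P) (card Q)"
  using prime_imp_coprime[OF p cardQ] by (simp add: cardP)

lemma subgroup_pow_card:
  assumes "subgroup H G" "x \<in> H" shows "x [^] card H = \<one>"
proof -
  interpret H: group "G\<lparr>carrier := H\<rparr>" using assms(1) by (rule subgroup_imp_group)
  have "x [^]\<^bsub>G\<lparr>carrier := H\<rparr>\<^esub> order (G\<lparr>carrier := H\<rparr>) = \<one>\<^bsub>G\<lparr>carrier := H\<rparr>\<^esub>"
    using assms(2) by (intro H.pow_order_eq_1) simp
  then show ?thesis by (simp add: order_def nat_pow_consistent[symmetric])
qed

lemma pow_coprime_one:
  assumes "x \<in> carrier G" "x [^] (r::nat) = \<one>" "x [^] (s::nat) = \<one>" "coprime r s"
  shows "x = \<one>"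
proof -
  have "ord x dvd r" "ord x dvd s" using assms by (simp_all add: pow_eq_id)
  then have "ord x dvd 1" using assms(4) by (metis coprime_def)
  then have "x [^] (1::nat) = \<one>" using assms(1) by (simp only: pow_eq_id)
  then show ?thesis using assms(1) by simp
qed

lemma Int_trivial: "x \<in> P \<Longrightarrow> x \<in> Q \<Longrightarrow> x = \<one>"
  using pow_coprime_one[OF _ subgroup_pow_card[OF P] subgroup_pow_card[OF Q] coprime_cards] by simp

lemma order_eq: "order G = card P * card Q"
proof (rule dvd_antisym)
  have "carrier G = P <#> Q"
  proof
    show "P <#> Q \<subseteq> carrier G" using P.subset Q.subset by (rule set_mult_closed)
    show "carrier G \<subseteq> P <#> Q"
    proof
      fix x assume "x \<in> carrier G"
      from carrier[OF this] show "x \<in> P <#> Q" unfolding set_mult_def by blast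
    qed
  qed
  then show "order G dvd card P * card Q"
    using card_set_mult_dvd[OF P finP Q finQ] by (simp add: order_def)
  have "card P dvd order G" "card Q dvd order G"
    using dvd_triv_right[of "card P" "card (rcosets P)"] dvd_triv_right[of "card Q" "card (rcosets Q)"]
    by (simp_all only: lagrange P Q)
  then show "card P * card Q dvd order G"
    using coprime_cards by (rule divides_mult)
qed

lemma card_Q_pos: "card Q > 0"
  using finQ Q.one_closed card_gt_0_iff by blast

lemma multiplicity_order: "multiplicity p (order G) = e"
proof -
  have "multiplicity p (order G) = multiplicity p (p ^ e) + multiplicity p (card Q)"
    unfolding order_eq cardP using p card_Q_pos prime_gt_0_nat[OF p]
    by (intro prime_elem_multiplicity_mult_distrib) simp_all
  also have "multiplicity p (p ^ e) = e"
    using prime_gt_1_nat[OF p] by (intro multiplicity_same_power) simp_all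
  also have "multiplicity p (card Q) = 0" using cardQ by (rule not_dvd_imp_multiplicity_0)
  finally show ?thesis by simp
qed

lemma pow_closed: "subgroup H G \<Longrightarrow> x \<in> H \<Longrightarrow> x [^] (n::nat) \<in> H"
  using subgroup_int_pow_closed[of H x "int n"] by (simp add: int_pow_int)

lemma pow_mult_split: "u \<in> P \<Longrightarrow> v \<in> Q \<Longrightarrow> (u \<otimes> v) [^] (n::nat) = u [^] n \<otimes> v [^] n"
  using commute by (intro pow_mult_distrib) auto

lemma split_one:
  assumes "u \<in> P" "v \<in> Q" "u \<otimes> v = \<one>" shows "u = \<one>" "v = \<one>"
proof -
  have "inv v = u" using assms by (intro inv_equality) simp_all
  then have "u \<in> Q" using Q.m_inv_closed[OF assms(2)] by simp
  then show "u = \<one>" using Int_trivial assms(1) by blast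
  then show "v = \<one>" using assms(2,3) by simp
qed

text \<open>The component in \<open>Q\<close> of an element of \<open>J\<close> has order dividing
  both \<open>card P\<close> and \<open>card Q\<close>, so it is trivial.\<close>

lemma sylow_unique:
  assumes "sylow_subgroup G p J" shows "J = P"
proof -
  have J: "subgroup J G" "card J = card P"
    using assms by (simp_all add: sylow_subgroup_def multiplicity_order cardP)
  have "x \<in> P" if x: "x \<in> J" for x
  proof -
    obtain u v where uv: "u \<in> P" "v \<in> Q" "x = u \<otimes> v"
      using carrier subgroup.mem_carrier[OF J(1) x] by blast
    have "u [^] card P \<otimes> v [^] card P = \<one>"
      using subgroup_pow_card[OF J(1) x] pow_mult_split[OF uv(1,2)] by (simp add: uv J(2))
    then have "v [^] card P = \<one>"
      using subgroup_pow_card[OF P uv(1)] uv(2) by simp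
    then have "v = \<one>"
      using pow_coprime_one[OF _ _ subgroup_pow_card[OF Q uv(2)] coprime_cards] uv(2) by simp
    then show ?thesis using uv by simp
  qed
  then have "J \<subseteq> P" by blast
  then show ?thesis using card_subset_eq[OF finP] J(2) by blast
qed

text \<open>Elements of a Sylow subgroup for a prime other than \<open>p\<close> have trivial
  component in \<open>P\<close>, which gives one inclusion. Conversely, the generated subgroup
  contains a Sylow subgroup for each such prime, so \<open>card Q\<close> divides its order.\<close>

lemma sylow_complement_eq: "sylow_complement G p = Q"
proof -
  define U where "U = \<Union>{H. \<exists>q. prime q \<and> q \<noteq> p \<and> sylow_subgroup G q H}"
  have U_carrier: "U \<subseteq> carrier G"
    unfolding U_def sylow_subgroup_def using subgroup.subset by blast
  have "x \<in> Q" if "x \<in> U" for x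
  proof -
    obtain H q where q: "prime q" "q \<noteq> p" "sylow_subgroup G q H" "x \<in> H"
      using \<open>x \<in> U\<close> unfolding U_def by blast
    then have H: "subgroup H G" "card H = q ^ multiplicity q (order G)"
      by (simp_all add: sylow_subgroup_def)
    obtain u v where uv: "u \<in> P" "v \<in> Q" "x = u \<otimes> v"
      using carrier subgroup.mem_carrier[OF H(1) q(4)] by blast
    have "u [^] card H \<otimes> v [^] card H = \<one>"
      using subgroup_pow_card[OF H(1) q(4)] pow_mult_split[OF uv(1,2)] by (simp add: uv)
    then have "u [^] card H = \<one>"
      using pow_closed[OF P uv(1)] pow_closed[OF Q uv(2)] by (rule split_one(1)[rotated 2])
    moreover have "coprime (card H) (card P)"
      unfolding H(2) cardP using primes_coprime[OF q(1) p q(2)] by simp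
    ultimately have "u = \<one>"
      using pow_coprime_one[OF _ _ subgroup_pow_card[OF P uv(1)]] uv(1) by simp
    then show ?thesis using uv by simp
  qed
  then have "U \<subseteq> Q" by (rule subsetI)
  then have sub: "generate G U \<subseteq> Q" using Q by (rule generate_subgroup_incl)
  define K where "K = generate G U"
  have K: "subgroup K G" unfolding K_def using U_carrier by (rule generate_is_subgroup)
  have finK: "finite K" using finite_subset[OF sub finQ] by (simp add: K_def)
  have cardK: "card K > 0" using finK subgroup.one_closed[OF K] card_gt_0_iff by blast
  have "card Q dvd card K"
  proof (rule multiplicity_le_imp_dvd)
    show "card Q \<noteq> 0" using card_Q_pos by simp
    fix q :: nat assume q: "prime q"
    show "multiplicity q (card Q) \<le> multiplicity q (card K)"
    proof (cases "q = p")
      case True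
      then show ?thesis using cardQ by (simp add: not_dvd_imp_multiplicity_0)
    next
      case False
      define s where "s = multiplicity q (order G)"
      have order_pos: "order G \<noteq> 0"
        using finite_carrier order_gt_0_iff_finite by simp
      have "q ^ s dvd order G" by (simp add: s_def multiplicity_dvd)
      then obtain r where "order G = q ^ s * r" by (rule dvdE)
      from sylow_thm[OF q group_axioms this finite_carrier]
      obtain H where H: "subgroup H G" "card H = q ^ s" by blast
      then have "sylow_subgroup G q H" by (simp add: sylow_subgroup_def s_def)
      with q False have "H \<in> {H. \<exists>q. prime q \<and> q \<noteq> p \<and> sylow_subgroup G q H}" by auto
      then have "H \<subseteq> U" unfolding U_def by (rule Union_upper)
      then have "H \<subseteq> K" unfolding K_def by (auto intro: generate.incl)
      then have "subgroup H (G\<lparr>carrier := K\<rparr>)" by (rule subgroup_incl[OF H(1) K])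
      from group.lagrange[OF subgroup_imp_group[OF K] this]
      have "card K = card H * card (rcosets\<^bsub>G\<lparr>carrier := K\<rparr>\<^esub> H)"
        by (simp add: order_def mult.commute)
      then have "card H dvd card K" by (rule dvdI)
      moreover have unit: "\<not> is_unit q" using q not_prime_unit by metis
      moreover have "card K \<noteq> 0" using cardK by (rule gr_implies_not0)
      ultimately have "s \<le> multiplicity q (card K)"
        unfolding H(2) using power_dvd_iff_le_multiplicity by metis
      moreover have "multiplicity q (card Q) \<le> s"
        unfolding s_def using order_pos dvd_triv_right[of "card Q" "card P"]
        by (intro dvd_imp_multiplicity_le) (simp_all only: order_eq not_False_eq_True)
      ultimately show ?thesis by (rule le_trans[rotated])
    qed
  qed
  then have "card Q \<le> card K" using cardK by (rule dvd_imp_le)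
  then have "K = Q"
    by (rule card_seteq[OF finQ sub[folded K_def]])
  then show ?thesis unfolding sylow_complement_def K_def U_def .
qed

lemma sylow_proj_eq:
  assumes "u \<in> P" "v \<in> Q" shows "sylow_proj G p P (u \<otimes> v) = u"
  unfolding sylow_proj_def sylow_complement_eq
proof (rule the_equality)
  show "u \<in> P \<and> (\<exists>z\<in>Q. u \<otimes> v = u \<otimes> z)" using assms by blast
  fix y assume "y \<in> P \<and> (\<exists>z\<in>Q. u \<otimes> v = y \<otimes> z)"
  then obtain z where yz: "y \<in> P" "z \<in> Q" "u \<otimes> v = y \<otimes> z" by blast
  have "(inv y \<otimes> u) \<otimes> (v \<otimes> inv z) = inv y \<otimes> (u \<otimes> v) \<otimes> inv z"
    using assms yz(1,2) by (simp add: m_assoc)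
  also have "\<dots> = \<one>"
    unfolding yz(3) using yz(1,2) by (simp add: m_assoc [symmetric])
  finally have "(inv y \<otimes> u) \<otimes> (v \<otimes> inv z) = \<one>" .
  moreover have "inv y \<otimes> u \<in> P" "v \<otimes> inv z \<in> Q" using assms yz(1,2) by simp_all
  ultimately have "inv y \<otimes> u = \<one>" using split_one(1) by blast
  then have "y \<otimes> (inv y \<otimes> u) = y" using yz(1) by simp
  then have "u = y" using assms(1) yz(1) by (simp add: m_assoc [symmetric])
  then show "y = u" by simp
qed

end

section \<open>A permutation model of the Sylow subgroup\<close>

lemma (in macdonald_prime) radical_dvd_power: "radical_dvd (p ^ e) (a - 1)"
  by (rule radical_dvd_prime_power[OF p_dvd p])

locale macdonald_model = macdonald_prime
begin

definition eps :: int where "eps = int p ^ v"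
definition M :: int where "M = int p ^ (v + m)"
text \<open>It measures \<open>C\<close> to the power \<open>eps\<close>: in A^n B = B C^n A^(s n)
  with n = \<open>eps\<close> and A^n central, one reads off C^n = A^(n - s n).\<close>

definition sigma :: int where "sigma = pow_sum a (p ^ v) div eps"
text \<open>\<open>pw\<close> and \<open>S\<close> extend a^k and s k to all integers
  \<open>k\<close>. By periodicity the values modulo \<open>M\<close> do not depend on the
  representative of \<open>k\<close>.\<close>

definition pw :: "int \<Rightarrow> int" where "pw k = a ^ nat (k mod M)"
definition S :: "int \<Rightarrow> int" where "S k = pow_sum a (nat (k mod M))"

lemma p_gt_0: "p > 0"
  using p by (rule prime_gt_0_nat)

lemma eps_pos: "eps > 0" and M_pos: "M > 0"
  using p_gt_0 by (simp_all add: eps_def M_def)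

lemma M_eq: "M = eps * int p ^ m"
  by (simp add: M_def eps_def power_add)

lemma M_int: "M = int (p ^ (v + m))"
  by (simp add: M_def)

lemma eps_dvd_M: "eps dvd M"
  by (simp add: M_eq)

lemma M_dvd_mult:
  assumes "eps dvd x" "int p ^ m dvd y" shows "M dvd x * y"
  using mult_dvd_mono[OF assms] by (simp only: M_eq)

lemma sigma: "pow_sum a (p ^ v) = eps * sigma"
  using dvd_pow_sum_self[OF radical_dvd_power[of v]] by (simp add: sigma_def eps_def)

lemma nat_mod_cong: "[nat (x mod M) = n] (mod p ^ (v + m)) \<longleftrightarrow> [x = int n] (mod M)"
proof -
  have "[nat (x mod M) = n] (mod p ^ (v + m)) \<longleftrightarrow> [int (nat (x mod M)) = int n] (mod M)"
    unfolding M_int by (rule cong_int_iff [symmetric])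
  also have "int (nat (x mod M)) = x mod M"
    using M_pos by simp
  finally show ?thesis by (simp add: cong_def)
qed

lemma pw_nat: "[x = int n] (mod M) \<Longrightarrow> [pw x = a ^ n] (mod M)"
  unfolding pw_def using power_periodic[OF radical_dvd_power] nat_mod_cong by (simp add: M_int)

lemma S_nat: "[x = int n] (mod M) \<Longrightarrow> [S x = pow_sum a n] (mod M)"
  unfolding S_def using pow_sum_periodic[OF radical_dvd_power] nat_mod_cong by (simp add: M_int)

lemma ex_nat_cong: "\<exists>n. [x = int n] (mod M)"
  using M_pos by (intro exI[of _ "nat (x mod M)"]) (simp add: cong_def)

lemma pw_add: "[pw (x + y) = pw x * pw y] (mod M)"
proof -
  obtain n n' where n: "[x = int n] (mod M)" "[y = int n'] (mod M)" using ex_nat_cong by metis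
  then have "[x + y = int (n + n')] (mod M)" by (simp add: cong_add)
  then have "[pw (x + y) = a ^ n * a ^ n'] (mod M)" using pw_nat by (metis power_add)
  moreover have "[pw x * pw y = a ^ n * a ^ n'] (mod M)" using n by (intro cong_mult pw_nat)
  ultimately show ?thesis using cong_sym cong_trans by metis
qed

lemma S_add: "[S (x + y) = S x + pw x * S y] (mod M)"
proof -
  obtain n n' where n: "[x = int n] (mod M)" "[y = int n'] (mod M)" using ex_nat_cong by metis
  then have "[x + y = int (n + n')] (mod M)" by (simp add: cong_add)
  then have "[S (x + y) = pow_sum a n + a ^ n * pow_sum a n'] (mod M)" using S_nat by (metis pow_sum_add)
  moreover have "[S x + pw x * S y = pow_sum a n + a ^ n * pow_sum a n'] (mod M)"
    using n by (intro cong_add cong_mult pw_nat S_nat)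
  ultimately show ?thesis using cong_sym cong_trans by metis
qed

lemma pw_0: "pw 0 = 1" and S_0: "S 0 = 0"
  by (simp_all add: pw_def S_def)

lemma pw_1: "[pw 1 = a] (mod M)" and S_1: "[S 1 = a] (mod M)"
  using pw_nat[of 1 1] S_nat[of 1 1] by simp_all

lemma dvd_pw: "int p ^ m dvd pw x - 1"
  unfolding pw_def by (rule dvd_power_minus_1)

text \<open>\<open>pw x\<close> is 1 modulo p^m, and \<open>M\<close> is \<open>eps\<close> times
  p^m. This is the arithmetic form of the centrality of A^eps.\<close>

lemma pw_absorb:
  assumes "eps dvd y" shows "[pw x * y = y] (mod M)"
proof -
  have "M dvd y * (pw x - 1)" using assms dvd_pw by (rule M_dvd_mult)
  then show ?thesis by (simp add: cong_iff_dvd_diff algebra_simps)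
qed

lemma a_absorb:
  assumes "eps dvd y" shows "[a * y = y] (mod M)"
proof -
  have "M dvd y * (a - 1)" using assms dvd by (rule M_dvd_mult)
  then show ?thesis by (simp add: cong_iff_dvd_diff algebra_simps)
qed

text \<open>It makes conjugation by C^eps trivial on \<open>A\<close>: s(p^v) provides
  \<open>eps\<close>, the factor \<open>a - 1\<close> provides p^m, and their product is a (a^(p^v)
  - 1).\<close>

lemma power_eps: "M dvd a ^ (p ^ v) - 1"
proof -
  have "M dvd pow_sum a (p ^ v) * (a - 1)"
    using dvd by (intro M_dvd_mult) (simp_all add: sigma)
  also have "pow_sum a (p ^ v) * (a - 1) = a * (a ^ (p ^ v) - 1)"
    using pow_sum_geometric[of a "p ^ v"] by (simp only: mult.commute)
  finally have "M dvd a * (a ^ (p ^ v) - 1)" .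
  moreover have "coprime M a" using coprime_a by (simp add: M_def)
  ultimately show ?thesis using coprime_dvd_mult_right_iff by metis
qed

lemma nat_mult_eps: "[eps * t = int (p ^ v * nat (t mod M))] (mod M)"
  using M_pos by (simp add: eps_def cong_def mod_mult_right_eq)

lemma pw_eps: "[pw (x + eps * t) = pw x] (mod M)"
proof -
  have "[pw (eps * t) = a ^ (p ^ v * nat (t mod M))] (mod M)"
    by (rule pw_nat[OF nat_mult_eps])
  moreover have "[a ^ (p ^ v * nat (t mod M)) = 1] (mod M)"
    using power_cong_1[OF power_eps] by (simp add: power_mult cong_iff_dvd_diff)
  ultimately have "[pw (eps * t) = 1] (mod M)" by (rule cong_trans)
  then have "[pw x * pw (eps * t) = pw x * 1] (mod M)" by (intro cong_mult cong_refl)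
  with pw_add show ?thesis unfolding mult_1_right by (rule cong_trans)
qed

lemma S_mult_eps: "[S (eps * t) = eps * sigma * t] (mod M)"
proof -
  define n where "n = nat (t mod M)"
  have "[S (eps * t) = pow_sum a (p ^ v * n)] (mod M)"
    unfolding n_def by (rule S_nat[OF nat_mult_eps])
  also have "pow_sum a (p ^ v * n) = eps * sigma * (\<Sum>i<n. a ^ (p ^ v * i))"
    by (simp add: pow_sum_mult sigma)
  also have "[eps * sigma * (\<Sum>i<n. a ^ (p ^ v * i)) = eps * sigma * (\<Sum>i<n. 1)] (mod M)"
    using power_cong_1[OF power_eps]
    by (intro cong_mult cong_sum cong_refl) (simp add: power_mult cong_iff_dvd_diff)
  also have "(\<Sum>i<n. 1) = t mod M"
    using M_pos by (simp add: n_def)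
  also have "[eps * sigma * (t mod M) = eps * sigma * t] (mod M)"
    by (intro cong_mult cong_refl) (simp add: cong_def)
  finally show ?thesis .
qed

lemma S_eps: "[S (x + eps * t) = S x + eps * sigma * t] (mod M)"
proof -
  have "[pw x * S (eps * t) = pw x * (eps * sigma * t)] (mod M)"
    by (intro cong_mult cong_refl S_mult_eps)
  also have "[pw x * (eps * sigma * t) = eps * sigma * t] (mod M)"
    by (rule pw_absorb) simp
  finally have "[S x + pw x * S (eps * t) = S x + eps * sigma * t] (mod M)"
    by (intro cong_add cong_refl)
  with S_add show ?thesis by (rule cong_trans)
qed

text \<open>With b = \<open>pw k\<close>, S(-b) is -s(b) divided by a^b modulo \<open>M\<close>, so
  this number is \<open>defect a b\<close> up to the unit a^b. Here the lower bound on the valuation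
  of defects enters the model.\<close>

lemma eps_dvd_defect: "eps dvd pw k + S (- pw k)"
proof -
  define b where "b = nat (pw k)"
  have b: "int b = pw k" "b = nat (a ^ nat (k mod M))"
    using a_pow_ge_1[of "nat (k mod M)"] by (simp_all add: b_def pw_def)
  have pwb: "[pw (int b) = a ^ b] (mod M)" and Sb: "[S (int b) = pow_sum a b] (mod M)"
    by (simp_all add: pw_nat S_nat)
  have "[0 = S (int b) + pw (int b) * S (- int b)] (mod M)"
    using S_add[of "int b" "- int b"] by (simp add: S_0)
  also have "[S (int b) + pw (int b) * S (- int b) = pow_sum a b + a ^ b * S (- int b)] (mod M)"
    by (intro cong_add cong_mult pwb Sb cong_refl)
  finally have "M dvd - (pow_sum a b + a ^ b * S (- int b))"
    by (simp add: cong_iff_dvd_diff)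
  then have "eps dvd pow_sum a b + a ^ b * S (- int b)"
    using eps_dvd_M dvd_trans by (simp only: dvd_minus_iff) blast
  moreover have "eps dvd defect a b"
    unfolding eps_def b(2) by (rule dvd_defect_power)
  ultimately have "eps dvd pow_sum a b + a ^ b * S (- int b) + defect a b"
    by (rule dvd_add)
  also have "pow_sum a b + a ^ b * S (- int b) + defect a b = a ^ b * (int b + S (- int b))"
    by (simp add: defect_def algebra_simps)
  finally have "eps dvd a ^ b * (int b + S (- int b))" .
  moreover have "coprime eps (a ^ b)" using coprime_a by (simp add: eps_def)
  ultimately show ?thesis using coprime_dvd_mult_right_iff b(1) by metis
qed

section \<open>Triples modulo the central relations and their translations\<close>

type_synonym triple = "int \<times> int \<times> int"

text \<open>The triple \<open>(j, k, i)\<close> stands for the group element \<open>B\<^sup>j C\<^sup>k A\<^sup>i\<close>. Two triples are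
  identified as forced by the relations \<open>A\<^bsup>eps\<^esup> B\<^bsup>eps\<^esup> = 1\<close>, \<open>C\<^bsup>eps\<^esup> = A\<^bsup>eps (1 - sigma)\<^esup>\<close> and \<open>A\<^sup>M = 1\<close>
  among central elements; \<open>norm\<close> picks a representative.\<close>

definition norm :: "triple \<Rightarrow> triple" where
  "norm = (\<lambda>(j, k, i). (j mod eps, k mod eps,
    (i - (j - j mod eps) - (sigma - 1) * (k - k mod eps)) mod M))"

definition X :: "triple set" where "X = {0..<eps} \<times> {0..<eps} \<times> {0..<M}"

definition rel :: "triple \<Rightarrow> triple \<Rightarrow> bool" where "rel x y \<longleftrightarrow> norm x = norm y"

lemma rel_iff: "rel (j, k, i) (j', k', i') \<longleftrightarrow>
  eps dvd j - j' \<and> eps dvd k - k' \<and> M dvd (i - i') - (j - j') - (sigma - 1) * (k - k')"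
proof -
  have "(i - (j - j mod eps) - (sigma - 1) * (k - k mod eps)) - (i' - (j' - j' mod eps) - (sigma - 1) * (k' - k' mod eps))
     = (i - i') - (j - j') - (sigma - 1) * (k - k')" if "j mod eps = j' mod eps" "k mod eps = k' mod eps"
    using that by (simp add: algebra_simps)
  note eq = this
  have 1: "rel (j, k, i) (j', k', i') \<longleftrightarrow> j mod eps = j' mod eps \<and> k mod eps = k' mod eps \<and>
    M dvd (i - (j - j mod eps) - (sigma - 1) * (k - k mod eps)) - (i' - (j' - j' mod eps) - (sigma - 1) * (k' - k' mod eps))"
    unfolding rel_def norm_def by (simp only: prod.case prod.inject mod_eq_dvd_iff[of _ M])
  show ?thesis
  proof (cases "j mod eps = j' mod eps \<and> k mod eps = k' mod eps")
    case True
    moreover from True have "eps dvd j - j' \<and> eps dvd k - k'" by (simp only: mod_eq_dvd_iff)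
    ultimately show ?thesis unfolding 1 eq[OF conjunct1[OF True] conjunct2[OF True]] by blast
  next
    case False
    moreover from False have "\<not> (eps dvd j - j' \<and> eps dvd k - k')" by (simp only: mod_eq_dvd_iff not_False_eq_True)
    ultimately show ?thesis unfolding 1 by blast
  qed
qed

lemma rel_cong:
  assumes "[j = j'] (mod M)" "[i = i'] (mod M)" shows "rel (j, k, i) (j', k, i')"
proof -
  have "M dvd j - j'" "M dvd i - i'" using assms by (simp_all add: cong_iff_dvd_diff)
  then show ?thesis unfolding rel_iff using dvd_trans[OF eps_dvd_M] by simp
qed

lemma rel_refl [simp]: "rel x x" by (simp add: rel_def)
lemma rel_sym: "rel x y \<Longrightarrow> rel y x" by (simp add: rel_def)
lemma rel_trans: "rel x y \<Longrightarrow> rel y z \<Longrightarrow> rel x z" by (simp add: rel_def)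

lemma norm_norm: "rel (norm x) x"
proof -
  obtain j k i where x: "x = (j, k, i)" by (cases x)
  define i' where "i' = i - (j - j mod eps) - (sigma - 1) * (k - k mod eps)"
  have "M dvd i' mod M - i'" by (simp add: mod_eq_dvd_iff [symmetric])
  moreover have "i' mod M - i - (j mod eps - j) - (sigma - 1) * (k mod eps - k) = i' mod M - i'"
    by (simp add: i'_def algebra_simps)
  moreover have "norm x = (j mod eps, k mod eps, i' mod M)"
    by (simp add: norm_def x i'_def)
  moreover have "eps dvd j mod eps - j" "eps dvd k mod eps - k"
    by (simp_all add: mod_eq_dvd_iff [symmetric])
  ultimately show ?thesis unfolding x by (simp only: rel_iff)
qed

lemma norm_in_X: "norm x \<in> X"
  using eps_pos M_pos by (auto simp: norm_def X_def split: prod.splits)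

lemma norm_X: "x \<in> X \<Longrightarrow> norm x = x"
  by (auto simp: norm_def X_def)

lemma finite_X: "finite X" and card_X: "card X = p ^ v * (p ^ v * p ^ (v + m))"
proof -
  show "finite X" by (simp add: X_def)
  have "nat eps = p ^ v" "nat M = p ^ (v + m)" by (simp_all add: eps_def M_int nat_power_eq)
  then show "card X = p ^ v * (p ^ v * p ^ (v + m))"
    by (simp add: X_def card_cartesian_product)
qed

definition rA :: "triple \<Rightarrow> triple" where "rA = (\<lambda>(j, k, i). (j, k, i + 1))"
definition rB :: "triple \<Rightarrow> triple" where "rB = (\<lambda>(j, k, i). (j + pw k, k + i, S i))"
definition rC :: "triple \<Rightarrow> triple" where "rC = (\<lambda>(j, k, i). (j, k + 1, a * i))"
text \<open>Comes from A^(-1) B^j = B^(-S(-j)) C^(-j) A^(-1) and A^(-1) C^k = C^k A^(-a^k). Left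
  multiplication by \<open>A\<close> itself would require inverting the map that sends j to
  -S(-j).\<close>

definition lA :: "triple \<Rightarrow> triple" where "lA = (\<lambda>(j, k, i). (- S (- j), k - j, i - pw k))"
definition lB :: "triple \<Rightarrow> triple" where "lB = (\<lambda>(j, k, i). (j + 1, k, i))"
definition lC :: "triple \<Rightarrow> triple" where "lC = (\<lambda>(j, k, i). (a * j, k + 1, i))"

definition compat :: "(triple \<Rightarrow> triple) \<Rightarrow> bool" where
  "compat f \<longleftrightarrow> (\<forall>x y. rel x y \<longrightarrow> rel (f x) (f y))"

lemma compatD: "compat f \<Longrightarrow> rel x y \<Longrightarrow> rel (f x) (f y)"
  unfolding compat_def by blast

lemma rel_cases:
  assumes "rel x y"
  obtains j k i t u w where "y = (j, k, i)"
    "x = (j + eps * t, k + eps * u, i + eps * t + (sigma - 1) * (eps * u) + M * w)"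
proof -
  obtain j k i j' k' i' where xy: "y = (j, k, i)" "x = (j', k', i')" by (cases x, cases y)
  then obtain t u w where "j' - j = eps * t" "k' - k = eps * u"
    "(i' - i) - (j' - j) - (sigma - 1) * (k' - k) = M * w"
    using assms unfolding xy rel_iff by (elim conjE dvdE)
  then have "j' = j + eps * t" "k' = k + eps * u" "i' = i + eps * t + (sigma - 1) * (eps * u) + M * w"
    by (simp_all add: algebra_simps)
  then show thesis using that xy by blast
qed

lemma compatI:
  assumes "\<And>j k i t u w. rel (f (j + eps * t, k + eps * u, i + eps * t + (sigma - 1) * (eps * u) + M * w)) (f (j, k, i))"
  shows "compat f"
  unfolding compat_def using assms rel_cases by metis

lemma rel_congI:
  assumes "[j = j' + eps * t] (mod M)" "k = k' + eps * u" "[i = i' + eps * t + (sigma - 1) * (eps * u)] (mod M)"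
  shows "rel (j, k, i) (j', k', i')"
proof -
  have "rel (j, k, i) (j' + eps * t, k, i' + eps * t + (sigma - 1) * (eps * u))"
    by (rule rel_cong[OF assms(1,3)])
  also have "rel (j' + eps * t, k, i' + eps * t + (sigma - 1) * (eps * u)) (j', k', i')"
    unfolding rel_iff assms(2) by (simp add: algebra_simps)
  finally (rel_trans) show ?thesis .
qed

lemma cong_M_multiple: "[x + M * w = x] (mod M)"
  by (simp add: cong_iff_dvd_diff)

lemma compat_rA: "compat rA"
  by (intro compatI) (simp add: rA_def rel_iff algebra_simps)

lemma compat_lB: "compat lB"
  by (intro compatI) (simp add: lB_def rel_iff algebra_simps)

lemma compat_rC: "compat rC"
proof (intro compatI)
  fix j k i t u w
  have "[a * (eps * (t + (sigma - 1) * u)) = eps * (t + (sigma - 1) * u)] (mod M)"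
    by (rule a_absorb) simp
  then have "[a * i + a * (eps * (t + (sigma - 1) * u)) + M * (a * w) = a * i + eps * (t + (sigma - 1) * u) + 0] (mod M)"
    by (intro cong_add cong_refl) (simp_all add: cong_0_iff)
  then show "rel (rC (j + eps * t, k + eps * u, i + eps * t + (sigma - 1) * (eps * u) + M * w)) (rC (j, k, i))"
    unfolding rC_def prod.case
    by (intro rel_congI[where t = t and u = u]) (simp_all add: algebra_simps)
qed

lemma compat_lC: "compat lC"
proof (intro compatI)
  fix j k i t u w
  have "[a * (eps * t) = eps * t] (mod M)" by (rule a_absorb) simp
  then have "[a * j + a * (eps * t) = a * j + eps * t] (mod M)"
    by (intro cong_add cong_refl)
  then show "rel (lC (j + eps * t, k + eps * u, i + eps * t + (sigma - 1) * (eps * u) + M * w)) (lC (j, k, i))"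
    unfolding lC_def prod.case
    by (intro rel_congI[where t = t and u = u] cong_M_multiple) (simp_all add: algebra_simps)
qed

text \<open>A shift of \<open>i\<close> by \<open>eps * y\<close> moves \<open>k\<close> by
  \<open>eps * y\<close> and \<open>S i\<close> by \<open>eps * sigma * y\<close>. This explains the
  weight \<open>sigma - 1\<close> in \<open>norm\<close>: after the change in \<open>k\<close> is
  charged with it, exactly the shift \<open>eps * y\<close> remains.\<close>

lemma compat_rB: "compat rB"
proof (intro compatI)
  fix j k i t u w
  define y where "y = t + (sigma - 1) * u + int p ^ m * w"
  have i: "i + eps * t + (sigma - 1) * (eps * u) + M * w = i + eps * y"
    by (simp add: y_def M_eq algebra_simps)
  have "[pw (k + eps * u) = pw k] (mod M)" by (rule pw_eps)
  then have "[j + eps * t + pw (k + eps * u) = j + eps * t + pw k] (mod M)"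
    by (intro cong_add cong_refl)
  moreover have "[S i + eps * sigma * y = S i + eps * t + (sigma - 1) * (eps * (u + y))] (mod M)"
    unfolding cong_iff_dvd_diff by (simp add: y_def M_eq algebra_simps)
  then have "[S (i + eps * y) = S i + eps * t + (sigma - 1) * (eps * (u + y))] (mod M)"
    using S_eps by (rule cong_trans[rotated])
  ultimately show "rel (rB (j + eps * t, k + eps * u, i + eps * t + (sigma - 1) * (eps * u) + M * w)) (rB (j, k, i))"
    unfolding rB_def prod.case i
    by (intro rel_congI[where t = t and u = "u + y"]) (simp_all add: algebra_simps)
qed

lemma compat_lA: "compat lA"
proof (intro compatI)
  fix j k i t u w
  have "[S (- j + eps * (- t)) = S (- j) + eps * sigma * (- t)] (mod M)" by (rule S_eps)
  then have "[- S (- j + eps * (- t)) = - (S (- j) + eps * sigma * (- t))] (mod M)"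
    by (simp only: cong_minus_minus_iff)
  then have 1: "[- S (- (j + eps * t)) = - S (- j) + eps * (sigma * t)] (mod M)"
    by (simp add: algebra_simps)
  have "[pw (k + eps * u) = pw k] (mod M)" by (rule pw_eps)
  then have "[(i + eps * t + (sigma - 1) * (eps * u) + M * w) - pw (k + eps * u)
      = (i + eps * t + (sigma - 1) * (eps * u)) - pw k] (mod M)"
    by (intro cong_diff cong_M_multiple)
  then have 2: "[(i + eps * t + (sigma - 1) * (eps * u) + M * w) - pw (k + eps * u)
      = (i - pw k) + eps * (sigma * t) + (sigma - 1) * (eps * (u - t))] (mod M)"
    by (simp add: algebra_simps)
  show "rel (lA (j + eps * t, k + eps * u, i + eps * t + (sigma - 1) * (eps * u) + M * w)) (lA (j, k, i))"
    unfolding lA_def prod.case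
    by (rule rel_congI[OF 1 _ 2]) (simp add: algebra_simps)
qed

text \<open>Since \<open>A\<^sup>i B = B C\<^sup>i A\<^bsup>S i\<^esup>\<close>, the maps \<open>rA\<close>, \<open>rB\<close>, \<open>rC\<close> are the right multiplications by \<open>A\<close>, \<open>B\<close>,
  \<open>C\<close>, and \<open>lA\<close>, \<open>lB\<close>, \<open>lC\<close> are the left multiplications by the inverse of \<open>A\<close>, by \<open>B\<close> and by \<open>C\<close>.
  They commute, and the left multiplications act transitively, so an identity between words in the
  right multiplications needs to be checked at the origin only.\<close>

definition equivariant :: "(triple \<Rightarrow> triple) \<Rightarrow> bool" where
  "equivariant f \<longleftrightarrow> compat f \<and> (\<forall>x. rel (f (lA x)) (lA (f x)) \<and> rel (f (lB x)) (lB (f x)) \<and> rel (f (lC x)) (lC (f x)))"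

lemma equivariant_rA: "equivariant rA"
  unfolding equivariant_def using compat_rA by (auto simp: rA_def lA_def lB_def lC_def algebra_simps)

lemma pw_Suc: "[pw (k + 1) = a * pw k] (mod M)"
proof -
  have "[pw k * pw 1 = pw k * a] (mod M)" by (intro cong_mult cong_refl pw_1)
  with pw_add have "[pw (k + 1) = pw k * a] (mod M)" by (rule cong_trans)
  then show ?thesis by (simp only: mult.commute)
qed

lemma equivariant_rC: "equivariant rC"
proof -
  have "rel (rC (lA (j, k, i))) (lA (rC (j, k, i)))" for j k i
  proof -
    have "[a * i - a * pw k = a * i - pw (k + 1)] (mod M)"
      by (intro cong_diff cong_refl) (rule cong_sym[OF pw_Suc])
    then have "rel (- S (- j), k + 1 - j, a * i - a * pw k) (- S (- j), k + 1 - j, a * i - pw (k + 1))"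
      by (intro rel_cong cong_refl)
    then show ?thesis by (simp add: rC_def lA_def algebra_simps)
  qed
  then show ?thesis
    unfolding equivariant_def using compat_rC by (auto simp: rC_def lB_def lC_def algebra_simps)
qed

text \<open>The substantial case is \<open>lA\<close>, that is, (A^(-1) x) B = A^(-1) (x B). The two
  sides differ by \<open>eps * t\<close> in the exponents of both \<open>B\<close> and
  \<open>A\<close>, where \<open>eps * t\<close> is the number from \<open>eps_dvd_defect\<close>;
  \<open>rel\<close> identifies them because A^eps B^eps = 1.\<close>

lemma equivariant_rB: "equivariant rB"
proof -
  have lC: "rel (rB (lC (j, k, i))) (lC (rB (j, k, i)))" for j k i
  proof -
    have "[a * j + pw (k + 1) = a * j + a * pw k] (mod M)"
      by (intro cong_add cong_refl pw_Suc)
    then have "rel (a * j + pw (k + 1), k + 1 + i, S i) (a * j + a * pw k, k + 1 + i, S i)"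
      by (intro rel_cong cong_refl)
    then show ?thesis by (simp add: rB_def lC_def algebra_simps)
  qed
  have lA: "rel (rB (lA (j, k, i))) (lA (rB (j, k, i)))" for j k i
  proof -
    define d where "d = pw k + S (- pw k)"
    obtain t where t: "d = eps * t" using eps_dvd_defect unfolding d_def by (rule dvdE)
    have absorb: "[pw x * pw k + pw x * S (- pw k) = eps * t] (mod M)" for x
      using pw_absorb[OF eps_dvd_defect, of x k] unfolding t [symmetric] d_def by (simp only: distrib_left)
    have "[S (- j + - pw k) = S (- j) + pw (- j) * S (- pw k)] (mod M)" by (rule S_add)
    moreover have "[pw (- j + k) = pw (- j) * pw k] (mod M)" by (rule pw_add)
    ultimately have "[S (- j + - pw k) - S (- j) + pw (- j + k)
        = (S (- j) + pw (- j) * S (- pw k)) - S (- j) + pw (- j) * pw k] (mod M)"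
      by (intro cong_add cong_diff cong_refl)
    also have "(S (- j) + pw (- j) * S (- pw k)) - S (- j) + pw (- j) * pw k = pw (- j) * pw k + pw (- j) * S (- pw k)"
      by simp
    finally have "[S (- j + - pw k) - S (- j) + pw (- j + k) = eps * t] (mod M)"
      using absorb cong_trans by blast
    then have 1: "[- S (- j) + pw (k - j) = - S (- (j + pw k)) + eps * t] (mod M)"
      unfolding cong_iff_dvd_diff by (simp add: algebra_simps)
    have "[S (i + - pw k) = S i + pw i * S (- pw k)] (mod M)" by (rule S_add)
    moreover have "[pw (i + k) = pw i * pw k] (mod M)" by (rule pw_add)
    ultimately have "[S (i + - pw k) - S i + pw (i + k)
        = (S i + pw i * S (- pw k)) - S i + pw i * pw k] (mod M)"
      by (intro cong_add cong_diff cong_refl)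
    also have "(S i + pw i * S (- pw k)) - S i + pw i * pw k = pw i * pw k + pw i * S (- pw k)"
      by simp
    finally have "[S (i + - pw k) - S i + pw (i + k) = eps * t] (mod M)"
      using absorb cong_trans by blast
    then have 2: "[S (i - pw k) = S i - pw (k + i) + eps * t + (sigma - 1) * (eps * 0)] (mod M)"
      unfolding cong_iff_dvd_diff by (simp add: algebra_simps)
    show ?thesis
      unfolding rB_def lA_def prod.case
      by (rule rel_congI[OF 1 _ 2]) simp
  qed
  show ?thesis
    unfolding equivariant_def using compat_rB lA lC by (auto simp: rB_def lB_def algebra_simps)
qed

lemma equivariant_comp:
  assumes "equivariant f" "equivariant g" shows "equivariant (\<lambda>x. f (g x))"
  using assms unfolding equivariant_def compat_def by (meson rel_trans)

lemma equivariant_id: "equivariant (\<lambda>x. x)"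
  by (simp add: equivariant_def compat_def)

lemma equivariant_funpow: "equivariant f \<Longrightarrow> equivariant (f ^^ n)"
  by (induction n) (simp_all add: equivariant_id equivariant_comp id_def comp_def)

text \<open>Modulo \<open>M\<close> every shift is a sum of unit steps in one direction, so
  iterating the three maps suffices. \<open>j\<close> is cleared before \<open>k\<close> is changed,
  and both before \<open>i\<close>, because \<open>lC\<close> is a plain shift only for
  \<open>j = 0\<close> and \<open>lA\<close> only for \<open>j = k = 0\<close>.\<close>

lemma left_transitive:
  assumes rel: "\<And>x y. rel x y \<Longrightarrow> P x \<Longrightarrow> P y"
    and l: "\<And>x. P x \<Longrightarrow> P (lA x)" "\<And>x. P x \<Longrightarrow> P (lB x)" "\<And>x. P x \<Longrightarrow> P (lC x)"
    and P: "P x"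
  shows "P y"
proof -
  have shift: "\<exists>n :: nat. [x + int n = y] (mod M)" for x y
    using ex_nat_cong[of "y - x"] by (metis add.commute cong_add_lcancel cong_sym diff_add_cancel)
  have j: "P (j', k, i)" if "P (j, k, i)" for j j' k i
  proof -
    have "P (j + int n, k, i)" for n
    proof (induction n)
      case (Suc n)
      then show ?case using l(2)[of "(j + int n, k, i)"] by (simp add: lB_def algebra_simps)
    qed (use that in simp)
    moreover obtain n where "[j + int n = j'] (mod M)" using shift by blast
    ultimately show ?thesis using rel rel_cong cong_refl by blast
  qed
  have k: "P (j', k', i)" if "P (j, k, i)" for j j' k k' i
  proof -
    have "P (0, k + int n, i)" for n
    proof (induction n)
      case (Suc n)
      then show ?case using l(3)[of "(0, k + int n, i)"] by (simp add: lC_def algebra_simps)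
    qed (use j that in simp)
    moreover obtain n where n: "[k + int n = k'] (mod M)" using shift by blast
    moreover have "rel (0, k + int n, i) (0, k', i)"
      using n dvd_trans[OF eps_dvd_M] by (simp add: rel_iff cong_iff_dvd_diff)
    ultimately show ?thesis using rel j by blast
  qed
  have i: "P (j', k', i')" if "P (j, k, i)" for j j' k k' i i'
  proof -
    have "P (0, 0, i - int n)" for n
    proof (induction n)
      case (Suc n)
      then show ?case using l(1)[of "(0, 0, i - int n)"] by (simp add: lA_def S_0 pw_0 algebra_simps)
    qed (use k that in simp)
    moreover obtain n where n: "[i' + int n = i] (mod M)" using shift by blast
    then have "[i - int n = i'] (mod M)"
      unfolding cong_iff_dvd_diff by (metis cong_iff_dvd_diff cong_sym diff_diff_eq2 diff_diff_add add.commute)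
    ultimately show ?thesis using rel rel_cong cong_refl k by blast
  qed
  show ?thesis using i P by (metis prod_cases3)
qed

text \<open>The image up to \<open>rel\<close> is stable under the left maps. On the finite set
  \<open>X\<close> surjectivity already gives a permutation, so no inverse maps have to be written
  down.\<close>

lemma equivariant_surj:
  assumes "equivariant f" shows "\<exists>x. rel (f x) y"
proof (rule left_transitive[where P = "\<lambda>y. \<exists>x. rel (f x) y" and x = "f (0, 0, 0)"])
  show "\<exists>z. rel (f z) y" if "rel x y" "\<exists>z. rel (f z) x" for x y
    using that rel_trans by blast
  have step: "\<exists>z. rel (f z) (l x)" if l: "compat l" and comm: "\<And>x. rel (f (l x)) (l (f x))" and ex: "\<exists>z. rel (f z) x" for l x
  proof -
    obtain z where z: "rel (f z) x" using ex by blast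
    have "rel (f (l z)) (l x)" using comm compatD[OF l z] by (rule rel_trans)
    then show ?thesis by blast
  qed
  have "\<And>x. rel (f (lA x)) (lA (f x))" "\<And>x. rel (f (lB x)) (lB (f x))" "\<And>x. rel (f (lC x)) (lC (f x))"
    using assms unfolding equivariant_def by blast+
  then show "\<exists>z. rel (f z) (lA x)" "\<exists>z. rel (f z) (lB x)" "\<exists>z. rel (f z) (lC x)" if "\<exists>z. rel (f z) x" for x
    using step[OF compat_lA _ that] step[OF compat_lB _ that] step[OF compat_lC _ that] by blast+
qed (use rel_refl in blast)

lemma equivariant_eq:
  assumes f: "equivariant f" and g: "equivariant g" and 0: "rel (f (0, 0, 0)) (g (0, 0, 0))"
  shows "rel (f x) (g x)"
proof (rule left_transitive[where P = "\<lambda>x. rel (f x) (g x)" and x = "(0, 0, 0)"])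
  show "rel (f y) (g y)" if "rel x y" "rel (f x) (g x)" for x y
    using that f g unfolding equivariant_def compat_def by (meson rel_sym rel_trans)
  have step: "rel (f (l x)) (g (l x))"
    if "compat l" "\<And>x. rel (f (l x)) (l (f x))" "\<And>x. rel (g (l x)) (l (g x))" "rel (f x) (g x)" for l x
    using rel_trans[OF that(2) rel_trans[OF compatD[OF that(1,4)] rel_sym[OF that(3)]]] .
  have fl: "\<And>x. rel (f (lA x)) (lA (f x))" "\<And>x. rel (f (lB x)) (lB (f x))" "\<And>x. rel (f (lC x)) (lC (f x))"
    using f unfolding equivariant_def by blast+
  have gl: "\<And>x. rel (g (lA x)) (lA (g x))" "\<And>x. rel (g (lB x)) (lB (g x))" "\<And>x. rel (g (lC x)) (lC (g x))"
    using g unfolding equivariant_def by blast+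
  show "rel (f (lA x)) (g (lA x))" "rel (f (lB x)) (g (lB x))" "rel (f (lC x)) (g (lC x))"
    if "rel (f x) (g x)" for x
    using that step[OF compat_lA fl(1) gl(1)] step[OF compat_lB fl(2) gl(2)] step[OF compat_lC fl(3) gl(3)] by blast+
qed (rule 0)

end

text \<open>Composition of right multiplications reverses the order of factors, so they satisfy the
  relations read backwards; inverting the permutations restores the order.\<close>

lemma (in group) macdonald_pair_inv:
  assumes [simp]: "x \<in> carrier G" "y \<in> carrier G" "z \<in> carrier G"
    and "y \<otimes> x = z \<otimes> x \<otimes> y" "z \<otimes> x = x [^] a \<otimes> z" "y \<otimes> z = z \<otimes> y [^] a"
  shows "macdonald_pair G (inv x) (inv y) (inv z) a"
proof
  have "inv (y \<otimes> x) = inv (z \<otimes> x \<otimes> y)" "inv (z \<otimes> x) = inv (x [^] a \<otimes> z)"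
    "inv (y \<otimes> z) = inv (z \<otimes> y [^] a)"
    by (simp_all only: assms(4-6))
  then show "inv x \<otimes> inv y = inv y \<otimes> inv x \<otimes> inv z"
    "inv x \<otimes> inv z = inv z \<otimes> inv x [^] a" "inv z \<otimes> inv y = inv y [^] a \<otimes> inv z"
    by (simp_all add: inv_mult_group int_pow_inv m_assoc)
qed simp_all

section \<open>Permutations of the normalized triples\<close>

context macdonald_model
begin

text \<open>The action of \<open>f\<close> on the classes of \<open>rel\<close>, transported to
  representatives; the restriction provides the extensionality that elements of
  \<open>BijGroup\<close> must have.\<close>

definition hat :: "(triple \<Rightarrow> triple) \<Rightarrow> triple \<Rightarrow> triple" where
  "hat f = restrict (\<lambda>x. norm (f x)) X"

lemma hat_Bij:
  assumes "equivariant f" shows "hat f \<in> carrier (BijGroup X)"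
proof -
  have compat: "compat f" using assms unfolding equivariant_def by blast
  have sub: "hat f ` X \<subseteq> X" unfolding hat_def by (rule image_subsetI) (simp add: norm_in_X)
  have "X \<subseteq> hat f ` X"
  proof
    fix y assume y: "y \<in> X"
    obtain x where "rel (f x) y" using equivariant_surj[OF assms] by blast
    then have "rel (f (norm x)) y" using compatD[OF compat norm_norm] rel_trans by blast
    then have "hat f (norm x) = y" using norm_in_X norm_X[OF y] by (simp add: hat_def rel_def)
    then show "y \<in> hat f ` X" using norm_in_X by blast
  qed
  then have "bij_betw (hat f) X X"
    using finite_surj_inj[OF finite_X] sub by (auto simp: bij_betw_def)
  then show ?thesis by (simp add: BijGroup_def Bij_def hat_def)
qed

lemma hat_mult:
  assumes f: "equivariant f" and g: "equivariant g"
  shows "hat f \<otimes>\<^bsub>BijGroup X\<^esub> hat g = hat (\<lambda>x. f (g x))"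
proof -
  have "compat f" using f unfolding equivariant_def by blast
  then have eq: "norm (f (norm y)) = norm (f y)" for y
    using compatD[OF _ norm_norm] unfolding rel_def by blast
  have "compose X (hat f) (hat g) = hat (\<lambda>x. f (g x))"
    unfolding compose_def hat_def by (rule restrict_ext) (simp add: eq norm_in_X)
  then show ?thesis
    using hat_Bij[OF f] hat_Bij[OF g] by (simp add: BijGroup_def)
qed

lemma hat_eq:
  assumes "equivariant f" "equivariant g" "rel (f (0, 0, 0)) (g (0, 0, 0))"
  shows "hat f = hat g"
  using equivariant_eq[OF assms] unfolding hat_def rel_def by simp

lemma hat_id: "hat (\<lambda>x. x) = \<one>\<^bsub>BijGroup X\<^esub>"
  using norm_X by (auto simp: hat_def BijGroup_def)

lemma hat_pow:
  assumes "equivariant f" shows "hat f [^]\<^bsub>BijGroup X\<^esub> (n::nat) = hat (f ^^ n)"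
proof (induction n)
  case 0
  then show ?case using hat_id by (simp add: nat_pow_def id_def)
next
  case (Suc n)
  have "hat f [^]\<^bsub>BijGroup X\<^esub> Suc n = hat (f ^^ n) \<otimes>\<^bsub>BijGroup X\<^esub> hat f"
    by (simp add: nat_pow_def Suc [unfolded nat_pow_def])
  also have "\<dots> = hat (\<lambda>x. (f ^^ n) (f x))"
    by (rule hat_mult[OF equivariant_funpow[OF assms] assms])
  also have "(\<lambda>x. (f ^^ n) (f x)) = f ^^ Suc n"
    by (simp only: funpow_Suc_right comp_def)
  finally show ?case .
qed

lemma rA_pow: "(rA ^^ n) (j, k, i) = (j, k, i + int n)"
  by (induction n) (simp_all add: rA_def)

lemma rB_pow: "(rB ^^ n) (0, 0, 0) = (int n, 0, 0)"
  by (induction n) (simp_all add: rB_def S_0 pw_0)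

lemma rC_pow: "(rC ^^ n) (j, k, 0) = (j, k + int n, 0)"
  by (induction n) (simp_all add: rC_def)

lemma a_nat: "int (nat a) = a"
  using a by simp

lemma hat_relations:
  shows "hat rB \<otimes>\<^bsub>BijGroup X\<^esub> hat rA = hat rC \<otimes>\<^bsub>BijGroup X\<^esub> hat rA \<otimes>\<^bsub>BijGroup X\<^esub> hat rB"
    and "hat rC \<otimes>\<^bsub>BijGroup X\<^esub> hat rA = hat rA [^]\<^bsub>BijGroup X\<^esub> a \<otimes>\<^bsub>BijGroup X\<^esub> hat rC"
    and "hat rB \<otimes>\<^bsub>BijGroup X\<^esub> hat rC = hat rC \<otimes>\<^bsub>BijGroup X\<^esub> hat rB [^]\<^bsub>BijGroup X\<^esub> a"
    and "hat rA [^]\<^bsub>BijGroup X\<^esub> (p ^ (v + m)) = \<one>\<^bsub>BijGroup X\<^esub>"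
    and "hat rB [^]\<^bsub>BijGroup X\<^esub> (p ^ (v + m)) = \<one>\<^bsub>BijGroup X\<^esub>"
proof -
  note A = equivariant_rA and B = equivariant_rB and C = equivariant_rC
    and comp = equivariant_comp and fp = equivariant_funpow
  have pow: "hat f [^]\<^bsub>BijGroup X\<^esub> a = hat (f ^^ nat a)" if "equivariant f" for f
    using hat_pow[OF that, of "nat a"] int_pow_int[of "BijGroup X" "hat f" "nat a"] by (simp only: a_nat)
  have "hat (\<lambda>x. rB (rA x)) = hat (\<lambda>x. rC (rA (rB x)))"
  proof (rule hat_eq[OF comp[OF B A] comp[OF C comp[OF A B]]])
    show "rel (rB (rA (0, 0, 0))) (rC (rA (rB (0, 0, 0))))"
      using rel_cong[OF cong_refl S_1, of 1 1] by (simp add: rA_def rB_def rC_def pw_0 S_0)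
  qed
  then show "hat rB \<otimes>\<^bsub>BijGroup X\<^esub> hat rA = hat rC \<otimes>\<^bsub>BijGroup X\<^esub> hat rA \<otimes>\<^bsub>BijGroup X\<^esub> hat rB"
    by (simp only: hat_mult[OF B A] hat_mult[OF C A] hat_mult[OF comp[OF C A] B])
  have "hat (\<lambda>x. rC (rA x)) = hat (\<lambda>x. (rA ^^ nat a) (rC x))"
  proof (rule hat_eq[OF comp[OF C A] comp[OF fp[OF A] C]])
    have "rC (rA (0, 0, 0)) = (0, 1, a)" "rC (0, 0, 0) = (0, 1, 0)"
      by (simp_all add: rA_def rC_def)
    then show "rel (rC (rA (0, 0, 0))) ((rA ^^ nat a) (rC (0, 0, 0)))"
      by (simp only: rA_pow a_nat add_0 rel_refl)
  qed
  then show "hat rC \<otimes>\<^bsub>BijGroup X\<^esub> hat rA = hat rA [^]\<^bsub>BijGroup X\<^esub> a \<otimes>\<^bsub>BijGroup X\<^esub> hat rC"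
    by (simp only: pow[OF A] hat_mult[OF C A] hat_mult[OF fp[OF A] C])
  have "hat (\<lambda>x. rB (rC x)) = hat (\<lambda>x. rC ((rB ^^ nat a) x))"
  proof (rule hat_eq[OF comp[OF B C] comp[OF C fp[OF B]]])
    have "rB (rC (0, 0, 0)) = (pw 1, 1, 0)" by (simp add: rB_def rC_def S_0)
    moreover have "rC ((rB ^^ nat a) (0, 0, 0)) = (a, 1, 0)" unfolding rB_pow a_nat by (simp add: rC_def)
    ultimately show "rel (rB (rC (0, 0, 0))) (rC ((rB ^^ nat a) (0, 0, 0)))"
      using rel_cong[OF pw_1 cong_refl] by (simp only:)
  qed
  then show "hat rB \<otimes>\<^bsub>BijGroup X\<^esub> hat rC = hat rC \<otimes>\<^bsub>BijGroup X\<^esub> hat rB [^]\<^bsub>BijGroup X\<^esub> a"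
    by (simp only: pow[OF B] hat_mult[OF B C] hat_mult[OF C fp[OF B]])
  have M0: "[0 + int (p ^ (v + m)) = 0] (mod M)" "[int (p ^ (v + m)) = 0] (mod M)"
    by (simp_all add: M_def cong_0_iff)
  have "hat (rA ^^ (p ^ (v + m))) = hat (\<lambda>x. x)"
    by (rule hat_eq[OF fp[OF A] equivariant_id]) (simp only: rA_pow rel_cong[OF cong_refl M0(1)])
  then show "hat rA [^]\<^bsub>BijGroup X\<^esub> (p ^ (v + m)) = \<one>\<^bsub>BijGroup X\<^esub>"
    by (simp only: hat_pow[OF A] hat_id)
  have "hat (rB ^^ (p ^ (v + m))) = hat (\<lambda>x. x)"
    by (rule hat_eq[OF fp[OF B] equivariant_id]) (simp only: rB_pow rel_cong[OF M0(2) cong_refl])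
  then show "hat rB [^]\<^bsub>BijGroup X\<^esub> (p ^ (v + m)) = \<one>\<^bsub>BijGroup X\<^esub>"
    by (simp only: hat_pow[OF B] hat_id)
qed

text \<open>Orbit and stabilizer: the group acts on \<open>X\<close> through \<open>h\<close>, and
  the image contains a permutation carrying the origin to any prescribed (j, k, i), namely that of
  rA^i rC^k rB^j.\<close>

lemma card_dvd_order_macdonald_group:
  assumes "[\<alpha> = a] (mod int p ^ (v + m))"
  shows "p ^ v * (p ^ v * p ^ (v + m)) dvd order (macdonald_group \<alpha>)"
proof -
  interpret H: group "BijGroup X" by (rule group_BijGroup)
  interpret G: group "macdonald_group \<alpha>" by (rule group_macdonald_group)
  note A = equivariant_rA and B = equivariant_rB and C = equivariant_rC
    and comp = equivariant_comp and fp = equivariant_funpow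
  note closed = hat_Bij[OF equivariant_rA] hat_Bij[OF equivariant_rB] hat_Bij[OF equivariant_rC]
  let ?inv = "\<lambda>x. inv\<^bsub>BijGroup X\<^esub> x"
  interpret pa: macdonald_pair "BijGroup X" "?inv (hat rA)" "?inv (hat rB)" "?inv (hat rC)" a
    by (rule H.macdonald_pair_inv[OF closed hat_relations(1-3)])
  have "macdonald_pair (BijGroup X) (?inv (hat rA)) (?inv (hat rB)) (?inv (hat rC)) \<alpha>"
  proof (rule pa.change_exponent)
    show "?inv (hat rA) [^]\<^bsub>BijGroup X\<^esub> (p ^ (v + m)) = \<one>\<^bsub>BijGroup X\<^esub>"
      "?inv (hat rB) [^]\<^bsub>BijGroup X\<^esub> (p ^ (v + m)) = \<one>\<^bsub>BijGroup X\<^esub>"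
      using closed hat_relations(4,5) by (simp_all add: H.nat_pow_inv)
    show "[a = \<alpha>] (mod int (p ^ (v + m)))" using assms by (simp add: cong_sym)
  qed
  then obtain h where h: "h \<in> hom (macdonald_group \<alpha>) (BijGroup X)"
    "h (macdonald_gen_elt \<alpha> GenA) = ?inv (hat rA)" "h (macdonald_gen_elt \<alpha> GenB) = ?inv (hat rB)"
    by (rule macdonald_group_hom)
  interpret h: group_hom "macdonald_group \<alpha>" "BijGroup X" h
    by (simp add: group_hom_def group_hom_axioms_def h(1) G.group_axioms H.group_axioms)
  interpret act: group_action "macdonald_group \<alpha>" X h
    by (simp add: group_action_def h.group_hom_axioms)
  interpret Im: subgroup "h ` carrier (macdonald_group \<alpha>)" "BijGroup X"
    by (rule h.img_is_subgroup)
  let ?Im = "h ` carrier (macdonald_group \<alpha>)"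
  have "?inv (hat rA) \<in> ?Im" "?inv (hat rB) \<in> ?Im"
    unfolding h(2,3) [symmetric] using macdonald_gen_closed by simp_all
  from this[THEN Im.m_inv_closed] have Im_AB: "hat rA \<in> ?Im" "hat rB \<in> ?Im"
    using closed by simp_all
  have "hat rC = hat rB \<otimes>\<^bsub>BijGroup X\<^esub> hat rA \<otimes>\<^bsub>BijGroup X\<^esub> ?inv (hat rB) \<otimes>\<^bsub>BijGroup X\<^esub> ?inv (hat rA)"
    unfolding hat_relations(1) using closed by (simp add: H.m_assoc)
  then have Im_C: "hat rC \<in> ?Im"
    using Im_AB by (simp only: Im.m_closed Im.m_inv_closed)
  have pow: "x [^]\<^bsub>BijGroup X\<^esub> (n::nat) \<in> ?Im" if "x \<in> ?Im" for x n
    using H.subgroup_int_pow_closed[OF Im.subgroup_axioms that, of "int n"] by (simp only: int_pow_int)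
  have zero: "(0, 0, 0) \<in> X" using eps_pos M_pos by (simp add: X_def)
  have "x \<in> orbit (macdonald_group \<alpha>) h (0, 0, 0)" if x: "x \<in> X" for x
  proof -
    obtain j' k' i' where "x = (j', k', i')" by (cases x)
    then have "x = (int (nat j'), int (nat k'), int (nat i'))" using x by (simp add: X_def)
    then obtain j k i where x': "x = (int j, int k, int i)" by blast
    define F where "F = (\<lambda>x. (rA ^^ i) ((rC ^^ k) ((rB ^^ j) x)))"
    have "hat rA [^]\<^bsub>BijGroup X\<^esub> i \<otimes>\<^bsub>BijGroup X\<^esub> (hat rC [^]\<^bsub>BijGroup X\<^esub> k \<otimes>\<^bsub>BijGroup X\<^esub> hat rB [^]\<^bsub>BijGroup X\<^esub> j) = hat F"
      unfolding F_def
      by (simp only: hat_pow[OF A] hat_pow[OF B] hat_pow[OF C] hat_mult[OF fp[OF C] fp[OF B]]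
          hat_mult[OF fp[OF A] comp[OF fp[OF C] fp[OF B]]])
    moreover have "hat rA [^]\<^bsub>BijGroup X\<^esub> i \<otimes>\<^bsub>BijGroup X\<^esub> (hat rC [^]\<^bsub>BijGroup X\<^esub> k \<otimes>\<^bsub>BijGroup X\<^esub> hat rB [^]\<^bsub>BijGroup X\<^esub> j) \<in> ?Im"
      using Im_AB Im_C by (intro Im.m_closed pow)
    ultimately obtain g where g: "g \<in> carrier (macdonald_group \<alpha>)" "hat F = h g" by auto
    have "F (0, 0, 0) = x" by (simp add: F_def x' rB_pow rC_pow rA_pow)
    then have "hat F (0, 0, 0) = x" using zero norm_X[OF x] by (simp add: hat_def)
    then show ?thesis using g by (auto simp: orbit_def)
  qed
  moreover have "orbit (macdonald_group \<alpha>) h (0, 0, 0) \<subseteq> X"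
    using act.element_image[OF _ zero] unfolding orbit_def by blast
  ultimately have "orbit (macdonald_group \<alpha>) h (0, 0, 0) = X" by blast
  then have "card X * card (stabilizer (macdonald_group \<alpha>) h (0, 0, 0)) = order (macdonald_group \<alpha>)"
    using act.orbit_stabilizer_theorem[OF zero] by simp
  then show ?thesis unfolding card_X by (rule dvdI[OF HOL.sym])
qed

end

section \<open>The normal form\<close>

lemma (in group) generate_commute:
  assumes "S \<subseteq> carrier G" "T \<subseteq> carrier G"
    and "\<And>s t. s \<in> S \<Longrightarrow> t \<in> T \<Longrightarrow> s \<otimes> t = t \<otimes> s"
    and "x \<in> generate G S" "y \<in> generate G T"
  shows "x \<otimes> y = y \<otimes> x"
proof -
  have aux: "x \<otimes> y = y \<otimes> x"
    if U: "U \<subseteq> carrier G" and y: "y \<in> carrier G" and com: "\<And>u. u \<in> U \<Longrightarrow> u \<otimes> y = y \<otimes> u"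
      and x: "x \<in> generate G U" for U x y
    using x
  proof (induction x rule: generate.induct)
    case one
    then show ?case using y by simp
  next
    case (incl h)
    then show ?case by (rule com)
  next
    case (inv h)
    then have h: "h \<in> carrier G" using U by blast
    from int_pow_commute[OF h h y com[OF inv], of "-1"] show ?case
      using h by (simp add: int_pow_neg)
  next
    case (eng h1 h2)
    then have "h1 \<in> carrier G" "h2 \<in> carrier G"
      using generate_in_carrier[OF U] by blast+
    then have "h1 \<otimes> h2 \<otimes> y = (h1 \<otimes> y) \<otimes> h2" using eng.IH(2) y by (simp add: m_assoc)
    also have "\<dots> = y \<otimes> (h1 \<otimes> h2)"
      unfolding eng.IH(1) using y \<open>h1 \<in> carrier G\<close> \<open>h2 \<in> carrier G\<close> by (simp add: m_assoc)
    finally show ?case .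
  qed
  have x: "x \<in> carrier G" using generate_in_carrier[OF assms(1,4)] .
  have "t \<otimes> x = x \<otimes> t" if t: "t \<in> T" for t
  proof (rule HOL.sym, rule aux[OF assms(1)])
    show "t \<in> carrier G" using t assms(2) by blast
  qed (use t assms(3,4) in auto)
  from aux[OF assms(2) x this assms(5)] show ?thesis by (rule HOL.sym)
qed

text \<open>Existence makes the map from the box of exponents onto \<open>J\<close> surjective, and
  equality of the cardinalities makes it injective.\<close>

lemma unique_normal_formI:
  assumes J: "finite J" "card J = i\<^sub>0 * (j\<^sub>0 * k\<^sub>0)"
    and ex: "\<And>x. x \<in> J \<Longrightarrow> \<exists>i j k. i < i\<^sub>0 \<and> j < j\<^sub>0 \<and> k < k\<^sub>0 \<and>
      x = A [^]\<^bsub>G\<^esub> (i::nat) \<otimes>\<^bsub>G\<^esub> B [^]\<^bsub>G\<^esub> (j::nat) \<otimes>\<^bsub>G\<^esub> C [^]\<^bsub>G\<^esub> (k::nat)"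
    and J': "\<And>(i::nat) (j::nat) (k::nat). A [^]\<^bsub>G\<^esub> i \<otimes>\<^bsub>G\<^esub> B [^]\<^bsub>G\<^esub> j \<otimes>\<^bsub>G\<^esub> C [^]\<^bsub>G\<^esub> k \<in> J"
  shows "unique_normal_form G J A B C i\<^sub>0 j\<^sub>0 k\<^sub>0"
proof -
  define box where "box = {..<i\<^sub>0} \<times> {..<j\<^sub>0} \<times> {..<k\<^sub>0}"
  define f where "f = (\<lambda>(i :: nat, j :: nat, k :: nat). A [^]\<^bsub>G\<^esub> i \<otimes>\<^bsub>G\<^esub> B [^]\<^bsub>G\<^esub> j \<otimes>\<^bsub>G\<^esub> C [^]\<^bsub>G\<^esub> k)"
  have image: "f ` box = J"
  proof
    show "f ` box \<subseteq> J" using J' by (auto simp: f_def)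
    show "J \<subseteq> f ` box"
    proof
      fix x assume "x \<in> J"
      then obtain i j k where "i < i\<^sub>0" "j < j\<^sub>0" "k < k\<^sub>0" "x = f (i, j, k)"
        using ex[of x] by (auto simp: f_def)
      then show "x \<in> f ` box" by (auto simp: box_def)
    qed
  qed
  have "card (f ` box) = card box" unfolding image J(2) by (simp add: box_def card_cartesian_product)
  then have inj: "inj_on f box" by (intro eq_card_imp_inj_on) (simp_all add: box_def)
  have "\<exists>!t. t \<in> box \<and> x = f t" if "x \<in> J" for x
  proof -
    obtain t where "t \<in> box" "x = f t" using \<open>x \<in> J\<close> image by blast
    then show ?thesis using inj by (auto simp: inj_on_def)
  qed
  then show ?thesis
    unfolding unique_normal_form_def
    by (simp add: box_def f_def case_prod_unfold mem_Times_iff conj_assoc)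
qed

section \<open>The Sylow subgroup of the Macdonald group\<close>

context
  fixes \<alpha> :: int and p m :: nat
  assumes \<alpha>: "\<alpha> \<notin> {0, 1, 2}" and p: "prime p" and p_dvd: "int p dvd \<alpha> - 1"
    and m_def: "m = multiplicity (int p) (\<alpha> - 1)"
begin

lemma m_pos: "1 \<le> m"
proof -
  have "\<not> is_unit (int p)" "\<alpha> - 1 \<noteq> 0" using p \<alpha> by auto
  then show ?thesis using p_dvd power_dvd_iff_le_multiplicity[of "\<alpha> - 1" "int p" 1] by (simp add: m_def)
qed

lemma p_pow_dvd: "int p ^ m dvd \<alpha> - 1"
  unfolding m_def by (rule multiplicity_dvd)

lemma not_p_pow_dvd: "\<not> int p ^ Suc m dvd \<alpha> - 1"
proof -
  have "\<not> is_unit (int p)" "\<alpha> - 1 \<noteq> 0" using p \<alpha> by auto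
  then show ?thesis using power_dvd_iff_le_multiplicity[of "\<alpha> - 1" "int p" "Suc m"] by (simp add: m_def)
qed

lemma sylow_normal_form:
  assumes J: "sylow_subgroup (macdonald_group \<alpha>) p J"
    and A: "A = sylow_proj (macdonald_group \<alpha>) p J (macdonald_gen_elt \<alpha> GenA)"
    and B: "B = sylow_proj (macdonald_group \<alpha>) p J (macdonald_gen_elt \<alpha> GenB)"
    and C: "C = commutator (macdonald_group \<alpha>) A B"
  defines "v \<equiv> macdonald_exponent p m \<alpha>"
  shows "unique_normal_form (macdonald_group \<alpha>) J A B C (p ^ (v + m)) (p ^ v) (p ^ v)"
    and "card J = p ^ (v + m) * (p ^ v * p ^ v)"
proof -
  define A0 B0 where "A0 = macdonald_gen_elt \<alpha> GenA" and "B0 = macdonald_gen_elt \<alpha> GenB"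
  define C0 where "C0 = commutator (macdonald_group \<alpha>) A0 B0"
  interpret G: macdonald_pair "macdonald_group \<alpha>" A0 B0 C0 \<alpha>
    unfolding A0_def B0_def C0_def by (rule macdonald_pair_gens)
  let ?G = "macdonald_group \<alpha>"
  obtain N where N: "radical_dvd N (\<alpha> - 1)" "A0 [^]\<^bsub>?G\<^esub> N = \<one>\<^bsub>?G\<^esub>" "B0 [^]\<^bsub>?G\<^esub> N = \<one>\<^bsub>?G\<^esub>"
    using G.ex_torsion \<alpha> by blast
  interpret T: macdonald_torsion ?G A0 B0 C0 \<alpha> N
    by (intro macdonald_torsion.intro macdonald_torsion_axioms.intro N G.macdonald_pair_axioms)
  define e where "e = multiplicity p N"
  have "N \<noteq> 0" "\<not> is_unit p" using T.N_pos p by auto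
  then obtain E where E: "N = p ^ e * E" "\<not> p dvd E"
    unfolding e_def by (rule multiplicity_decompose')
  define D where "D = p ^ e"
  have coprime: "coprime D E" using prime_imp_coprime[OF p E(2)] by (simp add: D_def)
  have DE: "N = D * E" "N = E * D" using E(1) by (simp_all add: D_def)
  obtain n where n: "[n = 1] (mod D)" "[n = 0] (mod E)"
    using binary_chinese_remainder_nat[OF coprime, of 1 0] by blast
  obtain l where l: "[l = 0] (mod D)" "[l = 1] (mod E)"
    using binary_chinese_remainder_nat[OF coprime, of 0 1] by blast
  have coprime': "coprime E D" using coprime by (simp add: coprime_commute)
  interpret P: macdonald_torsion ?G "A0 [^]\<^bsub>?G\<^esub> n" "B0 [^]\<^bsub>?G\<^esub> n" "C0 [^]\<^bsub>?G\<^esub> n" \<alpha> D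
    by (rule T.part[OF coprime DE(1) n l])
  interpret Q: macdonald_torsion ?G "A0 [^]\<^bsub>?G\<^esub> l" "B0 [^]\<^bsub>?G\<^esub> l" "C0 [^]\<^bsub>?G\<^esub> l" \<alpha> E
    by (rule T.part[OF coprime' DE(2) l(2,1) n(2,1)])
  define P where "P = generate ?G {A0 [^]\<^bsub>?G\<^esub> n, B0 [^]\<^bsub>?G\<^esub> n}"
  define Q where "Q = generate ?G {A0 [^]\<^bsub>?G\<^esub> l, B0 [^]\<^bsub>?G\<^esub> l}"
  have subP: "subgroup P ?G" and subQ: "subgroup Q ?G"
    unfolding P_def Q_def by (intro G.generate_is_subgroup; simp)+
  have com: "x \<otimes>\<^bsub>?G\<^esub> y = y \<otimes>\<^bsub>?G\<^esub> x" if "x \<in> P" "y \<in> Q" for x y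
  proof (rule G.generate_commute[OF _ _ _ that[unfolded P_def Q_def]])
    have "A0 [^]\<^bsub>?G\<^esub> n \<otimes>\<^bsub>?G\<^esub> A0 [^]\<^bsub>?G\<^esub> l = A0 [^]\<^bsub>?G\<^esub> l \<otimes>\<^bsub>?G\<^esub> A0 [^]\<^bsub>?G\<^esub> n"
      "B0 [^]\<^bsub>?G\<^esub> n \<otimes>\<^bsub>?G\<^esub> B0 [^]\<^bsub>?G\<^esub> l = B0 [^]\<^bsub>?G\<^esub> l \<otimes>\<^bsub>?G\<^esub> B0 [^]\<^bsub>?G\<^esub> n"
      by (simp_all add: G.nat_pow_mult add.commute)
    then show "s \<otimes>\<^bsub>?G\<^esub> t = t \<otimes>\<^bsub>?G\<^esub> s"
      if "s \<in> {A0 [^]\<^bsub>?G\<^esub> n, B0 [^]\<^bsub>?G\<^esub> n}" "t \<in> {A0 [^]\<^bsub>?G\<^esub> l, B0 [^]\<^bsub>?G\<^esub> l}" for s t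
      using that T.pow_parts_commute[OF coprime DE(1) n l] T.pow_parts_commute[OF coprime' DE(2) l(2,1) n(2,1)]
      by auto
  qed simp_all
  have "[n + l = 1] (mod D)" "[n + l = 1] (mod E)"
    using cong_add[OF n(1) l(1)] cong_add[OF n(2) l(2)] by simp_all
  then have nl: "[n + l = 1] (mod N)"
    unfolding DE(1) using coprime by (intro coprime_cong_mult_nat)
  have A0: "A0 = A0 [^]\<^bsub>?G\<^esub> n \<otimes>\<^bsub>?G\<^esub> A0 [^]\<^bsub>?G\<^esub> l"
    using G.nat_pow_cong[OF G.A N(2) nl] by (simp add: G.nat_pow_mult)
  have B0: "B0 = B0 [^]\<^bsub>?G\<^esub> n \<otimes>\<^bsub>?G\<^esub> B0 [^]\<^bsub>?G\<^esub> l"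
    using G.nat_pow_cong[OF G.B N(3) nl] by (simp add: G.nat_pow_mult)
  have memP: "A0 [^]\<^bsub>?G\<^esub> n \<in> P" "B0 [^]\<^bsub>?G\<^esub> n \<in> P" and memQ: "A0 [^]\<^bsub>?G\<^esub> l \<in> Q" "B0 [^]\<^bsub>?G\<^esub> l \<in> Q"
    unfolding P_def Q_def by (auto intro: generate.incl)
  have PQ: "subgroup (P <#>\<^bsub>?G\<^esub> Q) ?G"
  proof (rule G.subgroup_set_mult[OF subP subQ])
    show "Q <#>\<^bsub>?G\<^esub> P \<subseteq> P <#>\<^bsub>?G\<^esub> Q"
    proof
      fix x assume "x \<in> Q <#>\<^bsub>?G\<^esub> P"
      then obtain y z where "y \<in> Q" "z \<in> P" "x = y \<otimes>\<^bsub>?G\<^esub> z" unfolding set_mult_def by blast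
      then have "x = z \<otimes>\<^bsub>?G\<^esub> y" using com by simp
      then show "x \<in> P <#>\<^bsub>?G\<^esub> Q" using \<open>y \<in> Q\<close> \<open>z \<in> P\<close> unfolding set_mult_def by blast
    qed
  qed
  have "A0 \<in> P <#>\<^bsub>?G\<^esub> Q" "B0 \<in> P <#>\<^bsub>?G\<^esub> Q"
    using A0 B0 memP memQ unfolding set_mult_def by blast+
  then have "generate ?G {A0, B0} \<subseteq> P <#>\<^bsub>?G\<^esub> Q"
    by (intro G.generate_subgroup_incl PQ) simp
  then have carrier: "carrier ?G \<subseteq> P <#>\<^bsub>?G\<^esub> Q"
    using generate_macdonald_gens[of \<alpha>] by (simp add: A0_def B0_def)
  have cardP_dvd: "card P dvd p ^ (e * 3)"
    using P.card_generate_dvd by (simp add: P_def D_def power_mult)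
  then obtain e' where cardP: "card P = p ^ e'"
    using divides_primepow_nat[OF p] by blast
  have cardQ: "\<not> p dvd card Q"
  proof
    assume "p dvd card Q"
    then have "p dvd E ^ 3" using dvd_trans Q.card_generate_dvd by (simp add: Q_def) blast
    then show False using E(2) p prime_dvd_power by blast
  qed
  have ex_split: "\<exists>u\<in>P. \<exists>v\<in>Q. x = u \<otimes>\<^bsub>?G\<^esub> v" if "x \<in> carrier ?G" for x
    using subsetD[OF carrier that] unfolding set_mult_def by blast
  have fin: "finite P" "finite Q"
    unfolding P_def Q_def by (rule P.generate_finite, rule Q.generate_finite)
  interpret S: coprime_product ?G P Q p e'
    by (intro coprime_product.intro coprime_product_axioms.intro G.group_axioms p subP subQ fin com ex_split
        cardP cardQ)
  have JP: "J = P" using J by (rule S.sylow_unique)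
  have A': "A = A0 [^]\<^bsub>?G\<^esub> n" and B': "B = B0 [^]\<^bsub>?G\<^esub> n"
    unfolding A B JP A0_def [symmetric] B0_def [symmetric]
    using S.sylow_proj_eq[OF memP(1) memQ(1)] S.sylow_proj_eq[OF memP(2) memQ(2)] A0 B0 by simp_all
  have C': "C = C0 [^]\<^bsub>?G\<^esub> n"
    using P.C_eq unfolding C A' B' commutator_def by (simp add: G.inv_mult_group G.m_assoc)
  interpret U: macdonald_p_group ?G A B C \<alpha> p m e
    unfolding A' B' C'
    by (intro macdonald_p_group.intro macdonald_p_group_axioms.intro P.macdonald_pair_axioms p m_pos p_pow_dvd
        not_p_pow_dvd P.pow_A_N[unfolded D_def] P.pow_B_N[unfolded D_def])
  have ex: "\<exists>i j k :: nat. i < p ^ (v + m) \<and> j < p ^ v \<and> k < p ^ v \<and>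
      x = A [^]\<^bsub>?G\<^esub> i \<otimes>\<^bsub>?G\<^esub> B [^]\<^bsub>?G\<^esub> j \<otimes>\<^bsub>?G\<^esub> C [^]\<^bsub>?G\<^esub> k" if x: "x \<in> J" for x
  proof -
    obtain i j k :: nat where "x = A [^]\<^bsub>?G\<^esub> i \<otimes>\<^bsub>?G\<^esub> B [^]\<^bsub>?G\<^esub> j \<otimes>\<^bsub>?G\<^esub> C [^]\<^bsub>?G\<^esub> k"
      using P.ex_pow_A_B_C[OF x[unfolded JP P_def]] unfolding A' B' C' by blast
    then show ?thesis unfolding v_def by (rule U.ex_normal_form)
  qed
  have mem: "A [^]\<^bsub>?G\<^esub> i \<otimes>\<^bsub>?G\<^esub> B [^]\<^bsub>?G\<^esub> j \<otimes>\<^bsub>?G\<^esub> C [^]\<^bsub>?G\<^esub> k \<in> J" for i j k :: nat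
  proof -
    have "C \<in> P" using P.C_in_generate unfolding C' P_def .
    then show ?thesis
      unfolding JP using memP S.pow_closed[OF subP] by (intro S.P.m_closed) (simp_all add: A' B')
  qed
  obtain b where b: "macdonald_prime p m b" "[\<alpha> = b] (mod int p ^ (v + m))" "macdonald_exponent p m b = v"
    using ex_macdonald_prime[OF p m_pos p_pow_dvd not_p_pow_dvd] unfolding v_def by blast
  interpret M: macdonald_model p m b using b(1) by (simp add: macdonald_model_def)
  have "p ^ v * (p ^ v * p ^ (v + m)) dvd order ?G"
    using M.card_dvd_order_macdonald_group[of \<alpha>] b(2) unfolding b(3) by blast
  \<comment> \<open>The model gives a divisor of the order of the whole group. Being a power of
    \<open>p\<close>, it is coprime to \<open>card Q\<close> and must divide
    \<open>card P\<close>.\<close>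
  then have "p ^ v * (p ^ v * p ^ (v + m)) dvd card P * card Q"
    by (simp only: S.order_eq)
  moreover have "coprime (p ^ v * (p ^ v * p ^ (v + m))) (card Q)"
    using prime_imp_coprime[OF p cardQ] by simp
  ultimately have "p ^ v * (p ^ v * p ^ (v + m)) dvd card P"
    using coprime_dvd_mult_left_iff by blast
  moreover have "card P > 0" using cardP prime_gt_0_nat[OF p] by simp
  ultimately have "p ^ v * (p ^ v * p ^ (v + m)) \<le> card P" by (rule dvd_imp_le)
  moreover have "card J \<le> p ^ (v + m) * (p ^ v * p ^ v)"
  proof -
    have "J \<subseteq> (\<lambda>(i, j, k). A [^]\<^bsub>?G\<^esub> i \<otimes>\<^bsub>?G\<^esub> B [^]\<^bsub>?G\<^esub> j \<otimes>\<^bsub>?G\<^esub> C [^]\<^bsub>?G\<^esub> k) ` ({..<p ^ (v + m)} \<times> {..<p ^ v} \<times> {..<p ^ v})"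
      using ex by fastforce
    then have "card J \<le> card ({..<p ^ (v + m)} \<times> {..<p ^ v} \<times> {..<p ^ v})"
      by (rule surj_card_le[rotated]) simp
    then show ?thesis by (simp add: card_cartesian_product)
  qed
  ultimately show card: "card J = p ^ (v + m) * (p ^ v * p ^ v)"
    unfolding JP by (simp add: mult_ac)
  show "unique_normal_form ?G J A B C (p ^ (v + m)) (p ^ v) (p ^ v)"
    using S.finP card ex mem unfolding JP by (intro unique_normal_formI)
qed

end

theorem theorem7p1:
  fixes \<alpha> :: int and p m :: nat
    and J :: "macdonald_gen gword set set"
    and A B C :: "macdonald_gen gword set"
  assumes "\<alpha> \<notin> {0, 1, 2}"
    and "prime p"
    and "int p dvd \<alpha> - 1"
    and "m = multiplicity (int p) (\<alpha> - 1)"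
    and "sylow_subgroup (macdonald_group \<alpha>) p J"
    and "A = sylow_proj (macdonald_group \<alpha>) p J (macdonald_gen_elt \<alpha> GenA)"
    and "B = sylow_proj (macdonald_group \<alpha>) p J (macdonald_gen_elt \<alpha> GenB)"
    and "C = commutator (macdonald_group \<alpha>) A B"
  shows
    "(p > 3 \<or> (p = 3 \<and> (m > 1 \<or> [(\<alpha> - 1) div 3 = 1] (mod 3))) \<longrightarrow>
        unique_normal_form (macdonald_group \<alpha>) J A B C (p ^ (3 * m)) (p ^ (2 * m)) (p ^ (2 * m)) \<and>
        card J = p ^ (7 * m)) \<and>
     (p = 2 \<longrightarrow>
        unique_normal_form (macdonald_group \<alpha>) J A B C
          (2 ^ (3 * m - 1)) (2 ^ (2 * m - 1)) (2 ^ (2 * m - 1)) \<and>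
        card J = 2 ^ (7 * m - 3)) \<and>
     (p = 3 \<and> m = 1 \<and> [(\<alpha> - 1) div 3 = -1] (mod 3) \<longrightarrow>
        unique_normal_form (macdonald_group \<alpha>) J A B C 81 27 27 \<and>
        card J = 3 ^ 10)"
proof -
  define v where "v = macdonald_exponent p m \<alpha>"
  have nf: "unique_normal_form (macdonald_group \<alpha>) J A B C (p ^ (v + m)) (p ^ v) (p ^ v)"
    and card: "card J = p ^ (v + m) * (p ^ v * p ^ v)"
    unfolding v_def using sylow_normal_form[OF assms] by blast+
  have m: "1 \<le> m" using m_pos[OF assms(1-4)] .
  show ?thesis
  proof (intro conjI[of "_ \<longrightarrow> _"] impI)
    assume case1: "p > 3 \<or> (p = 3 \<and> (m > 1 \<or> [(\<alpha> - 1) div 3 = 1] (mod 3)))"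
    have "v = 2 * m"
    proof -
      have "\<not> [1 = -1 :: int] (mod 3)" by (simp add: cong_def)
      then have "\<not> ([(\<alpha> - 1) div 3 = 1] (mod 3) \<and> [(\<alpha> - 1) div 3 = -1] (mod 3))"
        using cong_sym cong_trans by blast
      then show ?thesis using case1 unfolding v_def macdonald_exponent_def by auto
    qed
    then have "v + m = 3 * m" "v + m + (v + v) = 7 * m" by simp_all
    then show "unique_normal_form (macdonald_group \<alpha>) J A B C (p ^ (3 * m)) (p ^ (2 * m)) (p ^ (2 * m)) \<and>
        card J = p ^ (7 * m)"
      using nf card \<open>v = 2 * m\<close> by (metis power_add)
  next
    assume p: "p = 2"
    then have "v = 2 * m - 1" unfolding v_def macdonald_exponent_def by simp
    then have "v + m = 3 * m - 1" "v + m + (v + v) = 7 * m - 3" using m by simp_all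
    then show "unique_normal_form (macdonald_group \<alpha>) J A B C
          (2 ^ (3 * m - 1)) (2 ^ (2 * m - 1)) (2 ^ (2 * m - 1)) \<and> card J = 2 ^ (7 * m - 3)"
      using nf card \<open>v = 2 * m - 1\<close> unfolding p by (metis power_add)
  next
    assume case3: "p = 3 \<and> m = 1 \<and> [(\<alpha> - 1) div 3 = -1] (mod 3)"
    then have "v = 3" unfolding v_def macdonald_exponent_def by simp
    then show "unique_normal_form (macdonald_group \<alpha>) J A B C 81 27 27 \<and> card J = 3 ^ 10"
      using nf card case3 by simp
  qed
qed

end
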